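(* Let $X^o$ be the complement in $\mathbb P^3$ of the union of two quadrics such that their intersection contains a smooth conic. Then the integral points of $X^o$ are potentially dense.
   Context: All varieties are defined over a number field. Let $X\subset\mathbb P^n$ be a projective variety over a number field $\mathbb K$, let $D\subset X$ be a closed algebraic subset and let $X^o=X\setminus D$ (here $X=\mathbb P^3$ and $D$ is the union of the two quadric surfaces). For a finite set $S$ of places of $\mathbb K$ containing the archimedean ones, a point $P\in X^o(\mathbb K)$ is $S$-integral with respect to $D$ if for no place $\nu\notin S$ does $P$ reduce modulo $\nu$ to a point of $D$. The integral points of $X^o$ are potentially dense if, after replacing $\mathbb K$ by a suitable finite extension and possibly enlarging the finite set $S$, the set of $S$-integral points of $X^o$ is Zariski-dense.
   Formalization: The conic is assumed to be a reduced component of the intersection (quadrics transverse at some point of it); otherwise the claim fails, e.g. for yz-w^2=0 and yz-w^2+x^2=0. This also excludes coinciding quadrics and quadrics with a shared or double plane containing the conic. *)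

theory Defs
  imports
    "HOL-Analysis.Analysis"
    "HOL-Library.Poly_Mapping"
    "HOL-Library.Numeral_Type"
    "HOL-Computational_Algebra.Polynomial"
begin

text \<open>Number fields are realised as subfields of the complex numbers, so that finite extensions
  are inclusions. Varieties are identified with their sets of complex points.\<close>

definition number_field :: "complex set \<Rightarrow> bool" where
  "number_field K \<longleftrightarrow>
     1 \<in> K \<and> (\<forall>x\<in>K. \<forall>y\<in>K. x - y \<in> K \<and> x * y \<in> K) \<and> (\<forall>x\<in>K. inverse x \<in> K) \<and>
     (\<exists>B. finite B \<and> K = module.span (\<lambda>(q::rat) (z::complex). of_rat q * z) B)"

text \<open>Values outside \<open>K\<close> are pinned by \<open>extensional\<close>, so that distinct functions are
  distinct absolute values on \<open>K\<close>.\<close>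

definition absolute_value :: "complex set \<Rightarrow> (complex \<Rightarrow> real) \<Rightarrow> bool" where
  "absolute_value K a \<longleftrightarrow>
     a \<in> extensional K \<and>
     (\<forall>x\<in>K. 0 \<le> a x \<and> (a x = 0 \<longleftrightarrow> x = 0)) \<and>
     (\<forall>x\<in>K. \<forall>y\<in>K. a (x * y) = a x * a y \<and> a (x + y) \<le> a x + a y) \<and>
     (\<exists>x\<in>K. x \<noteq> 0 \<and> a x \<noteq> 1)"

definition equivalent_absolute_values ::
  "complex set \<Rightarrow> ((complex \<Rightarrow> real) \<times> (complex \<Rightarrow> real)) set" where
  "equivalent_absolute_values K =
     {(a, b). absolute_value K a \<and> absolute_value K b \<and> (\<exists>s>0. \<forall>x\<in>K. b x = a x powr s)}"

definition places :: "complex set \<Rightarrow> (complex \<Rightarrow> real) set set" where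
  "places K = {a. absolute_value K a} // equivalent_absolute_values K"

definition archimedean_places :: "complex set \<Rightarrow> (complex \<Rightarrow> real) set set" where
  "archimedean_places K =
     {\<nu> \<in> places K. \<exists>a\<in>\<nu>. \<exists>x\<in>K. \<exists>y\<in>K. a (x + y) > max (a x) (a y)}"

text \<open>Polynomials in variables indexed by \<open>'n\<close>: finitely supported maps from exponent vectors to
  coefficients. Projective space of dimension \<open>CARD('n) - 1\<close> is represented by the nonzero
  vectors of \<open>complex ^ 'n\<close>; vectors differing by a nonzero scalar are the same point, and
  subsets are given by their affine cones without the origin.\<close>

type_synonym 'n mpoly = "('n \<Rightarrow>\<^sub>0 nat) \<Rightarrow>\<^sub>0 complex"

definition eval_mpoly :: "'n::finite mpoly \<Rightarrow> complex ^ 'n \<Rightarrow> complex" where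
  "eval_mpoly F x =
     (\<Sum>m\<in>Poly_Mapping.keys F. Poly_Mapping.lookup F m * (\<Prod>i\<in>UNIV. x $ i ^ Poly_Mapping.lookup m i))"

definition form :: "nat \<Rightarrow> complex set \<Rightarrow> 'n::finite mpoly \<Rightarrow> bool" where
  "form d R F \<longleftrightarrow>
     (\<forall>m\<in>Poly_Mapping.keys F.
        Poly_Mapping.lookup F m \<in> R \<and> (\<Sum>i\<in>UNIV. Poly_Mapping.lookup m i) = d)"

text \<open>The vector of formal partial derivatives, evaluated at a point. The truncated exponent
  \<open>0 - 1\<close> only occurs with coefficient 0.\<close>

definition grad :: "'n::finite mpoly \<Rightarrow> complex ^ 'n \<Rightarrow> complex ^ 'n" where
  "grad F x = (\<chi> i. \<Sum>m\<in>Poly_Mapping.keys F.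
     Poly_Mapping.lookup F m * of_nat (Poly_Mapping.lookup m i) *
     (\<Prod>j\<in>UNIV. x $ j ^ (Poly_Mapping.lookup m j - (if j = i then 1 else 0))))"

definition proj_space :: "(complex ^ 'n::finite) set" where
  "proj_space = {x. x \<noteq> 0}"

definition zero_locus :: "'n::finite mpoly set \<Rightarrow> (complex ^ 'n) set" where
  "zero_locus \<F> = {x \<in> proj_space. \<forall>F\<in>\<F>. eval_mpoly F x = 0}"

definition zariski_closed :: "(complex ^ 'n::finite) set \<Rightarrow> bool" where
  "zariski_closed Z \<longleftrightarrow> (\<exists>\<F>. (\<forall>F\<in>\<F>. \<exists>d. form d UNIV F) \<and> Z = zero_locus \<F>)"

definition zariski_dense_in :: "(complex ^ 'n::finite) set \<Rightarrow> (complex ^ 'n) set \<Rightarrow> bool" where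
  "zariski_dense_in T U \<longleftrightarrow> T \<subseteq> U \<and> (\<forall>Z. zariski_closed Z \<and> T \<subseteq> Z \<longrightarrow> U \<subseteq> Z)"

text \<open>The reduction of \<open>D\<close> modulo a non-archimedean place is the special fibre of the closure of
  \<open>D\<close> in projective space over the valuation ring: it is cut out by the reductions of all forms
  with integral coefficients that vanish on \<open>D\<close>. The coordinates of the point are scaled so that
  all are integral and one is a unit; a form then vanishes at the reduced point iff
  its value lies in the maximal ideal.\<close>

definition reduces_into ::
  "complex set \<Rightarrow> (complex \<Rightarrow> real) set \<Rightarrow> (complex ^ 'n::finite) set \<Rightarrow> complex ^ 'n \<Rightarrow> bool" where
  "reduces_into K \<nu> D x \<longleftrightarrow>
     (\<exists>a\<in>\<nu>. \<exists>c\<in>K.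
        (\<forall>i. a (c * x $ i) \<le> 1) \<and> (\<exists>i. a (c * x $ i) = 1) \<and>
        (\<forall>d F. form d {z \<in> K. a z \<le> 1} F \<and> (\<forall>y\<in>D. eval_mpoly F y = 0)
           \<longrightarrow> a (eval_mpoly F (c *s x)) < 1))"

definition integral_points ::
  "complex set \<Rightarrow> (complex \<Rightarrow> real) set set \<Rightarrow> (complex ^ 'n::finite) set
     \<Rightarrow> (complex ^ 'n) set \<Rightarrow> (complex ^ 'n) set" where
  "integral_points K S X D =
     {x \<in> X - D. (\<forall>i. x $ i \<in> K) \<and> (\<forall>\<nu>\<in>places K - S. \<not> reduces_into K \<nu> D x)}"

definition integral_points_potentially_dense ::
  "complex set \<Rightarrow> (complex ^ 'n::finite) set \<Rightarrow> (complex ^ 'n) set \<Rightarrow> bool" where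
  "integral_points_potentially_dense K X D \<longleftrightarrow>
     (\<exists>L S. number_field L \<and> K \<subseteq> L \<and> finite S \<and> archimedean_places L \<subseteq> S \<and> S \<subseteq> places L \<and>
        zariski_dense_in (integral_points L S X D) (X - D))"

definition transverse_at :: "'n::finite mpoly \<Rightarrow> 'n mpoly \<Rightarrow> complex ^ 'n \<Rightarrow> bool" where
  "transverse_at F G x \<longleftrightarrow>
     (\<forall>s t. s *s grad F x + t *s grad G x = 0 \<longrightarrow> s = 0 \<and> t = 0)"

text \<open>Conics are not required to be defined over the ground field, only over some number field.
  Transversality at every point (Jacobian criterion) forces the linear form to be nonzero and the
  quadratic form to be nondegenerate on the plane.\<close>

definition smooth_conic :: "(complex ^ 4) set \<Rightarrow> bool" where
  "smooth_conic C \<longleftrightarrow>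
     (\<exists>H q. form 1 {z. algebraic z} H \<and> form 2 {z. algebraic z} q \<and> C = zero_locus {H, q} \<and>
        (\<forall>x\<in>C. transverse_at H q x))"

text \<open>The conic \<open>C\<close> is contained in the scheme-theoretic intersection of the two surfaces as a
  reduced component: at some point, hence at the generic point, of \<open>C\<close> the intersection is
  transverse. This excludes quadrics tangent along all of \<open>C\<close>, such as \<open>yz - w^2\<close> and
  \<open>yz - w^2 + x^2\<close>: integral points of their complement yield units \<open>u, v\<close> with \<open>v - u\<close> a
  square, hence only finitely many ratios \<open>u / v\<close>, and they are never dense.\<close>

definition reduced_component_of_intersection ::
  "(complex ^ 4) set \<Rightarrow> 4 mpoly \<Rightarrow> 4 mpoly \<Rightarrow> bool" where
  "reduced_component_of_intersection C F G \<longleftrightarrow>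
     C \<subseteq> zero_locus {F} \<inter> zero_locus {G} \<and> (\<exists>x\<in>C. transverse_at F G x)"

end

theory Submission
  imports Defs
begin

text \<open>Over a suitable number field there are coordinates in which the quadrics are
  \<open>F = y\<^sup>2 + z m - f\<^sup>2 h\<^sup>2\<close> and \<open>G = \<beta> F + h (a h + b m + c y)\<close>, up to a common constant and
  up to order, with the common conic in the plane \<open>h = 0\<close>; the reducedness of the conic says
  \<open>(b, c) \<noteq> (0, 0)\<close>. Integral points are the \<open>S\<close>-integral vectors at which \<open>F = u\<close> and
  \<open>G = v\<close> are units, and powers of 2 supply all the units that are needed:

  \<^item> If \<open>c \<noteq> 0\<close>, put \<open>m = 1\<close>, choose units \<open>u, v, h\<close> and solve for \<open>y\<close>, then for \<open>z\<close>.

  \<^item> If \<open>c = 0\<close> (the plane \<open>a h + b m = 0\<close> is tangent to the conic) and \<open>\<beta> \<noteq> 0\<close>, choose \<open>h\<close>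
  such that \<open>u = 1 + 2 f h = (1 + f h)\<^sup>2 - f\<^sup>2 h\<^sup>2\<close> is a unit, and \<open>v = \<beta> u w\<close> with a unit
  \<open>w\<close> congruent to 1 modulo \<open>h\<close>. This determines \<open>m\<close>, and the parabola
  \<open>y\<^sup>2 + z m = (1 + f h)\<^sup>2\<close> has the integral points with \<open>y = 1 + f h + j m\<close>.

  \<^item> If \<open>c = \<beta> = 0\<close>, put \<open>h = 1\<close>, choose \<open>m\<close> such that \<open>v = a + b m\<close> is a unit, and
  \<open>u = (r\<^sup>2 - f\<^sup>2) w\<close> with a constant \<open>r\<close> and a unit \<open>w\<close> congruent to 1 modulo \<open>m\<close>; then
  \<open>y = r + j m\<close> gives an integral \<open>z\<close>.

  In each case a form that vanishes at all these points vanishes identically.\<close>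

section \<open>Number fields\<close>

text \<open>The frame is chosen so that a point \<open>P\<close> of the conic lies on the plane
  \<open>a h + b m + c y = 0\<close>. Then \<open>z\<close> occurs only in \<open>F = u\<close>,
  which is solved for \<open>z\<close> last, and the obstacle is the division by \<open>m\<close>.
  If \<open>c \<noteq> 0\<close>, the variable \<open>y\<close> absorbs the value \<open>v\<close>,
  so \<open>m = 1\<close> is allowed. If \<open>c = 0\<close>, the value \<open>v\<close> is tied to
  \<open>m\<close> and \<open>h\<close>, and \<open>y\<^sup>2\<close> has to be congruent to
  \<open>u + f\<^sup>2 h\<^sup>2\<close> modulo \<open>m\<close>; \<open>u\<close> is chosen to make
  the latter a known square modulo \<open>m\<close>, and \<open>j\<close> runs through the
  \<open>y\<close> in one residue class. Units congruent to 1 modulo a non-unit are powers of a unit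
  that has this property. Only finitely many constants may be inverted, and \<open>S\<close> has to
  be finite, so a nonzero element of a number field must be shown to be a unit at almost all places.
  Places are classes of absolute values, and the argument avoids ideals: Ostrowski's estimates show
  that the relevant absolute values order the rationals in the same way, and separating elements
  bound the number of such places by the degree.\<close>

interpretation rat_complex: vector_space "\<lambda>(q::rat) (z::complex). of_rat q * z"
  by unfold_locales (auto simp: algebra_simps of_rat_add of_rat_mult)

section \<open>Subrings of the complex numbers\<close>

definition subring :: "complex set \<Rightarrow> bool" where
  "subring R \<longleftrightarrow> 1 \<in> R \<and> (\<forall>x\<in>R. \<forall>y\<in>R. x - y \<in> R \<and> x * y \<in> R)"

lemma subring_1: "subring R \<Longrightarrow> 1 \<in> R"
  by (simp add: subring_def)

lemma subring_diff: "subring R \<Longrightarrow> x \<in> R \<Longrightarrow> y \<in> R \<Longrightarrow> x - y \<in> R"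
  by (simp add: subring_def)

lemma subring_mult: "subring R \<Longrightarrow> x \<in> R \<Longrightarrow> y \<in> R \<Longrightarrow> x * y \<in> R"
  by (simp add: subring_def)

lemma subring_0: "subring R \<Longrightarrow> 0 \<in> R"
  using subring_diff[of R 1 1] subring_1[of R] by simp

lemma subring_minus: "subring R \<Longrightarrow> x \<in> R \<Longrightarrow> - x \<in> R"
  using subring_diff[of R 0 x] subring_0[of R] by simp

lemma subring_add: "subring R \<Longrightarrow> x \<in> R \<Longrightarrow> y \<in> R \<Longrightarrow> x + y \<in> R"
  using subring_diff[of R x "- y"] subring_minus[of R y] by simp

lemma subring_power: "subring R \<Longrightarrow> x \<in> R \<Longrightarrow> x ^ n \<in> R"
  by (induction n) (auto intro: subring_1 subring_mult)

lemma subring_sum: "subring R \<Longrightarrow> (\<And>i. i \<in> A \<Longrightarrow> f i \<in> R) \<Longrightarrow> sum f A \<in> R"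
  by (induction A rule: infinite_finite_induct) (auto intro: subring_0 subring_add)

lemma subring_prod: "subring R \<Longrightarrow> (\<And>i. i \<in> A \<Longrightarrow> f i \<in> R) \<Longrightarrow> prod f A \<in> R"
  by (induction A rule: infinite_finite_induct) (auto intro: subring_1 subring_mult)

lemma subring_of_nat: "subring R \<Longrightarrow> of_nat n \<in> R"
  by (induction n) (auto intro: subring_0 subring_1 subring_add)

lemma subring_numeral: "subring R \<Longrightarrow> numeral n \<in> R"
  using subring_of_nat[of R "numeral n"] by simp

lemmas subring_intros = subring_0 subring_1 subring_diff subring_mult subring_minus subring_add
  subring_power subring_sum subring_prod subring_of_nat subring_numeral

lemma number_field_iff:
  "number_field K \<longleftrightarrow>
     subring K \<and> (\<forall>x\<in>K. inverse x \<in> K) \<and> (\<exists>B. finite B \<and> K = rat_complex.span B)"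
  by (auto simp: number_field_def subring_def)

lemma number_field_subring: "number_field K \<Longrightarrow> subring K"
  by (simp add: number_field_iff)

lemma number_field_inverse: "number_field K \<Longrightarrow> x \<in> K \<Longrightarrow> inverse x \<in> K"
  by (simp add: number_field_iff)

lemma number_field_divide: "number_field K \<Longrightarrow> x \<in> K \<Longrightarrow> y \<in> K \<Longrightarrow> x / y \<in> K"
  by (simp add: divide_inverse number_field_inverse number_field_subring subring_mult)

lemma number_field_scale: "number_field K \<Longrightarrow> x \<in> K \<Longrightarrow> of_rat q * x \<in> K"
  by (auto simp: number_field_iff intro: rat_complex.span_scale)

lemma number_field_of_rat: "number_field K \<Longrightarrow> of_rat q \<in> K"
  using number_field_scale[of K 1 q] by (simp add: number_field_subring subring_1)

section \<open>Relations between powers, and adjunction of roots\<close>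

lemma rational_relation_powers:
  assumes "finite B" and "\<And>i. y ^ i \<in> rat_complex.span B"
  obtains n :: nat and c :: "nat \<Rightarrow> rat"
  where "c n \<noteq> 0" and "(\<Sum>i\<le>n. of_rat (c i) * y ^ i) = 0"
proof -
  let ?N = "card B"
  have "\<exists>c. (\<exists>i\<le>?N. c i \<noteq> 0) \<and> (\<Sum>i\<le>?N. of_rat (c i) * y ^ i) = 0"
  \<comment> \<open>\<open>dependent\<close> speaks of sets, so a coincidence among the
    \<open>?N + 1\<close> powers, which is itself a relation, is treated apart.\<close>
  proof (cases "inj_on (\<lambda>i. y ^ i) {..?N}")
    case False
    then obtain i j where ij: "i \<le> ?N" "j \<le> ?N" "i \<noteq> j" "y ^ i = y ^ j"
      by (auto simp: inj_on_def)
    define c :: "nat \<Rightarrow> rat" where "c = (\<lambda>k. if k = i then 1 else if k = j then - 1 else 0)"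
    have "(\<Sum>k\<le>?N. of_rat (c k) * y ^ k)
        = (\<Sum>k\<le>?N. (if k = i then y ^ i else 0) - (if k = j then y ^ j else 0))"
      using ij by (intro sum.cong) (auto simp: c_def)
    also have "\<dots> = 0"
      using ij by (simp add: sum_subtractf)
    finally show ?thesis
      using ij by (intro exI[of _ c]) (auto simp: c_def)
  next
    case True
    let ?S = "(\<lambda>i. y ^ i) ` {..?N}"
    have "card ?S = ?N + 1"
      using True by (simp add: card_image)
    moreover have "?S \<subseteq> rat_complex.span B"
      using assms(2) by auto
    ultimately have "rat_complex.dependent ?S"
      using rat_complex.independent_span_bound[OF assms(1), of ?S] by auto
    then obtain u where u: "\<exists>v\<in>?S. u v \<noteq> 0" "(\<Sum>v\<in>?S. of_rat (u v) * v) = 0"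
      using rat_complex.dependent_finite[of ?S] by auto
    then show ?thesis
      by (intro exI[of _ "\<lambda>i. u (y ^ i)"]) (auto simp: sum.reindex[OF True])
  qed
  then obtain c where c: "\<exists>i\<le>?N. c i \<noteq> 0" "(\<Sum>i\<le>?N. of_rat (c i) * y ^ i) = 0"
    by blast
  \<comment> \<open>The relation is cut off at its last nonzero coefficient, so that it can later be
    made monic.\<close>
  define n where "n = Max {i. i \<le> ?N \<and> c i \<noteq> 0}"
  have fin: "finite {i. i \<le> ?N \<and> c i \<noteq> 0}"
    by simp
  have n: "n \<le> ?N" "c n \<noteq> 0"
    using Max_in[OF fin] c(1) by (auto simp: n_def)
  have "c i = 0" if "i \<le> ?N" "i > n" for i
  proof (rule ccontr)
    assume "c i \<noteq> 0"
    then have "i \<le> n"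
      unfolding n_def using that(1) by (intro Max_ge fin) simp
    with that(2) show False by simp
  qed
  then have "(\<Sum>i\<le>?N. of_rat (c i) * y ^ i) = (\<Sum>i\<le>n. of_rat (c i) * y ^ i)"
    using n by (intro sum.mono_neutral_right) auto
  with c(2) n show ?thesis
    using that by auto
qed

lemma number_field_relation_powers:
  assumes "number_field K" and "y \<in> K"
  obtains n :: nat and c :: "nat \<Rightarrow> rat"
  where "c n \<noteq> 0" and "(\<Sum>i\<le>n. of_rat (c i) * y ^ i) = 0"
proof -
  obtain B where B: "finite B" "K = rat_complex.span B"
    using assms(1) by (auto simp: number_field_iff)
  moreover have "y ^ i \<in> rat_complex.span B" for i
    using subring_power[OF number_field_subring[OF assms(1)] assms(2)] B by simp
  ultimately show ?thesis
    using rational_relation_powers[OF B(1), of y] that by metis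
qed

text \<open>A finite-dimensional domain over a field is a field: a relation between the powers of
  \<open>y\<close>, divided by the lowest power that occurs, has a nonzero constant term and so
  exhibits the inverse of \<open>y\<close>.\<close>

lemma subring_finite_dim_number_field:
  assumes R: "subring R" and B: "finite B" "R = rat_complex.span B"
  shows "number_field R"
proof -
  have "inverse y \<in> R" if y: "y \<in> R" for y
  proof (cases "y = 0")
    case True
    then show ?thesis
      using R by (simp add: subring_0)
  next
    case False
    have pw: "y ^ i \<in> R" for i
      using R y by (rule subring_power)
    obtain n c where n: "c n \<noteq> 0" "(\<Sum>i\<le>n. of_rat (c i) * y ^ i) = 0"
      by (rule rational_relation_powers[OF B(1) pw[unfolded B(2)]])
    define j where "j = (LEAST i. c i \<noteq> 0)"
    have j: "c j \<noteq> 0" "j \<le> n"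
      unfolding j_def using n(1) by (rule LeastI, rule Least_le)
    have j': "c i = 0" if "i < j" for i
      using not_less_Least[OF that[unfolded j_def]] by simp
    have "0 = (\<Sum>i\<in>{j..n}. of_rat (c i) * y ^ i)"
      unfolding n(2)[symmetric] using j' by (intro sum.mono_neutral_right) auto
    also have "\<dots> = of_rat (c j) * y ^ j + (\<Sum>i\<in>{Suc j..n}. of_rat (c i) * y ^ i)"
      using j(2) by (rule sum.atLeast_Suc_atMost)
    also have "(\<Sum>i\<in>{Suc j..n}. of_rat (c i) * y ^ i)
        = y ^ j * y * (\<Sum>i\<in>{Suc j..n}. of_rat (c i) * y ^ (i - Suc j))"
      unfolding sum_distrib_left
    proof (intro sum.cong refl)
      fix i assume "i \<in> {Suc j..n}"
      then have "y ^ i = y ^ (j + 1 + (i - Suc j))"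
        by simp
      also have "\<dots> = y ^ j * y * y ^ (i - Suc j)"
        by (simp only: power_add power_one_right)
      finally show "of_rat (c i) * y ^ i = y ^ j * y * (of_rat (c i) * y ^ (i - Suc j))"
        by simp
    qed
    finally have eq: "y ^ j * (of_rat (c j)
        + y * (\<Sum>i\<in>{Suc j..n}. of_rat (c i) * y ^ (i - Suc j))) = 0"
      by (simp add: algebra_simps)
    let ?s = "\<Sum>i\<in>{Suc j..n}. of_rat (c i) * y ^ (i - Suc j)"
    have "y * ?s = - of_rat (c j)"
      using eq False by (simp add: add_eq_0_iff)
    then have "y * (of_rat (- inverse (c j)) * ?s) = of_rat (- inverse (c j)) * - of_rat (c j)"
      by (simp only: mult.left_commute[of y])
    also have "\<dots> = 1"
      using j(1) by (simp flip: of_rat_minus of_rat_mult)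
    finally have "inverse y = of_rat (- inverse (c j)) * ?s"
      by (rule inverse_unique)
    moreover have "?s \<in> R"
      using pw B(2) by (auto intro!: rat_complex.span_sum rat_complex.span_scale)
    ultimately show ?thesis
      using B(2) rat_complex.span_scale by metis
  qed
  with R B show ?thesis
    by (auto simp: number_field_iff)
qed

text \<open>\<open>L'\<close> is the ring \<open>L[x]\<close>. The equation for \<open>x\<close>
  expresses \<open>x ^ n\<close> by lower powers, so a spanning set of \<open>L\<close> times the
  powers below \<open>n\<close> spans \<open>L'\<close>, and finite dimension makes it a
  field.\<close>

lemma number_field_adjoin_root:
  assumes L: "number_field L" and p: "\<And>i. coeff p i \<in> L" "p \<noteq> 0" and x: "poly p x = 0"
  shows "\<exists>L'. number_field L' \<and> L \<subseteq> L' \<and> x \<in> L'"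
proof -
  note sub = number_field_subring[OF L]
  obtain B where B: "finite B" "L = rat_complex.span B"
    using L by (auto simp: number_field_iff)
  define L' where "L' = {poly q x | q. \<forall>i. coeff q i \<in> L}"
  define n where "n = degree p"
  define B' where "B' = (\<lambda>(b, i). b * x ^ i) ` (B \<times> {..<n})"
  have L'_sub: "subring L'"
    unfolding subring_def
  proof (intro conjI ballI)
    have "\<forall>i. coeff [:1:] i \<in> L"
      by (auto simp: coeff_pCons subring_0[OF sub] subring_1[OF sub] split: nat.splits)
    then show "1 \<in> L'"
      unfolding L'_def by (intro CollectI exI[of _ "[:1:]"]) simp
  next
    fix u v assume "u \<in> L'" "v \<in> L'"
    then obtain q r where qr: "u = poly q x" "v = poly r x" "\<forall>i. coeff q i \<in> L" "\<forall>i. coeff r i \<in> L"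
      by (auto simp: L'_def)
    then show "u - v \<in> L'"
      unfolding L'_def by (intro CollectI exI[of _ "q - r"]) (auto intro: subring_diff[OF sub])
    show "u * v \<in> L'"
      unfolding L'_def using qr
      by (intro CollectI exI[of _ "q * r"])
        (auto simp: coeff_mult intro!: subring_sum[OF sub] subring_mult[OF sub])
  qed
  have L_L': "L \<subseteq> L'"
  proof
    fix l assume "l \<in> L"
    then have "\<forall>i. coeff [:l:] i \<in> L"
      by (auto simp: coeff_pCons subring_0[OF sub] split: nat.splits)
    then show "l \<in> L'"
      unfolding L'_def by (intro CollectI exI[of _ "[:l:]"]) simp
  qed
  have x_L': "x \<in> L'"
  proof -
    have "\<forall>i. coeff [:0, 1:] i \<in> L"
      by (auto simp: coeff_pCons subring_0[OF sub] subring_1[OF sub] split: nat.splits)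
    then show "x \<in> L'"
      unfolding L'_def by (intro CollectI exI[of _ "[:0, 1:]"]) simp
  qed
  have low: "l * x ^ i \<in> rat_complex.span B'" if "l \<in> L" "i < n" for l i
  proof -
    from that(1) have "l \<in> rat_complex.span B"
      using B by simp
    then show ?thesis
    proof (induction rule: rat_complex.span_induct_alt)
      case base
      then show ?case
        by (simp add: rat_complex.span_zero)
    next
      case (step c b y)
      have "b * x ^ i \<in> rat_complex.span B'"
        using step(1) that(2) by (intro rat_complex.span_base) (auto simp: B'_def)
      then have "of_rat c * (b * x ^ i) + y * x ^ i \<in> rat_complex.span B'"
        using step by (intro rat_complex.span_add rat_complex.span_scale)
      then show ?case
        by (simp add: algebra_simps)
    qed
  qed
  have lc: "coeff p n \<noteq> 0"
    using p(2) by (simp add: n_def)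
  have "0 = (\<Sum>j<n. coeff p j * x ^ j) + coeff p n * x ^ n"
    using x by (simp add: poly_altdef n_def lessThan_Suc_atMost[symmetric])
  then have xn: "x ^ n = (\<Sum>j<n. - (coeff p j / coeff p n) * x ^ j)"
    using lc by (simp add: sum_negf sum_divide_distrib[symmetric] field_simps
        eq_neg_iff_add_eq_0)
  have all: "\<forall>l\<in>L. l * x ^ i \<in> rat_complex.span B'" for i
  proof (induction i rule: less_induct)
    case (less i)
    show ?case
    proof
      fix l assume l: "l \<in> L"
      show "l * x ^ i \<in> rat_complex.span B'"
      proof (cases "i < n")
        case True
        then show ?thesis using low l by simp
      next
        case False
        then have "l * x ^ i = l * x ^ (i - n) * x ^ n"
          by (simp add: mult.assoc flip: power_add)
        also have "\<dots> = (\<Sum>j<n. (- l * (coeff p j / coeff p n)) * x ^ (i - n + j))"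
          unfolding xn sum_distrib_left by (intro sum.cong refl) (simp add: power_add)
        also have "\<dots> \<in> rat_complex.span B'"
        proof (rule rat_complex.span_sum)
          fix j assume "j \<in> {..<n}"
          then have "i - n + j < i" using False by auto
          moreover have "- l * (coeff p j / coeff p n) \<in> L"
            using l p by (intro subring_mult[OF sub] subring_minus[OF sub] number_field_divide[OF L])
          ultimately show "- l * (coeff p j / coeff p n) * x ^ (i - n + j) \<in> rat_complex.span B'"
            using less by blast
        qed
        finally show ?thesis .
      qed
    qed
  qed
  have "L' = rat_complex.span B'"
  proof
    show "L' \<subseteq> rat_complex.span B'"
      using all by (auto simp: L'_def poly_altdef intro!: rat_complex.span_sum)
    have "of_rat q * z \<in> L'" if "z \<in> L'" for q z
      using that L_L' number_field_of_rat[OF L] by (intro subring_mult[OF L'_sub]) auto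
    then have "rat_complex.subspace L'"
      by (auto simp: rat_complex.subspace_def intro: subring_0[OF L'_sub] subring_add[OF L'_sub])
    moreover have "B' \<subseteq> L'"
    proof -
      have "b * x ^ i \<in> L'" if "b \<in> B" for b i
        using that B(2) L_L' x_L' rat_complex.span_base[of b B]
        by (intro subring_mult[OF L'_sub] subring_power[OF L'_sub]) auto
      then show ?thesis
        by (auto simp: B'_def)
    qed
    ultimately show "rat_complex.span B' \<subseteq> L'"
      by (intro rat_complex.span_minimal)
  qed
  moreover have "finite B'"
    using B(1) by (simp add: B'_def)
  ultimately have "number_field L'"
    using L'_sub subring_finite_dim_number_field by blast
  with L_L' x_L' show ?thesis by blast
qed

lemma number_field_adjoin_algebraic:
  assumes "finite A" and "\<And>z. z \<in> A \<Longrightarrow> algebraic z" and "number_field K"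
  shows "\<exists>L. number_field L \<and> K \<subseteq> L \<and> A \<subseteq> L"
  using assms(1,2)
proof (induction A rule: finite_induct)
  case empty
  then show ?case using assms(3) by blast
next
  case (insert x A)
  then obtain L where L: "number_field L" "K \<subseteq> L" "A \<subseteq> L"
    by auto
  obtain p where p: "\<And>i. coeff p i \<in> \<int>" "p \<noteq> 0" "poly p x = 0"
    using insert.prems[of x] by (auto simp: algebraic_def)
  have "coeff p i \<in> L" for i
    using p(1)[of i] number_field_of_rat[OF L(1)] by (metis Ints_cases of_rat_of_int_eq)
  then obtain L' where "number_field L'" "L \<subseteq> L'" "x \<in> L'"
    using number_field_adjoin_root[OF L(1) _ p(2,3)] by blast
  then show ?case
    using L by blast
qed

lemma number_field_adjoin_sqrt:
  assumes L: "number_field L" and "s\<^sup>2 \<in> L"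
  shows "\<exists>L'. number_field L' \<and> L \<subseteq> L' \<and> s \<in> L'"
proof (rule number_field_adjoin_root[OF L, of "[:- s\<^sup>2, 0, 1:]"])
  note sub = number_field_subring[OF L]
  show "coeff [:- s\<^sup>2, 0, 1:] i \<in> L" for i
    using assms(2) by (auto simp: coeff_pCons split: nat.splits
        intro: subring_minus[OF sub] subring_0[OF sub] subring_1[OF sub])
qed (auto simp: power2_eq_square)

section \<open>Absolute values and weak approximation\<close>

definition ultrametric_on :: "complex set \<Rightarrow> (complex \<Rightarrow> real) \<Rightarrow> bool" where
  "ultrametric_on K a \<longleftrightarrow> (\<forall>x\<in>K. \<forall>y\<in>K. a (x + y) \<le> max (a x) (a y))"

lemmas number_field_intros = subring_intros[OF number_field_subring]
  number_field_inverse number_field_divide number_field_of_rat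

context
  fixes K a
  assumes K: "number_field K" and av: "absolute_value K a"
begin

lemmas K_intros = number_field_intros[OF K]

lemma av_nonneg: "x \<in> K \<Longrightarrow> 0 \<le> a x"
  using av by (simp add: absolute_value_def)

lemma av_eq_0: "x \<in> K \<Longrightarrow> a x = 0 \<longleftrightarrow> x = 0"
  using av by (simp add: absolute_value_def)

lemma av_pos: "x \<in> K \<Longrightarrow> x \<noteq> 0 \<Longrightarrow> 0 < a x"
  using av_nonneg[of x] av_eq_0[of x] by simp

lemma av_0: "a 0 = 0"
  using av_eq_0[of 0] K_intros(1) by simp

lemma av_mult: "x \<in> K \<Longrightarrow> y \<in> K \<Longrightarrow> a (x * y) = a x * a y"
  using av by (simp add: absolute_value_def)

lemma av_triangle: "x \<in> K \<Longrightarrow> y \<in> K \<Longrightarrow> a (x + y) \<le> a x + a y"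
  using av by (simp add: absolute_value_def)

lemma av_1: "a 1 = 1"
  using av_mult[of 1 1] av_eq_0[of 1] K_intros(2) by simp

lemma av_minus:
  assumes "x \<in> K" shows "a (- x) = a x"
proof -
  have m: "- 1 \<in> K"
    by (intro K_intros)
  have "(a (- 1))\<^sup>2 = 1"
    using av_mult[OF m m] av_1 by (simp add: power2_eq_square)
  then have "a (- 1) = 1"
    using av_nonneg[OF m] by (simp add: power2_eq_1_iff)
  then show ?thesis
    using av_mult[OF m assms] by simp
qed

lemma av_diff_le: "x \<in> K \<Longrightarrow> y \<in> K \<Longrightarrow> a (x - y) \<le> a x + a y"
  using av_triangle[of x "- y"] av_minus[of y] by (simp add: K_intros)

lemma av_power: "x \<in> K \<Longrightarrow> a (x ^ n) = a x ^ n"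
  by (induction n) (auto simp: av_1 av_mult K_intros)

lemma av_inverse:
  assumes "x \<in> K" shows "a (inverse x) = inverse (a x)"
proof (cases "x = 0")
  case False
  then have "a x * a (inverse x) = 1"
    using av_mult[OF assms number_field_inverse[OF K assms]] av_1 by simp
  then show ?thesis
    by (rule inverse_unique[symmetric])
qed (simp add: av_0)

lemma av_divide: "x \<in> K \<Longrightarrow> y \<in> K \<Longrightarrow> a (x / y) = a x / a y"
  by (simp add: divide_inverse av_mult av_inverse K_intros)

lemma av_sum_le:
  assumes "\<And>i. i \<in> A \<Longrightarrow> f i \<in> K"
  shows "a (sum f A) \<le> (\<Sum>i\<in>A. a (f i))"
  using assms
proof (induction A rule: infinite_finite_induct)
  case (insert i A)
  then have "a (f i + sum f A) \<le> a (f i) + a (sum f A)"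
    by (intro av_triangle) (auto intro: K_intros)
  with insert show ?case
    by simp
qed (auto simp: av_0)

lemma av_of_nat_le: "a (of_nat n) \<le> of_nat n"
proof (induction n)
  case (Suc n)
  have "a (1 + of_nat n) \<le> a 1 + a (of_nat n)"
    by (intro av_triangle K_intros)
  with Suc show ?case
    by (simp add: av_1)
qed (simp add: av_0)

lemma av_gt_1_exists: "\<exists>x\<in>K. a x > 1"
proof -
  obtain x where x: "x \<in> K" "x \<noteq> 0" "a x \<noteq> 1"
    using av by (auto simp: absolute_value_def)
  show ?thesis
  proof (cases "a x > 1")
    case False
    then have "a (inverse x) > 1"
      using x av_pos[of x] by (simp add: av_inverse one_less_inverse_iff)
    then show ?thesis
      using x number_field_inverse[OF K] by (intro bexI[of _ "inverse x"])
  qed (use x in blast)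
qed

lemma ultrametric_sum_le:
  assumes "ultrametric_on K a" and "\<And>i. i \<in> A \<Longrightarrow> f i \<in> K" and "\<And>i. i \<in> A \<Longrightarrow> a (f i) \<le> c" and "0 \<le> c"
  shows "a (sum f A) \<le> c"
  using assms(2,3)
proof (induction A rule: infinite_finite_induct)
  case (insert i A)
  then have "a (f i + sum f A) \<le> max (a (f i)) (a (sum f A))"
    using assms(1) K_intros(8)[of A f] unfolding ultrametric_on_def by blast
  moreover have "a (f i) \<le> c" "a (sum f A) \<le> c"
    using insert by simp_all
  ultimately show ?case
    using insert(1,2) by (auto simp: le_max_iff_disj)
qed (use assms(4) in \<open>auto simp: av_0\<close>)

lemma ultrametric_of_nat_le: "ultrametric_on K a \<Longrightarrow> a (of_nat n) \<le> 1"
  using ultrametric_sum_le[of "{..<n}" "\<lambda>_. 1" 1] by (simp add: K_intros av_1)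

lemma ultrametric_of_int_le:
  assumes "ultrametric_on K a" shows "a (of_int n) \<le> 1"
proof (cases n rule: int_cases2)
  case (nonneg m)
  then show ?thesis
    using ultrametric_of_nat_le[OF assms, of m] by simp
next
  case (nonpos m)
  then show ?thesis
    using ultrametric_of_nat_le[OF assms, of m] by (simp add: av_minus K_intros)
qed

lemma ln_av_power_int:
  assumes "x \<in> K" "x \<noteq> 0"
  shows "x powi m \<in> K" and "ln (a (x powi m)) = m * ln (a x)"
proof -
  show "x powi m \<in> K"
    using assms by (auto simp: power_int_def intro: K_intros)
  show "ln (a (x powi m)) = m * ln (a x)"
    using assms av_pos[of x]
    by (auto simp: power_int_def av_power av_inverse K_intros ln_realpow ln_inverse)
qed

end

text \<open>With \<open>y\<close> fixed, \<open>b\<close> is a power of \<open>a\<close> as soon as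
  the slopes \<open>ln (a x) / ln (a y)\<close> and \<open>ln (b x) / ln (b y)\<close> agree. Slopes
  are compared by rational cuts, which the inclusion of the unit balls can see.\<close>

lemma equivalent_if_unit_ball_subset:
  assumes K: "number_field K" and a: "absolute_value K a" and b: "absolute_value K b"
    and ball: "\<And>x. x \<in> K \<Longrightarrow> a x < 1 \<Longrightarrow> b x < 1"
  shows "\<exists>s>0. \<forall>x\<in>K. b x = a x powr s"
proof -
  note K_intros = number_field_intros[OF K]
  obtain y where y: "y \<in> K" "a y > 1"
    using av_gt_1_exists[OF K a] by blast
  have y0: "y \<noteq> 0"
    using y av_0[OF K a] by auto
  have gt: "b x > 1" if "x \<in> K" "a x > 1" for x
  proof -
    have "x \<noteq> 0"
      using that av_0[OF K a] by auto
    have "a (inverse x) < 1"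
      using that by (simp add: av_inverse[OF K a] inverse_less_1_iff)
    then have "inverse (b x) < 1"
      using ball[of "inverse x"] that(1) by (simp add: av_inverse[OF K b] K_intros)
    then show ?thesis
      using av_pos[OF K b that(1) \<open>x \<noteq> 0\<close>] by (simp add: inverse_less_1_iff)
  qed
  have b_gt: "b y > 1"
    using gt y by blast
  have ay_ln: "ln (a y) > 0" and by_ln: "ln (b y) > 0"
    using y b_gt by simp_all
  have le: "ln (b x) / ln (b y) \<le> ln (a x) / ln (a y)" if x: "x \<in> K" "x \<noteq> 0" for x
  proof (rule ccontr)
    assume "\<not> ?thesis"
    then obtain q where q: "ln (a x) / ln (a y) < of_rat q" "of_rat q < ln (b x) / ln (b y)"
      using of_rat_dense[of "ln (a x) / ln (a y)" "ln (b x) / ln (b y)"] by auto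
    obtain m n where mn: "q = of_int m / of_int n" "n > 0"
      by (cases q) (auto simp: Fract_of_int_quotient)
    have qr: "(of_rat q :: real) = of_int m / of_int n"
      by (simp add: mn of_rat_divide)
    \<comment> \<open>In effect \<open>x ^ n / y ^ m\<close>: the cut \<open>m / n\<close> lies
      above the slope for \<open>a\<close>, so \<open>z\<close> is small for \<open>a\<close>, and
      below the slope for \<open>b\<close>, so \<open>z\<close> is large for
      \<open>b\<close>.\<close>
    define z where "z = x powi n * y powi (- m)"
    note xa = ln_av_power_int[OF K a x, of n] and xb = ln_av_power_int[OF K b x, of n]
    note ya = ln_av_power_int[OF K a y(1) y0, of "- m"] and yb = ln_av_power_int[OF K b y(1) y0, of "- m"]
    have z: "z \<in> K" "z \<noteq> 0"
      using xa(1) ya(1) x(2) y0 by (auto simp: z_def intro: K_intros)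
    have "ln (a z) = n * ln (a x) - m * ln (a y)"
      unfolding z_def using xa ya x y0 av_pos[OF K a xa(1)] av_pos[OF K a ya(1)]
      by (simp add: av_mult[OF K a] ln_mult)
    also have "\<dots> < 0"
      using q(1) ay_ln mn(2) unfolding qr by (simp add: field_simps)
    finally have "a z < 1"
      using av_pos[OF K a z] by simp
    then have "ln (b z) < 0"
      using ball[OF z(1)] av_pos[OF K b z] by simp
    moreover have "ln (b z) = n * ln (b x) - m * ln (b y)"
      unfolding z_def using xb yb x y0 av_pos[OF K b xb(1)] av_pos[OF K b yb(1)]
      by (simp add: av_mult[OF K b] ln_mult)
    ultimately show False
      using q(2) by_ln mn(2) unfolding qr by (simp add: field_simps)
  qed
  define s where "s = ln (b y) / ln (a y)"
  have "b x = a x powr s" if x: "x \<in> K" for x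
  proof (cases "x = 0")
    case True
    then show ?thesis by (simp add: av_0[OF K a] av_0[OF K b])
  next
    case False
    \<comment> \<open>Passing to the inverse changes the sign of both slopes and gives the opposite
      inequality.\<close>
    have "ln (b (inverse x)) / ln (b y) \<le> ln (a (inverse x)) / ln (a y)"
      using x False by (intro le K_intros) auto
    then have "ln (b x) / ln (b y) \<ge> ln (a x) / ln (a y)"
      using av_pos[OF K a x False] av_pos[OF K b x False] x
      by (simp add: av_inverse[OF K a] av_inverse[OF K b] ln_inverse)
    with le[OF x False] have "ln (b x) / ln (b y) = ln (a x) / ln (a y)"
      by simp
    then have "ln (b x) = s * ln (a x)"
      using ay_ln by_ln by (simp add: s_def field_simps)
    then have "exp (ln (b x)) = exp (s * ln (a x))"
      by simp
    then show ?thesis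
      using av_pos[OF K a x False] av_pos[OF K b x False] by (simp add: powr_def)
  qed
  moreover have "s > 0"
    using ay_ln by_ln by (simp add: s_def)
  ultimately show ?thesis by blast
qed

text \<open>The criterion for equivalence fails in both directions, which gives \<open>x\<close>
  with \<open>a x < 1 \<le> b x\<close> and \<open>y\<close> with \<open>b y < 1 \<le> a y\<close>;
  their quotient \<open>y / x\<close> separates strictly.\<close>

lemma inequivalent_separated:
  assumes K: "number_field K" and a: "absolute_value K a" and b: "absolute_value K b"
    and ne: "(a, b) \<notin> equivalent_absolute_values K"
  shows "\<exists>x\<in>K. a x > 1 \<and> b x < 1"
proof -
  note K_intros = number_field_intros[OF K]
  have "\<not> (\<exists>s>0. \<forall>x\<in>K. b x = a x powr s)"
    using ne a b by (auto simp: equivalent_absolute_values_def)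
  then obtain x where x: "x \<in> K" "a x < 1" "b x \<ge> 1"
    using equivalent_if_unit_ball_subset[OF K a b] by (meson not_less)
  have "\<not> (\<exists>s>0. \<forall>x\<in>K. a x = b x powr s)"
  proof
    assume "\<exists>s>0. \<forall>x\<in>K. a x = b x powr s"
    then obtain s where s: "s > 0" "\<forall>x\<in>K. a x = b x powr s" by blast
    then have "\<forall>x\<in>K. b x = a x powr (1 / s)"
      using av_nonneg[OF K b] by (auto simp: powr_powr)
    with s(1) have "\<exists>s>0. \<forall>x\<in>K. b x = a x powr s"
      by (intro exI[of _ "1 / s"]) auto
    with ne a b show False
      by (auto simp: equivalent_absolute_values_def)
  qed
  then obtain y where y: "y \<in> K" "b y < 1" "a y \<ge> 1"
    using equivalent_if_unit_ball_subset[OF K b a] by (meson not_less)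
  have "x \<noteq> 0" using x av_0[OF K b] by auto
  have "a (y / x) > 1"
    using x y av_pos[OF K a x(1) \<open>x \<noteq> 0\<close>] by (simp add: av_divide[OF K a] field_simps)
  moreover have "b (y / x) < 1"
    using x y by (simp add: av_divide[OF K b] field_simps)
  moreover have "y / x \<in> K"
    by (intro K_intros x y)
  ultimately show ?thesis
    by blast
qed

text \<open>Artin-Whaples induction. Let \<open>x\<close> separate \<open>a\<close> from
  \<open>A\<close>, and let \<open>y\<close> separate \<open>a\<close> from the new
  \<open>c\<close>. If \<open>c x \<le> 1\<close>, then \<open>x ^ r * y\<close> works for large
  \<open>r\<close>. If \<open>c x > 1\<close>, the power is replaced by
  \<open>x ^ r / (1 + x ^ r)\<close>, which is close to 1 for \<open>a\<close> and \<open>c\<close>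
  and close to 0 for \<open>A\<close>.\<close>

lemma separating_element:
  assumes K: "number_field K" and a: "absolute_value K a"
    and A: "finite A" "\<And>b. b \<in> A \<Longrightarrow> absolute_value K b"
      "\<And>b. b \<in> A \<Longrightarrow> (a, b) \<notin> equivalent_absolute_values K"
  shows "\<exists>x\<in>K. a x > 1 \<and> (\<forall>b\<in>A. b x < 1)"
  using A
proof (induction A rule: finite_induct)
  case empty
  then show ?case
    using av_gt_1_exists[OF K a] by blast
next
  case (insert c A)
  note K_intros = number_field_intros[OF K]
  have c: "absolute_value K c" using insert by simp
  obtain x where x: "x \<in> K" "a x > 1" "\<And>b. b \<in> A \<Longrightarrow> b x < 1"
    using insert by auto
  obtain y where y: "y \<in> K" "a y > 1" "c y < 1"
    using inequivalent_separated[OF K a c] insert by auto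
  have A: "absolute_value K b" if "b \<in> A" for b
    using insert that by auto
  show ?case
  proof (cases "c x \<le> 1")
    case True
    have "\<forall>\<^sub>F r in sequentially. b x ^ r * b y < 1" if b: "b \<in> A" for b
    proof -
      have "(\<lambda>r. b x ^ r * b y) \<longlonglongrightarrow> 0 * b y"
        using x(3)[OF b] av_nonneg[OF K A[OF b] x(1)] by (intro tendsto_intros LIMSEQ_realpow_zero)
      then show ?thesis
        by (auto intro: order_tendstoD)
    qed
    then have "\<forall>\<^sub>F r in sequentially. \<forall>b\<in>A. b x ^ r * b y < 1"
      using insert(1) by (simp add: eventually_ball_finite)
    then obtain r where r: "\<And>b. b \<in> A \<Longrightarrow> b x ^ r * b y < 1"
      by (auto simp: eventually_sequentially)
    have "1 * 1 < a x ^ r * a y"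
      using x y by (intro mult_le_less_imp_less) auto
    moreover have "c x ^ r * c y < 1"
      using True y av_nonneg[OF K c x(1)] av_nonneg[OF K c y(1)]
      by (meson le_less_trans mult_left_le_one_le power_le_one zero_le_power)
    ultimately have "a (x ^ r * y) > 1 \<and> (\<forall>b\<in>insert c A. b (x ^ r * y) < 1)"
      using r x y A a c K by (auto simp: av_mult av_power K_intros)
    moreover have "x ^ r * y \<in> K"
      by (intro K_intros x y)
    ultimately show ?thesis
      by blast
  next
    case False
    \<comment> \<open>The positive exponent makes the comparisons of \<open>x ^ Suc r\<close> with 1
      strict for every \<open>r\<close>, which keeps the denominators below nonzero.\<close>
    define t where "t r = x ^ Suc r / (1 + x ^ Suc r)" for r
    have tK: "t r \<in> K" for r
      unfolding t_def using x by (intro K_intros)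
    \<comment> \<open>Used with \<open>s = 1\<close> for the lower bound at \<open>a\<close>, where
      the denominator is at most \<open>a x ^ Suc r + 1\<close>, and with \<open>s = - 1\<close> for
      the upper bound at \<open>c\<close>, where it is at least
      \<open>c x ^ Suc r - 1\<close>.\<close>
    have big: "(\<lambda>r. z ^ Suc r / (z ^ Suc r + s)) \<longlonglongrightarrow> 1" if "z > 1" for z s :: real
    proof -
      have "(\<lambda>r. inverse z ^ Suc r) \<longlonglongrightarrow> 0"
        using that by (intro LIMSEQ_Suc LIMSEQ_realpow_zero) (auto simp: inverse_less_1_iff)
      then have "(\<lambda>r. 1 / (1 + s * inverse z ^ Suc r)) \<longlonglongrightarrow> 1 / (1 + s * 0)"
        by (intro tendsto_intros) auto
      moreover have "1 / (1 + s * inverse z ^ Suc r) = z ^ Suc r / (z ^ Suc r + s)" for r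
      proof -
        have "z ^ Suc r \<noteq> 0" using that by simp
        then have "1 + s * inverse z ^ Suc r = (z ^ Suc r + s) / z ^ Suc r"
          by (simp only: power_inverse) (simp add: field_simps)
        then show ?thesis by simp
      qed
      ultimately show ?thesis by simp
    qed
    have "\<forall>\<^sub>F r in sequentially. 1 < a (t r * y)"
    proof -
      have "(\<lambda>r. a x ^ Suc r / (a x ^ Suc r + 1) * a y) \<longlonglongrightarrow> 1 * a y"
        by (intro tendsto_intros big x)
      then have "\<forall>\<^sub>F r in sequentially. 1 < a x ^ Suc r / (a x ^ Suc r + 1) * a y"
        using y by (auto intro: order_tendstoD)
      then show ?thesis
      proof (rule eventually_mono)
        fix r assume r: "1 < a x ^ Suc r / (a x ^ Suc r + 1) * a y"
        have X: "x ^ Suc r \<in> K" by (intro K_intros x)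
        have X1: "1 + x ^ Suc r \<in> K" by (intro K_intros x)
        have gt: "a (x ^ Suc r) > 1"
          using x by (simp only: av_power[OF K a x(1)]) (intro one_less_power, auto)
        have "1 + x ^ Suc r \<noteq> 0"
          using gt av_minus[OF K a, of 1] av_1[OF K a]
          by (metis K_intros(2) add_eq_0_iff less_irrefl)
        then have pos: "0 < a (1 + x ^ Suc r)"
          by (intro av_pos[OF K a] X1)
        have "a (1 + x ^ Suc r) \<le> a x ^ Suc r + 1"
          using av_triangle[OF K a K_intros(2) X] by (simp only: av_1[OF K a] av_power[OF K a x(1)])
        then have "a x ^ Suc r / (a x ^ Suc r + 1) \<le> a x ^ Suc r / a (1 + x ^ Suc r)"
          using pos x by (intro divide_left_mono) auto
        then have "1 < a x ^ Suc r / a (1 + x ^ Suc r) * a y"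
          using r y by (smt (verit) mult_right_mono)
        then show "1 < a (t r * y)"
          unfolding t_def by (simp only: av_mult[OF K a tK[unfolded t_def] y(1)]
            av_divide[OF K a X X1] av_power[OF K a x(1)])
      qed
    qed
    moreover have "\<forall>\<^sub>F r in sequentially. c (t r * y) < 1"
    proof -
      have cx: "c x > 1" using False by simp
      have "(\<lambda>r. c x ^ Suc r / (c x ^ Suc r + - 1) * c y) \<longlonglongrightarrow> 1 * c y"
        by (intro tendsto_intros big cx)
      then have "\<forall>\<^sub>F r in sequentially. c x ^ Suc r / (c x ^ Suc r + - 1) * c y < 1"
        using y by (auto intro: order_tendstoD)
      then show ?thesis
      proof (rule eventually_mono)
        fix r assume r: "c x ^ Suc r / (c x ^ Suc r + - 1) * c y < 1"
        have X: "x ^ Suc r \<in> K" by (intro K_intros x)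
        have X1: "1 + x ^ Suc r \<in> K" by (intro K_intros x)
        have gt: "c x ^ Suc r > 1"
          using cx by (intro one_less_power) auto
        have "c (x ^ Suc r) \<le> c (1 + x ^ Suc r) + c 1"
          using av_diff_le[OF K c X1 K_intros(2)] by simp
        then have "c x ^ Suc r + - 1 \<le> c (1 + x ^ Suc r)"
          by (simp only: av_1[OF K c] av_power[OF K c x(1)])
        then have "c x ^ Suc r / c (1 + x ^ Suc r) \<le> c x ^ Suc r / (c x ^ Suc r + - 1)"
          using gt by (intro divide_left_mono) auto
        then have "c x ^ Suc r / c (1 + x ^ Suc r) * c y < 1"
          using r av_nonneg[OF K c y(1)] by (smt (verit) mult_right_mono)
        then show "c (t r * y) < 1"
          unfolding t_def by (simp only: av_mult[OF K c tK[unfolded t_def] y(1)]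
            av_divide[OF K c X X1] av_power[OF K c x(1)])
      qed
    qed
    moreover have "\<forall>\<^sub>F r in sequentially. \<forall>b\<in>A. b (t r * y) < 1"
    proof (rule eventually_ball_finite[OF insert(1)], rule ballI)
      fix b assume bA: "b \<in> A"
      note b = A[OF bA]
      have bx: "0 \<le> b x" "b x < 1"
        using x(3)[OF bA] av_nonneg[OF K b x(1)] by auto
      have "(\<lambda>r. b x ^ Suc r / (1 - b x ^ Suc r) * b y) \<longlonglongrightarrow> 0 / (1 - 0) * b y"
        using bx by (intro tendsto_intros LIMSEQ_Suc LIMSEQ_realpow_zero) auto
      then have "\<forall>\<^sub>F r in sequentially. b x ^ Suc r / (1 - b x ^ Suc r) * b y < 1"
        by (auto intro: order_tendstoD)
      then show "\<forall>\<^sub>F r in sequentially. b (t r * y) < 1"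
      proof (rule eventually_mono)
        fix r assume r: "b x ^ Suc r / (1 - b x ^ Suc r) * b y < 1"
        have X: "x ^ Suc r \<in> K" by (intro K_intros x)
        have X1: "1 + x ^ Suc r \<in> K" by (intro K_intros x)
        have lt: "b x ^ Suc r < 1"
          using bx mult_left_mono[OF power_le_one[of "b x" r], of "b x"] by simp
        have "b 1 \<le> b (1 + x ^ Suc r) + b (x ^ Suc r)"
          using av_diff_le[OF K b X1 X] by simp
        then have "1 - b x ^ Suc r \<le> b (1 + x ^ Suc r)"
          unfolding av_1[OF K b] av_power[OF K b x(1)] by linarith
        then have "b x ^ Suc r / b (1 + x ^ Suc r) \<le> b x ^ Suc r / (1 - b x ^ Suc r)"
          using lt bx by (intro divide_left_mono) auto
        then have "b x ^ Suc r / b (1 + x ^ Suc r) * b y < 1"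
          using r av_nonneg[OF K b y(1)] by (smt (verit) mult_right_mono)
        then show "b (t r * y) < 1"
          unfolding t_def by (simp only: av_mult[OF K b tK[unfolded t_def] y(1)]
            av_divide[OF K b X X1] av_power[OF K b x(1)])
      qed
    qed
    ultimately have "\<forall>\<^sub>F r in sequentially. 1 < a (t r * y) \<and> c (t r * y) < 1 \<and> (\<forall>b\<in>A. b (t r * y) < 1)"
      by eventually_elim simp
    then obtain r where "1 < a (t r * y)" "c (t r * y) < 1" "\<forall>b\<in>A. b (t r * y) < 1"
      by (auto simp: eventually_sequentially)
    moreover have "t r * y \<in> K"
      by (intro K_intros tK y)
    ultimately show ?thesis by blast
  qed
qed

section \<open>Finiteness of the exceptional places\<close>

lemma equiv_equivalent_absolute_values:
  assumes K: "number_field K"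
  shows "equiv {a. absolute_value K a} (equivalent_absolute_values K)"
proof (rule equivI)
  show "equivalent_absolute_values K \<subseteq> {a. absolute_value K a} \<times> {a. absolute_value K a}"
    by (auto simp: equivalent_absolute_values_def)
  show "refl_on {a. absolute_value K a} (equivalent_absolute_values K)"
    by (auto simp: equivalent_absolute_values_def refl_on_def av_nonneg[OF K] intro!: exI[of _ "1 :: real"])
  show "sym (equivalent_absolute_values K)"
  proof (rule symI)
    fix a b assume "(a, b) \<in> equivalent_absolute_values K"
    then obtain s where s: "absolute_value K a" "absolute_value K b" "s > 0" "\<forall>x\<in>K. b x = a x powr s"
      by (auto simp: equivalent_absolute_values_def)
    then have "\<forall>x\<in>K. a x = b x powr (1 / s)"
      using av_nonneg[OF K s(1)] by (auto simp: powr_powr)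
    then have "\<exists>s>0. \<forall>x\<in>K. a x = b x powr s"
      using s(3) by (intro exI[of _ "1 / s"]) auto
    with s show "(b, a) \<in> equivalent_absolute_values K"
      by (simp add: equivalent_absolute_values_def)
  qed
  show "trans (equivalent_absolute_values K)"
  proof (rule transI)
    fix a b c assume ab: "(a, b) \<in> equivalent_absolute_values K" and bc: "(b, c) \<in> equivalent_absolute_values K"
    obtain s where s: "s > 0" "\<forall>x\<in>K. b x = a x powr s"
      using ab by (auto simp: equivalent_absolute_values_def)
    obtain t where t: "t > 0" "\<forall>x\<in>K. c x = b x powr t"
      using bc by (auto simp: equivalent_absolute_values_def)
    have "\<forall>x\<in>K. c x = a x powr (s * t)"
      using s t by (auto simp: powr_powr)
    then have "\<exists>s>0. \<forall>x\<in>K. c x = a x powr s"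
      using s(1) t(1) by (intro exI[of _ "s * t"]) auto
    with ab bc show "(a, c) \<in> equivalent_absolute_values K"
      by (simp add: equivalent_absolute_values_def)
  qed
qed

lemma places_absolute_value:
  assumes "\<nu> \<in> places K" "a \<in> \<nu>" shows "absolute_value K a"
  using assms by (auto simp: places_def equivalent_absolute_values_def elim!: quotientE)

text \<open>Meant for the preorder that compares rationals by all absolute values of a set at once;
  it is not antisymmetric, so \<open>Max\<close> does not apply.\<close>

lemma finite_ne_total_max:
  assumes "finite A" "A \<noteq> {}" "\<And>x y. x \<in> A \<Longrightarrow> y \<in> A \<Longrightarrow> R x y \<or> R y x" "\<And>x y z. R x y \<Longrightarrow> R y z \<Longrightarrow> R x z"
  shows "\<exists>m\<in>A. \<forall>x\<in>A. R x m"
  using assms(1-3)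
proof (induction A rule: finite_ne_induct)
  case (insert x A)
  then obtain m where m: "m \<in> A" "\<forall>x\<in>A. R x m"
    by blast
  show ?case
  proof (cases "R x m")
    case False
    then have "R m x" "R x x"
      using insert.prems[of x m] insert.prems[of x x] m by auto
    then show ?thesis
      using m assms(4) by blast
  qed (use m in blast)
qed blast

text \<open>The powers of separating elements for pairwise inequivalent absolute values are linearly
  independent over the rationals as soon as these absolute values order the rationals in the same
  way, so there are at most as many of them as the degree of the field.\<close>

lemma finite_places_same_order_on_rats:
  assumes K: "number_field K" and A: "\<And>a. a \<in> A \<Longrightarrow> absolute_value K a"
    and total: "\<And>q r. q \<noteq> 0 \<Longrightarrow> r \<noteq> 0 \<Longrightarrow>
      (\<forall>a\<in>A. a (of_rat q) \<le> a (of_rat r)) \<or> (\<forall>a\<in>A. a (of_rat r) \<le> a (of_rat q))"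
  shows "finite {\<nu> \<in> places K. \<nu> \<inter> A \<noteq> {}}"
proof (rule ccontr)
  assume inf: "infinite {\<nu> \<in> places K. \<nu> \<inter> A \<noteq> {}}"
  note K_intros = number_field_intros[OF K]
  obtain B where B: "finite B" "K = rat_complex.span B"
    using K by (auto simp: number_field_iff)
  obtain N where N: "finite N" "card N = card B + 1" "N \<subseteq> {\<nu> \<in> places K. \<nu> \<inter> A \<noteq> {}}"
    using infinite_arbitrarily_large[OF inf] by blast
  then have "\<forall>\<nu>\<in>N. \<exists>a. a \<in> \<nu> \<inter> A"
    by blast
  then obtain rep where rep: "\<And>\<nu>. \<nu> \<in> N \<Longrightarrow> rep \<nu> \<in> \<nu>" "\<And>\<nu>. \<nu> \<in> N \<Longrightarrow> rep \<nu> \<in> A"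
    by (metis IntD1 IntD2)
  have av: "absolute_value K (rep \<nu>)" if "\<nu> \<in> N" for \<nu>
    using A rep that by blast
  have ineq: "(rep \<nu>, rep \<mu>) \<notin> equivalent_absolute_values K" if "\<nu> \<in> N" "\<mu> \<in> N" "\<nu> \<noteq> \<mu>" for \<nu> \<mu>
  proof -
    have "\<nu> \<in> places K" "\<mu> \<in> places K" using N(3) that by blast+
    then show ?thesis
      using quotient_eq_iff[OF equiv_equivalent_absolute_values[OF K], of \<nu> \<mu> "rep \<nu>" "rep \<mu>"] rep that
      by (auto simp: places_def)
  qed
  \<comment> \<open>The threshold \<open>1 / ?n\<close> makes the terms of a relation other than the
    dominant one, fewer than \<open>?n\<close> in number, too small together to cancel that
    term.\<close>
  let ?n = "real (card N)"
  have n: "?n > 0" using N by simp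
  have "\<exists>y\<in>K. rep \<nu> y > 1 \<and> (\<forall>\<mu>\<in>N - {\<nu>}. rep \<mu> y < 1 / ?n)" if \<nu>: "\<nu> \<in> N" for \<nu>
  proof -
    obtain x where x: "x \<in> K" "rep \<nu> x > 1" "\<forall>b\<in>rep ` (N - {\<nu>}). b x < 1"
      using separating_element[OF K av[OF \<nu>], of "rep ` (N - {\<nu>})"] N(1) av ineq[OF \<nu>] by blast
    have "\<forall>\<^sub>F k in sequentially. \<forall>\<mu>\<in>N - {\<nu>}. rep \<mu> x ^ Suc k < 1 / ?n"
    proof (rule eventually_ball_finite, use N(1) in simp, rule ballI)
      fix \<mu> assume \<mu>: "\<mu> \<in> N - {\<nu>}"
      have "(\<lambda>k. rep \<mu> x ^ Suc k) \<longlonglongrightarrow> 0"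
        using x \<mu> av_nonneg[OF K av[of \<mu>], of x]
        by (intro LIMSEQ_Suc LIMSEQ_realpow_zero) auto
      then show "\<forall>\<^sub>F k in sequentially. rep \<mu> x ^ Suc k < 1 / ?n"
        using n by (intro order_tendstoD(2)) auto
    qed
    then obtain k where k: "\<forall>\<mu>\<in>N - {\<nu>}. rep \<mu> x ^ Suc k < 1 / ?n"
      unfolding eventually_sequentially by blast
    have "rep \<nu> (x ^ Suc k) > 1"
      unfolding av_power[OF K av[OF \<nu>] x(1)] using x(2) by (rule one_less_power) simp
    moreover have "\<forall>\<mu>\<in>N - {\<nu>}. rep \<mu> (x ^ Suc k) < 1 / ?n"
      using k av_power[OF K av x(1)] by (metis DiffD1)
    ultimately show ?thesis
      using K_intros(7)[OF x(1)] by blast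
  qed
  then obtain y where y: "\<And>\<nu>. \<nu> \<in> N \<Longrightarrow> y \<nu> \<in> K" "\<And>\<nu>. \<nu> \<in> N \<Longrightarrow> rep \<nu> (y \<nu>) > 1"
      "\<And>\<nu> \<mu>. \<nu> \<in> N \<Longrightarrow> \<mu> \<in> N \<Longrightarrow> \<mu> \<noteq> \<nu> \<Longrightarrow> rep \<mu> (y \<nu>) < 1 / ?n"
    by (metis Diff_iff singletonD)
  have n1: "1 / ?n \<le> 1" using N(2) by simp
  have inj: "inj_on y N"
  proof (rule inj_onI, rule ccontr)
    fix \<nu> \<mu> assume "\<nu> \<in> N" "\<mu> \<in> N" "y \<nu> = y \<mu>" "\<nu> \<noteq> \<mu>"
    then show False
      using y(2)[of \<mu>] y(3)[of \<nu> \<mu>] n1 by simp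
  qed
  have "y ` N \<subseteq> rat_complex.span B"
    using y(1) B(2) by blast
  moreover have "card (y ` N) = card B + 1"
    using inj N(2) by (simp add: card_image)
  ultimately have "rat_complex.dependent (y ` N)"
    using rat_complex.independent_span_bound[OF B(1), of "y ` N"] by auto
  then obtain u where u: "\<exists>v\<in>y ` N. u v \<noteq> 0" "(\<Sum>v\<in>y ` N. of_rat (u v) * v) = 0"
    using rat_complex.dependent_finite[of "y ` N"] N(1) by auto
  define q where "q \<nu> = u (y \<nu>)" for \<nu>
  have sum0: "(\<Sum>\<nu>\<in>N. of_rat (q \<nu>) * y \<nu>) = 0"
    using u(2) by (simp add: sum.reindex[OF inj] q_def)
  define N1 where "N1 = {\<nu> \<in> N. q \<nu> \<noteq> 0}"
  have "finite N1" "N1 \<noteq> {}"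
    using N(1) u(1) by (auto simp: N1_def q_def)
  \<comment> \<open>The index whose coefficient is largest for all of \<open>A\<close>
    simultaneously. At its own place the factor \<open>y \<nu>\<close> exceeds 1 and the other
    factors are below \<open>1 / ?n\<close>, which contradicts the relation.\<close>
  then obtain \<nu> where \<nu>: "\<nu> \<in> N1" "\<forall>\<mu>\<in>N1. \<forall>a\<in>A. a (of_rat (q \<mu>)) \<le> a (of_rat (q \<nu>))"
    using finite_ne_total_max[of N1 "\<lambda>\<mu> \<nu>. \<forall>a\<in>A. a (of_rat (q \<mu>)) \<le> a (of_rat (q \<nu>))"] total
    by (force simp: N1_def)
  then have \<nu>N: "\<nu> \<in> N" "q \<nu> \<noteq> 0"
    by (auto simp: N1_def)
  define a where "a = rep \<nu>"
  have a: "absolute_value K a" "a \<in> A"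
    using av rep \<nu>N by (auto simp: a_def)
  let ?c = "a (of_rat (q \<nu>))"
  have c: "?c > 0"
    using \<nu>N by (intro av_pos[OF K a(1)] K_intros) simp
  have "?c < ?c * a (y \<nu>)"
    using y(2)[OF \<nu>N(1)] c by (simp add: a_def)
  also have "\<dots> = a (of_rat (q \<nu>) * y \<nu>)"
    by (rule av_mult[OF K a(1), symmetric]) (intro K_intros y \<nu>N)+
  also have "of_rat (q \<nu>) * y \<nu> = - (\<Sum>\<mu>\<in>N - {\<nu>}. of_rat (q \<mu>) * y \<mu>)"
    using sum0 sum.remove[OF N(1) \<nu>N(1), of "\<lambda>\<nu>. of_rat (q \<nu>) * y \<nu>"] by (simp add: eq_neg_iff_add_eq_0)
  also have "a \<dots> = a (\<Sum>\<mu>\<in>N - {\<nu>}. of_rat (q \<mu>) * y \<mu>)"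
    by (intro av_minus[OF K a(1)] K_intros y) auto
  also have "\<dots> \<le> (\<Sum>\<mu>\<in>N - {\<nu>}. a (of_rat (q \<mu>) * y \<mu>))"
    by (intro av_sum_le[OF K a(1)] K_intros y) auto
  also have "\<dots> \<le> (\<Sum>\<mu>\<in>N - {\<nu>}. ?c * (1 / ?n))"
  proof (rule sum_mono)
    fix \<mu> assume \<mu>: "\<mu> \<in> N - {\<nu>}"
    have "a (of_rat (q \<mu>)) \<le> ?c"
    proof (cases "q \<mu> = 0")
      case True
      then show ?thesis using c by (simp add: av_0[OF K a(1)])
    next
      case False
      then show ?thesis using \<nu>(2) a(2) \<mu> by (auto simp: N1_def)
    qed
    moreover have "a (y \<mu>) \<le> 1 / ?n"
      using y(3)[of \<mu> \<nu>] \<mu> \<nu>N unfolding a_def by (metis DiffD1 DiffD2 less_imp_le singletonI)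
    moreover have "0 \<le> a (y \<mu>)"
      using av_nonneg[OF K a(1)] y(1) \<mu> by blast
    ultimately have "a (of_rat (q \<mu>)) * a (y \<mu>) \<le> ?c * (1 / ?n)"
      using c by (intro mult_mono) auto
    then show "a (of_rat (q \<mu>) * y \<mu>) \<le> ?c * (1 / ?n)"
      using av_mult[OF K a(1) number_field_of_rat[OF K] y(1), of \<mu> "q \<mu>"] \<mu> by simp
  qed
  also have "\<dots> = ?c * (real (card (N - {\<nu>})) / ?n)"
    by simp
  also have "\<dots> \<le> ?c * 1"
    using c n N(1) by (intro mult_left_mono) (auto intro!: card_mono)
  finally show False by simp
qed

text \<open>Otherwise a linear function of \<open>k\<close> times \<open>(M / x) ^ k\<close> would
  stay at least 1 although it tends to 0. This removes the factors lost in estimates for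
  \<open>k\<close>-th powers.\<close>

lemma le_if_powers_le_linear_mult:
  fixes x M C D :: real
  assumes "M > 0" and le: "\<And>k. x ^ k \<le> (C * real k + D) * M ^ k"
  shows "x \<le> M"
proof (rule ccontr)
  assume "\<not> x \<le> M"
  define s where "s = M / x"
  have s: "0 < s" "s < 1"
    using \<open>\<not> x \<le> M\<close> assms(1) by (auto simp: s_def)
  have "(\<lambda>k. C * (real k * s ^ k) + D * s ^ k) \<longlonglongrightarrow> C * 0 + D * 0"
    using s by (intro tendsto_intros powser_times_n_limit_0 LIMSEQ_realpow_zero) auto
  then have "\<forall>\<^sub>F k in sequentially. C * (real k * s ^ k) + D * s ^ k < 1"
    by (intro order_tendstoD(2)) auto
  then obtain k where k: "C * (real k * s ^ k) + D * s ^ k < 1"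
    unfolding eventually_sequentially by blast
  have "x ^ k > 0"
    using \<open>\<not> x \<le> M\<close> assms(1) by simp
  then have "1 \<le> (C * real k + D) * M ^ k / x ^ k"
    using le[of k] by simp
  also have "\<dots> = C * (real k * s ^ k) + D * s ^ k"
    by (simp add: s_def power_divide algebra_simps add_divide_distrib)
  finally show False using k by simp
qed

section \<open>Ostrowski's comparison of absolute values on the rationals\<close>

context
  fixes K a
  assumes K: "number_field K" and av: "absolute_value K a"
begin

lemmas K_intros' = number_field_intros[OF K]

text \<open>Expansion in base \<open>n\<close>: there are \<open>d\<close> digits, each of absolute
  value at most \<open>n\<close>, and the powers of \<open>n\<close> are bounded by the power of the
  maximum. The induction splits off the last digit.\<close>

lemma av_of_nat_less_power:
  assumes n: "n \<ge> 2" and "N < n ^ d"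
  shows "a (of_nat N) \<le> real d * real n * max 1 (a (of_nat n)) ^ d"
  using assms(2)
proof (induction d arbitrary: N)
  case 0
  then show ?case by (simp add: av_0[OF K av])
next
  case (Suc d)
  let ?M = "max 1 (a (of_nat n))"
  have "N div n < n ^ d"
    using Suc(2) n by (simp add: less_mult_imp_div_less mult.commute)
  note IH = Suc(1)[OF this]
  have "of_nat N = (of_nat n * of_nat (N div n) + of_nat (N mod n) :: complex)"
    by (metis mult_div_mod_eq of_nat_add of_nat_mult)
  then have "a (of_nat N) \<le> a (of_nat n * of_nat (N div n)) + a (of_nat (N mod n))"
    using av_triangle[OF K av] K_intros' by metis
  also have "a (of_nat n * of_nat (N div n)) = a (of_nat n) * a (of_nat (N div n))"
    by (intro av_mult[OF K av] K_intros')
  also have "\<dots> \<le> ?M * (real d * real n * ?M ^ d)"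
    using IH by (intro mult_mono) (auto intro: av_nonneg[OF K av] K_intros')
  also have "a (of_nat (N mod n)) \<le> real (N mod n)"
    by (rule av_of_nat_le[OF K av])
  also have "\<dots> \<le> real n * ?M ^ Suc d"
  proof -
    have "real (N mod n) \<le> real n * 1" using n by simp
    also have "\<dots> \<le> real n * ?M ^ Suc d"
      by (intro mult_left_mono one_le_power) auto
    finally show ?thesis .
  qed
  finally show ?case
    by (simp add: algebra_simps)
qed

text \<open>The digit estimate is applied to \<open>m ^ k\<close>, which is below
  \<open>n ^ (c * k + 1)\<close>; letting \<open>k\<close> grow removes its linear factor.\<close>

lemma av_of_nat_le_power:
  assumes n: "n \<ge> 2" and "m \<le> n ^ c"
  shows "a (of_nat m) \<le> max 1 (a (of_nat n)) ^ c"
proof (rule le_if_powers_le_linear_mult)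
  let ?M = "max 1 (a (of_nat n))"
  show "?M ^ c > 0" by (simp add: less_max_iff_disj)
  fix k
  have "m ^ k \<le> (n ^ c) ^ k"
    using assms(2) by (rule power_mono) simp
  also have "\<dots> < n ^ Suc (c * k)"
    using n by (simp add: power_mult)
  finally have "a (of_nat (m ^ k)) \<le> real (Suc (c * k)) * real n * ?M ^ Suc (c * k)"
    by (rule av_of_nat_less_power[OF n])
  also have "a (of_nat (m ^ k)) = a (of_nat m) ^ k"
    unfolding of_nat_power by (intro av_power[OF K av] K_intros')
  finally show "a (of_nat m) ^ k \<le> (real c * real n * ?M * real k + real n * ?M) * (?M ^ c) ^ k"
    by (simp add: algebra_simps power_mult)
qed

text \<open>The binomial expansion of \<open>(x + y) ^ k\<close> has \<open>k + 1\<close> terms,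
  each at most the \<open>k\<close>-th power of the maximum, and the factor \<open>k + 1\<close>
  disappears in the limit.\<close>

lemma ultrametric_if_bounded_on_nats:
  assumes "\<And>m. a (of_nat m) \<le> 1"
  shows "ultrametric_on K a"
  unfolding ultrametric_on_def
proof (intro ballI)
  fix x y assume xy: "x \<in> K" "y \<in> K"
  let ?M = "max (a x) (a y)"
  show "a (x + y) \<le> ?M"
  proof (cases "?M > 0")
    case True
    show ?thesis
    proof (rule le_if_powers_le_linear_mult[OF True])
      fix k
      have "a (x + y) ^ k = a ((x + y) ^ k)"
        by (intro av_power[OF K av, symmetric] K_intros' xy)
      also have "\<dots> = a (\<Sum>i\<le>k. of_nat (k choose i) * x ^ i * y ^ (k - i))"
        by (simp add: binomial_ring)
      also have "\<dots> \<le> (\<Sum>i\<le>k. a (of_nat (k choose i) * x ^ i * y ^ (k - i)))"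
        by (intro av_sum_le[OF K av] K_intros' xy)
      also have "\<dots> \<le> (\<Sum>i\<le>k. ?M ^ k)"
      proof (rule sum_mono)
        fix i assume i: "i \<in> {..k}"
        have "a (of_nat (k choose i) * x ^ i * y ^ (k - i))
            = a (of_nat (k choose i)) * a x ^ i * a y ^ (k - i)"
          using xy by (simp add: av_mult[OF K av] av_power[OF K av] K_intros')
        also have "\<dots> \<le> 1 * ?M ^ i * ?M ^ (k - i)"
          using assms[of "k choose i"] av_nonneg[OF K av xy(1)] av_nonneg[OF K av xy(2)] True
          by (intro mult_mono power_mono) (auto intro!: av_nonneg[OF K av] K_intros' mult_nonneg_nonneg)
        also have "\<dots> = ?M ^ k"
          using i by (simp flip: power_add)
        finally show "a (of_nat (k choose i) * x ^ i * y ^ (k - i)) \<le> ?M ^ k" .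
      qed
      also have "\<dots> = (1 * real k + 1) * ?M ^ k"
        by (simp add: algebra_simps)
      finally show "a (x + y) ^ k \<le> (1 * real k + 1) * ?M ^ k" .
    qed
  next
    case False
    then have "a x = 0" "a y = 0"
      using av_nonneg[OF K av xy(1)] av_nonneg[OF K av xy(2)] by auto
    then show ?thesis
      using xy by (auto simp: av_eq_0[OF K av] av_0[OF K av])
  qed
qed

lemma archimedean_of_nat_mono:
  assumes "\<not> ultrametric_on K a" and "m \<le> n"
  shows "a (of_nat m) \<le> a (of_nat n)"
proof -
  have ge1: "a (of_nat n) \<ge> 1" if n: "n \<ge> 2" for n
  proof (rule ccontr)
    assume lt: "\<not> ?thesis"
    have "a (of_nat m) \<le> 1" for m
    proof -
      have "m \<le> n ^ m"
        using less_exp[of m] power_mono[of 2 n m] n by linarith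
      then show ?thesis
        using av_of_nat_le_power[OF n] lt by (simp add: max_def split: if_splits)
    qed
    with assms(1) ultrametric_if_bounded_on_nats show False by blast
  qed
  show ?thesis
  proof (cases "n \<ge> 2")
    case True
    have "a (of_nat m) \<le> max 1 (a (of_nat n)) ^ 1"
      using True assms(2) by (intro av_of_nat_le_power) auto
    then show ?thesis
      using ge1[OF True] by simp
  next
    case False
    then consider "m = n" | "m = 0" "n = 1"
      using assms(2) by linarith
    then show ?thesis
      by cases (simp_all add: av_0[OF K av] av_1[OF K av])
  qed
qed

text \<open>By cross multiplication from the integers. It shows that all archimedean absolute values
  order the rationals by their usual size, as the bound on the number of places requires.\<close>

lemma archimedean_of_rat_mono:
  assumes arch: "\<not> ultrametric_on K a" and "\<bar>q\<bar> \<le> \<bar>r\<bar>"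
  shows "a (of_rat q) \<le> a (of_rat r)"
proof -
  have abs: "a (of_int k) = a (of_nat (nat \<bar>k\<bar>))" for k
  proof (cases "k \<ge> 0")
    case False
    have "of_nat (nat \<bar>k\<bar>) = (- of_int k :: complex)"
      using False by simp
    then show ?thesis
      using av_minus[OF K av, of "of_int k"] number_field_of_rat[OF K, of "of_int k"] by simp
  qed simp
  obtain m n where mn: "q = of_int m / of_int n" "n > 0"
    by (cases q) (auto simp: Fract_of_int_quotient)
  obtain m' n' where mn': "r = of_int m' / of_int n'" "n' > 0"
    by (cases r) (auto simp: Fract_of_int_quotient)
  have intK: "of_int k \<in> K" for k
    using number_field_of_rat[OF K, of "of_int k"] by simp
  have "\<bar>of_int m\<bar> * of_int n' \<le> (\<bar>of_int m'\<bar> * of_int n :: rat)"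
    using assms(2) mn mn' by (simp add: abs_divide field_simps)
  then have "(of_int (\<bar>m\<bar> * n') :: rat) \<le> of_int (\<bar>m'\<bar> * n)"
    by simp
  then have "\<bar>m\<bar> * n' \<le> \<bar>m'\<bar> * n"
    by (simp only: of_int_le_iff)
  then have "\<bar>m * n'\<bar> \<le> \<bar>m' * n\<bar>"
    using mn(2) mn'(2) by (simp add: abs_mult)
  then have "nat \<bar>m * n'\<bar> \<le> nat \<bar>m' * n\<bar>"
    by (rule nat_mono)
  then have "a (of_int (m * n')) \<le> a (of_int (m' * n))"
    unfolding abs by (rule archimedean_of_nat_mono[OF arch])
  then have le: "a (of_int m) * a (of_int n') \<le> a (of_int m') * a (of_int n)"
    by (simp add: av_mult[OF K av] intK)
  have pos: "a (of_int n) > 0" "a (of_int n') > 0"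
    using mn mn' by (auto intro!: av_pos[OF K av] intK)
  have "a (of_rat q) = a (of_int m) / a (of_int n)" "a (of_rat r) = a (of_int m') / a (of_int n')"
    by (simp_all add: mn mn' of_rat_divide av_divide[OF K av] intK)
  then show ?thesis
    using le pos by (simp add: pos_divide_le_eq pos_le_divide_eq)
qed

text \<open>In a Bezout identity \<open>u * p + v * n = 1\<close> the first summand is below 1, so
  the second cannot be.\<close>

lemma ultrametric_coprime_eq_1:
  assumes ultra: "ultrametric_on K a" and p: "prime p" "a (of_nat p) < 1" and n: "\<not> int p dvd n"
  shows "a (of_int n) = 1"
proof -
  have intK: "of_int k \<in> K" for k
    using number_field_of_rat[OF K, of "of_int k"] by simp
  have "coprime (int p) n"
    using p n by (intro prime_imp_coprime) auto
  then obtain u v where uv: "u * int p + v * n = 1"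
    using bezout_int[of "int p" n] by (auto simp: coprime_iff_gcd_eq_1)
  have "1 = a (of_int (u * int p + v * n))"
    by (simp add: uv av_1[OF K av])
  also have "\<dots> = a (of_int u * of_nat p + of_int v * of_int n)"
    by simp
  also have "\<dots> \<le> max (a (of_int u * of_nat p)) (a (of_int v * of_int n))"
    using ultra K_intros'(4)[OF intK K_intros'(10)] K_intros'(4)[OF intK intK]
    unfolding ultrametric_on_def by blast
  finally have "1 \<le> max (a (of_int u) * a (of_nat p)) (a (of_int v) * a (of_int n))"
    by (simp add: av_mult[OF K av] intK K_intros')
  moreover have "a (of_int u) * a (of_nat p) < 1"
    using p(2) ultrametric_of_int_le[OF K av ultra, of u] av_nonneg[OF K av intK, of u]
      av_nonneg[OF K av K_intros'(10)[of p]]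
    using mult_right_mono[of "a (of_int u)" 1 "a (of_nat p)"] by linarith
  moreover have "a (of_int v) * a (of_int n) \<le> 1 * a (of_int n)"
    using ultrametric_of_int_le[OF K av ultra, of v] av_nonneg[OF K av intK, of n]
    by (intro mult_right_mono) auto
  ultimately have "1 \<le> a (of_int n)"
    by linarith
  with ultrametric_of_int_le[OF K av ultra, of n] show ?thesis by simp
qed

lemma ex_prime_factor_less_1:
  assumes "d > 0" "a (of_nat d) < 1"
  shows "\<exists>p\<in>prime_factors d. a (of_nat p) < 1"
  using assms
proof (induction d rule: less_induct)
  case (less d)
  have "d \<noteq> 1"
    using less.prems av_1[OF K av] by auto
  then obtain p where p: "prime p" "p dvd d"
    using prime_factor_nat by blast
  then obtain e where e: "d = p * e" by blast
  have "e > 0" "e < d"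
    using less.prems p e prime_gt_1_nat[OF p(1)] by (auto simp: e)
  show ?case
  proof (cases "a (of_nat p) < 1")
    case True
    then show ?thesis
      using p less.prems by (auto simp: in_prime_factors_iff)
  next
    case False
    have "a (of_nat p) * a (of_nat e) < 1"
      using less.prems(2) by (simp add: e av_mult[OF K av] K_intros')
    then have "a (of_nat e) < 1"
      using False av_nonneg[OF K av K_intros'(10)[of e]]
      using mult_right_mono[of 1 "a (of_nat p)" "a (of_nat e)"] by linarith
    then obtain p' where "p' \<in> prime_factors e" "a (of_nat p') < 1"
      using less.IH \<open>e > 0\<close> \<open>e < d\<close> by blast
    then show ?thesis
      using e less.prems by (auto simp: in_prime_factors_iff)
  qed
qed

end

section \<open>Finiteness of the archimedean places and of those where an element is not a
  unit\<close>

lemma finite_archimedean_places: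
  assumes K: "number_field K"
  shows "finite (archimedean_places K)"
proof -
  let ?A = "{a. absolute_value K a \<and> \<not> ultrametric_on K a}"
  have "finite {\<nu> \<in> places K. \<nu> \<inter> ?A \<noteq> {}}"
  proof (rule finite_places_same_order_on_rats[OF K])
    fix q r :: rat
    show "(\<forall>a\<in>?A. a (of_rat q) \<le> a (of_rat r)) \<or> (\<forall>a\<in>?A. a (of_rat r) \<le> a (of_rat q))"
      using archimedean_of_rat_mono[OF K] linear[of "\<bar>q\<bar>" "\<bar>r\<bar>"] by blast
  qed simp
  moreover have "archimedean_places K \<subseteq> {\<nu> \<in> places K. \<nu> \<inter> ?A \<noteq> {}}"
    by (auto simp: archimedean_places_def ultrametric_on_def not_le dest: places_absolute_value)
  ultimately show ?thesis
    by (rule finite_subset[rotated])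
qed

text \<open>Write \<open>q / r = m / n\<close> in lowest terms. The prime misses \<open>m\<close> or
  \<open>n\<close>, say \<open>n\<close>; then \<open>n\<close> has value 1 and \<open>m\<close> at
  most 1 for every absolute value over \<open>p\<close>, so all of them put \<open>q\<close> below
  \<open>r\<close>.\<close>

lemma finite_places_over_prime:
  assumes K: "number_field K" and p: "prime p"
  shows "finite {\<nu> \<in> places K. \<nu> \<inter> {a. absolute_value K a \<and> ultrametric_on K a \<and> a (of_nat p) < 1} \<noteq> {}}"
    (is "finite {\<nu> \<in> _. \<nu> \<inter> ?A \<noteq> {}}")
proof (rule finite_places_same_order_on_rats[OF K])
  fix q r :: rat assume qr: "q \<noteq> 0" "r \<noteq> 0"
  have intK: "of_int k \<in> K" for k
    using number_field_of_rat[OF K, of "of_int k"] by simp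
  have *: "\<forall>a\<in>?A. a (of_rat q) \<le> a (of_rat r)"
    if "q * of_int n = r * of_int m" "\<not> int p dvd n" for q r m n
  proof
    fix a assume "a \<in> ?A"
    then have a: "absolute_value K a" "ultrametric_on K a" "a (of_nat p) < 1" by auto
    have "of_rat q * of_int n = (of_rat r * of_int m :: complex)"
      using that(1) by (metis of_rat_mult of_rat_of_int_eq)
    then have "a (of_rat q) * a (of_int n) = a (of_rat r) * a (of_int m)"
      by (metis av_mult[OF K a(1)] intK number_field_of_rat[OF K])
    then have "a (of_rat q) = a (of_rat r) * a (of_int m)"
      using ultrametric_coprime_eq_1[OF K a(1,2) p a(3) that(2)] by simp
    then show "a (of_rat q) \<le> a (of_rat r)"
      using ultrametric_of_int_le[OF K a(1,2), of m]
        av_nonneg[OF K a(1) number_field_of_rat[OF K, of r]]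
      by (simp add: mult_left_le)
  qed
  obtain m n where mn: "quotient_of (q / r) = (m, n)"
    by (cases "quotient_of (q / r)")
  then have "q / r = of_int m / of_int n" "n > 0" "coprime m n"
    using quotient_of_div quotient_of_denom_pos quotient_of_coprime by blast+
  then have eq: "q * of_int n = r * of_int m"
    using qr by (simp add: field_simps)
  have "\<not> int p dvd m \<or> \<not> int p dvd n"
    using \<open>coprime m n\<close> p by (meson coprime_common_divisor not_prime_unit prime_nat_int_transfer)
  then show "(\<forall>a\<in>?A. a (of_rat q) \<le> a (of_rat r)) \<or> (\<forall>a\<in>?A. a (of_rat r) \<le> a (of_rat q))"
    using *[OF eq] *[OF eq[symmetric]] by blast
qed simp

text \<open>\<open>c\<close> satisfies a monic equation over the rationals. Where \<open>c\<close>
  is not integral, some coefficient is not integral either, so the place lies over one of the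
  finitely many primes in the denominators.\<close>

lemma finite_places_gt_1:
  assumes K: "number_field K" and c: "c \<in> K"
  shows "finite {\<nu> \<in> places K. \<exists>a\<in>\<nu>. ultrametric_on K a \<and> a c > 1}"
proof -
  note K_intros = number_field_intros[OF K]
  obtain n :: nat and e where e: "e n \<noteq> 0" "(\<Sum>i\<le>n. of_rat (e i) * c ^ i) = 0"
    by (rule number_field_relation_powers[OF K c])
  define q where "q i = - (e i / e n)" for i
  have "(\<Sum>i<n. of_rat (e i) * c ^ i) + of_rat (e n) * c ^ n = 0"
    using e(2) by (simp add: lessThan_Suc_atMost[symmetric])
  then have "c ^ n = - (\<Sum>i<n. of_rat (e i) * c ^ i) / of_rat (e n)"
    using e(1) by (simp add: field_simps eq_neg_iff_add_eq_0)
  also have "\<dots> = (\<Sum>i<n. of_rat (q i) * c ^ i)"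
    by (simp add: q_def sum_negf sum_divide_distrib of_rat_minus of_rat_divide)
  finally have cn: "c ^ n = (\<Sum>i<n. of_rat (q i) * c ^ i)" .
  define d where "d i = nat (snd (quotient_of (q i)))" for i
  let ?A = "\<lambda>p. {a. absolute_value K a \<and> ultrametric_on K a \<and> a (of_nat p) < 1}"
  define P where "P = (\<Union>i<n. prime_factors (d i))"
  have "{\<nu> \<in> places K. \<exists>a\<in>\<nu>. ultrametric_on K a \<and> a c > 1} \<subseteq> (\<Union>p\<in>P. {\<nu> \<in> places K. \<nu> \<inter> ?A p \<noteq> {}})"
  proof
    fix \<nu> assume "\<nu> \<in> {\<nu> \<in> places K. \<exists>a\<in>\<nu>. ultrametric_on K a \<and> a c > 1}"
    then obtain a where \<nu>: "\<nu> \<in> places K" and a: "a \<in> \<nu>" "ultrametric_on K a" "a c > 1"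
      by blast
    have av: "absolute_value K a"
      using places_absolute_value \<nu> a by blast
    have "\<exists>i<n. a (of_rat (q i)) > 1"
    proof (rule ccontr)
      assume "\<not> ?thesis"
      then have le: "a (of_rat (q i)) \<le> 1" if "i < n" for i
        using that by auto
      have "a c ^ n = a (\<Sum>i<n. of_rat (q i) * c ^ i)"
        using av_power[OF K av c] cn by metis
      also have "\<dots> \<le> a c ^ (n - 1)"
      proof (rule ultrametric_sum_le[OF K av a(2)])
        fix i assume i: "i \<in> {..<n}"
        show "of_rat (q i) * c ^ i \<in> K"
          by (intro K_intros c)
        have "a (of_rat (q i) * c ^ i) = a (of_rat (q i)) * a c ^ i"
          by (simp add: av_mult[OF K av] av_power[OF K av] c K_intros)
        also have "\<dots> \<le> 1 * a c ^ (n - 1)"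
          using i le a(3) by (intro mult_mono power_increasing) auto
        finally show "a (of_rat (q i) * c ^ i) \<le> a c ^ (n - 1)" by simp
      qed (use a(3) in auto)
      finally have le: "a c ^ n \<le> a c ^ (n - 1)" .
      show False
      proof (cases n)
        \<comment> \<open>For \<open>n = 0\<close> the relation reads \<open>1 = 0\<close>.\<close>
        case 0
        then show ?thesis using cn by simp
      next
        case (Suc k)
        then show ?thesis using le a(3) by (simp add: power_increasing_iff[symmetric])
      qed
    qed
    then obtain i where i: "i < n" "a (of_rat (q i)) > 1" by blast
    obtain m l where ml: "quotient_of (q i) = (m, l)"
      by (cases "quotient_of (q i)")
    then have q: "q i = of_int m / of_int l" "l > 0"
      using quotient_of_div quotient_of_denom_pos by blast+
    have intK: "of_int k \<in> K" for k
      using number_field_of_rat[OF K, of "of_int k"] by simp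
    have "a (of_int l) < 1"
    proof (rule ccontr)
      assume "\<not> ?thesis"
      moreover have "a (of_rat (q i)) = a (of_int m) / a (of_int l)"
        by (simp add: q of_rat_divide av_divide[OF K av] intK)
      ultimately show False
        using i(2) ultrametric_of_int_le[OF K av a(2), of m] by (simp add: less_divide_eq_1)
    qed
    moreover have "of_nat (d i) = (of_int l :: complex)" "d i > 0"
      using q(2) ml by (simp_all add: d_def)
    ultimately obtain p where "p \<in> prime_factors (d i)" "a (of_nat p) < 1"
      using ex_prime_factor_less_1[OF K av, of "d i"] by auto
    then show "\<nu> \<in> (\<Union>p\<in>P. {\<nu> \<in> places K. \<nu> \<inter> ?A p \<noteq> {}})"
      using \<nu> a av i(1) by (auto simp: P_def)
  qed
  moreover have "finite (\<Union>p\<in>P. {\<nu> \<in> places K. \<nu> \<inter> ?A p \<noteq> {}})"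
    using finite_places_over_prime[OF K] by (auto simp: P_def)
  ultimately show ?thesis
    by (rule finite_subset)
qed

lemma finite_places_neq_1:
  assumes K: "number_field K" and c: "c \<in> K" "c \<noteq> 0"
  shows "finite {\<nu> \<in> places K. \<exists>a\<in>\<nu>. ultrametric_on K a \<and> a c \<noteq> 1}"
proof (rule finite_subset)
  show "{\<nu> \<in> places K. \<exists>a\<in>\<nu>. ultrametric_on K a \<and> a c \<noteq> 1}
    \<subseteq> {\<nu> \<in> places K. \<exists>a\<in>\<nu>. ultrametric_on K a \<and> a c > 1}
      \<union> {\<nu> \<in> places K. \<exists>a\<in>\<nu>. ultrametric_on K a \<and> a (inverse c) > 1}"
  proof
    fix \<nu> assume "\<nu> \<in> {\<nu> \<in> places K. \<exists>a\<in>\<nu>. ultrametric_on K a \<and> a c \<noteq> 1}"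
    then obtain a where a: "\<nu> \<in> places K" "a \<in> \<nu>" "ultrametric_on K a" "a c \<noteq> 1"
      by blast
    then have av: "absolute_value K a"
      using places_absolute_value by blast
    have "a c > 1 \<or> a (inverse c) > 1"
      using a(4) av_pos[OF K av c] by (auto simp: av_inverse[OF K av c(1)] one_less_inverse_iff)
    with a show "\<nu> \<in> {\<nu> \<in> places K. \<exists>a\<in>\<nu>. ultrametric_on K a \<and> a c > 1}
      \<union> {\<nu> \<in> places K. \<exists>a\<in>\<nu>. ultrametric_on K a \<and> a (inverse c) > 1}"
      by blast
  qed
  show "finite ({\<nu> \<in> places K. \<exists>a\<in>\<nu>. ultrametric_on K a \<and> a c > 1}
      \<union> {\<nu> \<in> places K. \<exists>a\<in>\<nu>. ultrametric_on K a \<and> a (inverse c) > 1})"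
    using finite_places_gt_1[OF K c(1)] finite_places_gt_1[OF K number_field_inverse[OF K c(1)]]
    by (rule finite_UnI)
qed

text \<open>Every element of \<open>A\<close> other than 0 becomes a unit of the ring of \<open>S\<close>-integers.\<close>

definition bad_places :: "complex set \<Rightarrow> complex set \<Rightarrow> (complex \<Rightarrow> real) set set" where
  "bad_places K A = archimedean_places K \<union>
     (\<Union>c\<in>A - {0}. {\<nu> \<in> places K. \<exists>a\<in>\<nu>. ultrametric_on K a \<and> a c \<noteq> 1})"

definition S_integers :: "complex set \<Rightarrow> (complex \<Rightarrow> real) set set \<Rightarrow> complex set" where
  "S_integers K S = {x \<in> K. \<forall>\<nu>\<in>places K - S. \<forall>a\<in>\<nu>. a x \<le> 1}"

lemma finite_bad_places:
  assumes "number_field K" "finite A" "A \<subseteq> K"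
  shows "finite (bad_places K A)"
  unfolding bad_places_def
proof (intro finite_UnI finite_UN_I finite_archimedean_places[OF assms(1)])
  show "finite (A - {0})"
    using assms(2) by simp
  show "finite {\<nu> \<in> places K. \<exists>a\<in>\<nu>. ultrametric_on K a \<and> a c \<noteq> 1}" if "c \<in> A - {0}" for c
    using that assms(3) by (intro finite_places_neq_1[OF assms(1)]) auto
qed

lemma ultrametric_if_not_archimedean:
  assumes "\<nu> \<in> places K - S" "archimedean_places K \<subseteq> S" "a \<in> \<nu>"
  shows "ultrametric_on K a"
  using assms unfolding archimedean_places_def ultrametric_on_def by (force simp: not_le)

lemma subring_valuation_ring:
  assumes K: "number_field K" and av: "absolute_value K a" and ultra: "ultrametric_on K a"
  shows "subring {z \<in> K. a z \<le> 1}"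
proof -
  note K_intros = number_field_intros[OF K]
  have "a (x - y) \<le> 1" if xy: "x \<in> K" "y \<in> K" "a x \<le> 1" "a y \<le> 1" for x y
  proof -
    have "a (x + - y) \<le> max (a x) (a (- y))"
      using ultra xy(1) K_intros(5)[OF xy(2)] unfolding ultrametric_on_def by blast
    then show ?thesis
      using xy av_minus[OF K av xy(2)] by simp
  qed
  moreover have "a (x * y) \<le> 1" if "x \<in> K" "y \<in> K" "a x \<le> 1" "a y \<le> 1" for x y
    using that av_nonneg[OF K av] by (simp add: av_mult[OF K av] mult_le_one)
  ultimately show ?thesis
    by (auto simp: subring_def av_1[OF K av] intro: K_intros)
qed

lemma subring_S_integers:
  assumes K: "number_field K" and S: "archimedean_places K \<subseteq> S"
  shows "subring (S_integers K S)"
proof -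
  note sub = number_field_subring[OF K]
  have val: "subring {z \<in> K. a z \<le> 1}" if "\<nu> \<in> places K - S" "a \<in> \<nu>" for \<nu> a
    using that by (intro subring_valuation_ring[OF K] ultrametric_if_not_archimedean[OF that(1) S that(2)])
      (auto intro: places_absolute_value)
  show ?thesis
    unfolding subring_def
  proof (intro conjI ballI)
    show "1 \<in> S_integers K S"
      using subring_1[OF val] subring_1[OF sub] by (auto simp: S_integers_def)
    fix x y assume "x \<in> S_integers K S" "y \<in> S_integers K S"
    then show "x - y \<in> S_integers K S" "x * y \<in> S_integers K S"
      using subring_diff[OF val] subring_mult[OF val] subring_diff[OF sub] subring_mult[OF sub]
      by (auto simp: S_integers_def)
  qed
qed

lemma S_integers_bad_places:
  assumes K: "number_field K" and A: "A \<subseteq> K" and c: "c \<in> A"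
  shows "c \<in> S_integers K (bad_places K A)" and "inverse c \<in> S_integers K (bad_places K A)"
proof -
  have cK: "c \<in> K" using A c by blast
  have *: "a c \<le> 1 \<and> a (inverse c) \<le> 1" if \<nu>: "\<nu> \<in> places K - bad_places K A" "a \<in> \<nu>" for \<nu> a
  proof (cases "c = 0")
    \<comment> \<open>\<open>inverse 0 = 0\<close>, so both bounds hold for zero as well.\<close>
    case True
    then show ?thesis
      using av_0[OF K places_absolute_value, of \<nu> a] \<nu> by simp
  next
    case False
    have av: "absolute_value K a" 
      using \<nu> places_absolute_value by blast
    have "ultrametric_on K a"
      using \<nu> by (intro ultrametric_if_not_archimedean[OF \<nu>(1)]) (auto simp: bad_places_def)
    then have "a c = 1"
      using \<nu> False c unfolding bad_places_def by blast
    then show ?thesis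
      by (simp add: av_inverse[OF K av cK])
  qed
  then show "c \<in> S_integers K (bad_places K A)" "inverse c \<in> S_integers K (bad_places K A)"
    using cK number_field_inverse[OF K] by (auto simp: S_integers_def)
qed

section \<open>Forms and integrality of points\<close>

abbreviation monomial_value :: "('n::finite \<Rightarrow>\<^sub>0 nat) \<Rightarrow> complex ^ 'n \<Rightarrow> complex" where
  "monomial_value m x \<equiv> (\<Prod>i\<in>UNIV. x $ i ^ Poly_Mapping.lookup m i)"

lemma eval_mpoly_superset:
  assumes "finite A" "Poly_Mapping.keys F \<subseteq> A"
  shows "eval_mpoly F x = (\<Sum>m\<in>A. Poly_Mapping.lookup F m * monomial_value m x)"
  unfolding eval_mpoly_def using assms by (intro sum.mono_neutral_left) (auto simp: in_keys_iff)

lemma eval_mpoly_add: "eval_mpoly (F + G) x = eval_mpoly F x + eval_mpoly G x"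
proof -
  let ?A = "Poly_Mapping.keys F \<union> Poly_Mapping.keys G"
  have A: "finite ?A" by simp
  have "eval_mpoly (F + G) x = (\<Sum>m\<in>?A. Poly_Mapping.lookup (F + G) m * monomial_value m x)"
    by (rule eval_mpoly_superset[OF A Poly_Mapping.keys_add])
  also have "\<dots> = (\<Sum>m\<in>?A. Poly_Mapping.lookup F m * monomial_value m x)
      + (\<Sum>m\<in>?A. Poly_Mapping.lookup G m * monomial_value m x)"
    by (simp add: lookup_add distrib_right sum.distrib)
  also have "\<dots> = eval_mpoly F x + eval_mpoly G x"
    using eval_mpoly_superset[OF A, of F x] eval_mpoly_superset[OF A, of G x] by simp
  finally show ?thesis .
qed

lemma eval_mpoly_0: "eval_mpoly 0 x = 0"
  by (simp add: eval_mpoly_def)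

lemma eval_mpoly_sum: "eval_mpoly (sum F A) x = (\<Sum>i\<in>A. eval_mpoly (F i) x)"
  by (induction A rule: infinite_finite_induct) (auto simp: eval_mpoly_0 eval_mpoly_add)

lemma eval_mpoly_single: "eval_mpoly (Poly_Mapping.single m c) x = c * monomial_value m x"
  using eval_mpoly_superset[of "{m}" "Poly_Mapping.single m c" x] by (simp split: if_splits)

lemma form_sum:
  assumes "subring R" "\<And>i. i \<in> A \<Longrightarrow> form d R (F i)"
  shows "form d R (sum F A)"
  using assms(2)
proof (induction A rule: infinite_finite_induct)
  case (insert i A)
  then have F: "form d R (F i)" and G: "form d R (sum F A)"
    by auto
  have lookup: "Poly_Mapping.lookup H m \<in> R" if "form d R H" for H :: "'b mpoly" and m
    using that subring_0[OF assms(1)] by (cases "m \<in> Poly_Mapping.keys H") (auto simp: form_def in_keys_iff)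
  have "form d R (F i + sum F A)"
    unfolding form_def
  proof (intro ballI conjI)
    fix m assume "m \<in> Poly_Mapping.keys (F i + sum F A)"
    then have "m \<in> Poly_Mapping.keys (F i) \<union> Poly_Mapping.keys (sum F A)"
      by (rule subsetD[OF Poly_Mapping.keys_add])
    then show "(\<Sum>j\<in>UNIV. Poly_Mapping.lookup m j) = d"
      using F G by (auto simp: form_def)
    show "Poly_Mapping.lookup (F i + sum F A) m \<in> R"
      using lookup[OF F] lookup[OF G] by (auto simp: lookup_add intro: subring_add[OF assms(1)])
  qed
  with insert show ?case
    by simp
qed (auto simp: form_def)

text \<open>The product is an explicit sum of monomials, so degree and coefficient ring are checked
  term by term.\<close>

lemma ex_form_mult:
  assumes R: "subring R" and F: "form d R F" and G: "form e R G"
  shows "\<exists>H. form (d + e) R H \<and> (\<forall>x. eval_mpoly H x = eval_mpoly F x * eval_mpoly G x)"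
proof -
  define T where "T m n = Poly_Mapping.single (m + n) (Poly_Mapping.lookup F m * Poly_Mapping.lookup G n)" for m n
  let ?H = "\<Sum>m\<in>Poly_Mapping.keys F. \<Sum>n\<in>Poly_Mapping.keys G. T m n"
  have "form (d + e) R (T m n)" if "m \<in> Poly_Mapping.keys F" "n \<in> Poly_Mapping.keys G" for m n
    using that F G
    by (auto simp: form_def T_def lookup_add sum.distrib intro: subring_mult[OF R] split: if_splits)
  then have "form (d + e) R ?H"
    by (intro form_sum[OF R])
  moreover have "eval_mpoly ?H x = eval_mpoly F x * eval_mpoly G x" for x
  proof -
    have "eval_mpoly (T m n) x = (Poly_Mapping.lookup F m * monomial_value m x)
        * (Poly_Mapping.lookup G n * monomial_value n x)" for m n
      by (simp add: T_def eval_mpoly_single lookup_add power_add prod.distrib)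
    then have "eval_mpoly ?H x = (\<Sum>m\<in>Poly_Mapping.keys F. \<Sum>n\<in>Poly_Mapping.keys G.
        (Poly_Mapping.lookup F m * monomial_value m x) * (Poly_Mapping.lookup G n * monomial_value n x))"
      by (simp add: eval_mpoly_sum)
    also have "\<dots> = eval_mpoly F x * eval_mpoly G x"
      unfolding eval_mpoly_def by (rule sum_product[symmetric])
    finally show ?thesis .
  qed
  ultimately show ?thesis by blast
qed

lemma eval_form_scale:
  assumes "form d R F"
  shows "eval_mpoly F (c *s x) = c ^ d * eval_mpoly F x"
  unfolding eval_mpoly_def sum_distrib_left
proof (rule sum.cong[OF refl])
  fix m assume m: "m \<in> Poly_Mapping.keys F"
  have "monomial_value m (c *s x) = (\<Prod>i\<in>UNIV. c ^ Poly_Mapping.lookup m i) * monomial_value m x"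
    by (simp add: power_mult_distrib prod.distrib)
  also have "(\<Prod>i\<in>UNIV. c ^ Poly_Mapping.lookup m i) = c ^ d"
    using assms m by (simp add: form_def flip: power_sum)
  finally show "Poly_Mapping.lookup F m * monomial_value m (c *s x)
      = c ^ d * (Poly_Mapping.lookup F m * monomial_value m x)"
    by simp
qed

lemma eval_form_in_subring:
  assumes R: "subring R" and "form d R F" "\<And>i. x $ i \<in> R"
  shows "eval_mpoly F x \<in> R"
  using assms unfolding eval_mpoly_def form_def
  by (intro subring_sum[OF R] subring_mult[OF R] subring_prod[OF R] subring_power[OF R]) auto

lemma form_mono: "form d R F \<Longrightarrow> R \<subseteq> R' \<Longrightarrow> form d R' F"
  by (auto simp: form_def)

section \<open>Linear and quadratic forms: coefficient vectors, matrices, polarisation\<close>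

lemma sum_eq_1_nat_fun:
  fixes f :: "'n::finite \<Rightarrow> nat"
  assumes "(\<Sum>i\<in>UNIV. f i) = 1"
  shows "\<exists>i. \<forall>k. f k = (if k = i then 1 else 0)"
proof -
  obtain i where i: "f i > 0"
    using assms by (metis One_nat_def less_Suc0 nat_neq_iff not_gr0 sum.neutral zero_neq_one)
  have "f i + (\<Sum>k\<in>UNIV - {i}. f k) = 1"
    using assms sum.remove[of UNIV i f] by simp
  with i have "f i = 1" "(\<Sum>k\<in>UNIV - {i}. f k) = 0"
    by linarith+
  then show ?thesis
    by (intro exI[of _ i]) auto
qed

lemma sum_eq_2_nat_fun:
  fixes f :: "'n::finite \<Rightarrow> nat"
  assumes "(\<Sum>i\<in>UNIV. f i) = 2"
  shows "\<exists>i j. \<forall>k. f k = (if k = i then 1 else 0) + (if k = j then 1 else 0)"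
proof -
  obtain i where i: "f i > 0"
    using assms by (metis not_gr0 sum.neutral zero_neq_numeral)
  have "f i + (\<Sum>k\<in>UNIV - {i}. f k) = 2"
    using assms sum.remove[of UNIV i f] by simp
  moreover have "(\<Sum>k\<in>UNIV. f k - (if k = i then 1 else 0)) = (f i - 1) + (\<Sum>k\<in>UNIV - {i}. f k)"
    using sum.remove[of UNIV i "\<lambda>k. f k - (if k = i then 1 else 0)"] by simp
  ultimately have "(\<Sum>k\<in>UNIV. f k - (if k = i then 1 else 0)) = 1"
    using i by simp
  then obtain j where "\<forall>k. f k - (if k = i then 1 else 0) = (if k = j then 1 else 0)"
    using sum_eq_1_nat_fun[of "\<lambda>k. f k - (if k = i then 1 else 0)"] by blast
  then have j: "f k - (if k = i then 1 else 0) = (if k = j then 1 else 0)" for k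
    by blast
  have "f k = (if k = i then 1 else 0) + (if k = j then 1 else 0)" for k
    using j[of k] i by (auto split: if_splits)
  then show ?thesis by blast
qed

lemma prod_power_delta:
  fixes x :: "'a::comm_monoid_mult ^ 'n::finite"
  shows "(\<Prod>k\<in>UNIV. x $ k ^ (if k = i then 1 else 0)) = x $ i"
proof -
  have "(\<Prod>k\<in>UNIV. x $ k ^ (if k = i then 1 else 0)) = (\<Prod>k\<in>UNIV. if k = i then x $ k else 1)"
    by (intro prod.cong) auto
  then show ?thesis by simp
qed

lemma form_1_vector:
  assumes R: "subring R" and F: "form 1 R F"
  shows "\<exists>h :: complex ^ 'n::finite. (\<forall>i. h $ i \<in> R) \<and> (\<forall>x. eval_mpoly F x = (\<Sum>i\<in>UNIV. h $ i * x $ i))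
    \<and> (\<forall>x. grad F x = h)"
proof -
  let ?K = "Poly_Mapping.keys F"
  let ?c = "Poly_Mapping.lookup F"
  have "\<exists>i. \<forall>k. Poly_Mapping.lookup m k = (if k = i then 1 else 0)" if "m \<in> ?K" for m
    using that F by (intro sum_eq_1_nat_fun) (auto simp: form_def)
  then obtain I where I: "\<And>m k. m \<in> ?K \<Longrightarrow> Poly_Mapping.lookup m k = (if k = I m then 1 else 0)"
    by metis
  define h :: "complex ^ 'n" where "h = (\<chi> k. \<Sum>m\<in>?K. if k = I m then ?c m else 0)"
  have "h $ i \<in> R" for i
    unfolding h_def using F by (auto simp: form_def subring_0[OF R] intro!: subring_sum[OF R])
  moreover have "eval_mpoly F x = (\<Sum>i\<in>UNIV. h $ i * x $ i)" for x
  proof -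
    have "eval_mpoly F x = (\<Sum>m\<in>?K. \<Sum>i\<in>UNIV. (if i = I m then ?c m else 0) * x $ i)"
      unfolding eval_mpoly_def
    proof (intro sum.cong refl)
      fix m assume m: "m \<in> ?K"
      have "(\<Sum>i\<in>UNIV. (if i = I m then ?c m else 0) * x $ i) = (\<Sum>i\<in>UNIV. if i = I m then ?c m * x $ i else 0)"
        by (intro sum.cong) auto
      then show "?c m * monomial_value m x = (\<Sum>i\<in>UNIV. (if i = I m then ?c m else 0) * x $ i)"
        by (simp only: I[OF m] prod_power_delta) simp
    qed
    also have "\<dots> = (\<Sum>i\<in>UNIV. h $ i * x $ i)"
      by (subst sum.swap) (simp add: h_def sum_distrib_right)
    finally show ?thesis .
  qed
  moreover have "grad F x = h" for x
    unfolding grad_def h_def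
    by (intro vec_eq_iff[THEN iffD2] allI) (auto simp: I intro!: sum.cong)
  ultimately show ?thesis by blast
qed

text \<open>The matrix need not be symmetric: the coefficient of a mixed monomial may sit in a
  single entry, so passing from a form to its matrix never divides by 2.\<close>

definition quad :: "complex ^ 'n ^ 'n \<Rightarrow> complex ^ 'n \<Rightarrow> complex" where
  "quad A x = (\<Sum>i\<in>UNIV. \<Sum>j\<in>UNIV. A $ i $ j * (x $ i * x $ j))"

text \<open>The derivative of \<open>quad A\<close> at \<open>x\<close> in direction
  \<open>y\<close>, that is, the bilinear form of the matrix \<open>A\<close> plus its
  transpose.\<close>

definition polar :: "complex ^ 'n ^ 'n \<Rightarrow> complex ^ 'n \<Rightarrow> complex ^ 'n \<Rightarrow> complex" where
  "polar A x y = (\<Sum>i\<in>UNIV. \<Sum>j\<in>UNIV. A $ i $ j * (x $ i * y $ j + y $ i * x $ j))"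

lemma quad_add: "quad A (x + y) = quad A x + quad A y + polar A x y"
  by (simp add: quad_def polar_def algebra_simps sum.distrib)

lemma quad_scale: "quad A (c *s x) = c\<^sup>2 * quad A x"
  by (simp add: quad_def sum_distrib_left algebra_simps power2_eq_square)

lemma polar_commute: "polar A x y = polar A y x"
  by (simp add: polar_def algebra_simps)

lemma polar_self: "polar A x x = 2 * quad A x"
  by (simp add: quad_def polar_def sum_distrib_left algebra_simps)

lemma polar_add_left: "polar A (x + y) z = polar A x z + polar A y z"
  by (simp add: polar_def algebra_simps sum.distrib)

lemma polar_scale_left: "polar A (c *s x) z = c * polar A x z"
  by (simp add: polar_def sum_distrib_left algebra_simps)

lemma polar_add_right: "polar A z (x + y) = polar A z x + polar A z y"
  by (simp add: polar_commute[of A z] polar_add_left)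

lemma polar_scale_right: "polar A z (c *s x) = c * polar A z x"
  by (simp add: polar_commute[of A z] polar_scale_left)

lemma polar_diff_left: "polar A (x - y) z = polar A x z - polar A y z"
  using polar_add_left[of A "x - y" y z] by simp

lemma polar_diff_right: "polar A z (x - y) = polar A z x - polar A z y"
  by (simp add: polar_commute[of A z] polar_diff_left)

lemmas polar_linear = polar_add_left polar_add_right polar_diff_left polar_diff_right
  polar_scale_left polar_scale_right

lemma quad_in_subring:
  assumes "subring R" "\<And>i j. A $ i $ j \<in> R" "\<And>i. x $ i \<in> R"
  shows "quad A x \<in> R"
  unfolding quad_def using assms(2,3)
  by (intro subring_sum[OF assms(1)] subring_mult[OF assms(1)])

lemma polar_in_subring:
  assumes "subring R" "\<And>i j. A $ i $ j \<in> R" "\<And>i. x $ i \<in> R" "\<And>i. y $ i \<in> R"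
  shows "polar A x y \<in> R"
  unfolding polar_def using assms(2-4)
  by (intro subring_sum[OF assms(1)] subring_mult[OF assms(1)] subring_add[OF assms(1)])

text \<open>Each monomial is filed under one pair of indices. The last clause turns transversality,
  stated by gradients, into linear algebra with \<open>polar\<close>.\<close>

lemma form_2_matrix:
  assumes R: "subring R" and F: "form 2 R F"
  shows "\<exists>A :: complex ^ 'n::finite ^ 'n. (\<forall>i j. A $ i $ j \<in> R) \<and> (\<forall>x. eval_mpoly F x = quad A x)
    \<and> (\<forall>x y. (\<Sum>k\<in>UNIV. grad F x $ k * y $ k) = polar A x y)"
proof -
  let ?K = "Poly_Mapping.keys F"
  let ?c = "Poly_Mapping.lookup F"
  have "\<exists>i j. \<forall>k. Poly_Mapping.lookup m k = (if k = i then 1 else 0) + (if k = j then 1 else 0)"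
    if "m \<in> ?K" for m
    using that F by (intro sum_eq_2_nat_fun) (auto simp: form_def)
  then obtain I J where IJ: "\<And>m k. m \<in> ?K \<Longrightarrow>
      Poly_Mapping.lookup m k = (if k = I m then 1 else 0) + (if k = J m then 1 else 0)"
    by metis
  define A :: "complex ^ 'n ^ 'n" where
    "A = (\<chi> i j. \<Sum>m\<in>?K. if i = I m then (if j = J m then ?c m else 0) else 0)"
  have A_sum: "(\<Sum>i\<in>UNIV. \<Sum>j\<in>UNIV. A $ i $ j * g i j) = (\<Sum>m\<in>?K. ?c m * g (I m) (J m))" for g
  proof -
    have "(\<Sum>i\<in>UNIV. \<Sum>j\<in>UNIV. A $ i $ j * g i j)
        = (\<Sum>i\<in>UNIV. \<Sum>m\<in>?K. \<Sum>j\<in>UNIV. (if i = I m then (if j = J m then ?c m else 0) else 0) * g i j)"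
      unfolding A_def by (simp add: sum_distrib_right) (subst sum.swap, rule refl)
    also have "\<dots> = (\<Sum>m\<in>?K. \<Sum>i\<in>UNIV. \<Sum>j\<in>UNIV. (if i = I m then (if j = J m then ?c m else 0) else 0) * g i j)"
      by (rule sum.swap)
    also have "\<dots> = (\<Sum>m\<in>?K. \<Sum>i\<in>UNIV. if i = I m then (\<Sum>j\<in>UNIV. if j = J m then ?c m * g i j else 0) else 0)"
    proof (intro sum.cong refl)
      fix m i
      show "(\<Sum>j\<in>UNIV. (if i = I m then (if j = J m then ?c m else 0) else 0) * g i j)
          = (if i = I m then (\<Sum>j\<in>UNIV. if j = J m then ?c m * g i j else 0) else 0)"
      proof (cases "i = I m")
        case True
        have "(if j = J m then ?c m else 0) * g i j = (if j = J m then ?c m * g i j else 0)" for j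
          by simp
        then show ?thesis
          unfolding True if_P[OF refl] by (rule sum.cong[OF refl])
      qed simp
    qed
    also have "\<dots> = (\<Sum>m\<in>?K. ?c m * g (I m) (J m))"
      by simp
    finally show ?thesis .
  qed
  have "A $ i $ j \<in> R" for i j
    unfolding A_def using F by (auto simp: form_def subring_0[OF R] intro!: subring_sum[OF R])
  moreover have "eval_mpoly F x = quad A x" for x
    unfolding quad_def A_sum eval_mpoly_def
    by (intro sum.cong refl) (simp only: IJ power_add prod.distrib prod_power_delta)
  moreover have "(\<Sum>k\<in>UNIV. grad F x $ k * y $ k) = polar A x y" for x y
  proof -
    \<comment> \<open>The partial derivative of \<open>x $ I m * x $ J m\<close>; for
      \<open>I m = J m\<close> both summands contribute.\<close>
    have gr: "of_nat (Poly_Mapping.lookup m k) * (\<Prod>j\<in>UNIV. x $ j ^ (Poly_Mapping.lookup m j - (if j = k then 1 else 0)))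
        = (if k = I m then x $ J m else 0) + (if k = J m then x $ I m else 0)" if m: "m \<in> ?K" for m k
    proof (cases "k = I m")
      case True
      have "Poly_Mapping.lookup m j - (if j = k then 1 else 0) = (if j = J m then 1 else 0)" for j
        using True by (simp add: IJ[OF m])
      then show ?thesis
        using True by (simp only: prod_power_delta) (simp add: IJ[OF m])
    next
      case False
      note F1 = False
      show ?thesis
      proof (cases "k = J m")
        case True
        have "Poly_Mapping.lookup m j - (if j = k then 1 else 0) = (if j = I m then 1 else 0)" for j
          using True F1 by (simp add: IJ[OF m])
        then show ?thesis
          using True F1 by (simp only: prod_power_delta) (simp add: IJ[OF m])
      next
        case False
        then show ?thesis
          using F1 by (simp add: IJ[OF m])
      qed
    qed
    have "(\<Sum>k\<in>UNIV. grad F x $ k * y $ k)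
        = (\<Sum>k\<in>UNIV. \<Sum>m\<in>?K. ?c m * ((if k = I m then x $ J m else 0) + (if k = J m then x $ I m else 0)) * y $ k)"
      unfolding grad_def by (simp add: sum_distrib_right mult.assoc gr cong: sum.cong)
    also have "\<dots> = (\<Sum>m\<in>?K. \<Sum>k\<in>UNIV. ?c m * ((if k = I m then x $ J m else 0) + (if k = J m then x $ I m else 0)) * y $ k)"
      by (rule sum.swap)
    also have "\<dots> = (\<Sum>m\<in>?K. \<Sum>k\<in>UNIV. (if k = I m then ?c m * (x $ J m * y $ k) else 0)
        + (if k = J m then ?c m * (x $ I m * y $ k) else 0))"
      by (intro sum.cong refl) (simp add: algebra_simps)
    also have "\<dots> = (\<Sum>m\<in>?K. ?c m * (x $ I m * y $ J m + y $ I m * x $ J m))"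
      by (simp add: sum.distrib algebra_simps)
    finally show ?thesis
      unfolding polar_def A_sum .
  qed
  ultimately show ?thesis by blast
qed

text \<open>A form witnessing that a point with unit values does not reduce into the union of two
  hypersurfaces is the product of the two equations.\<close>

lemma integral_pointsI:
  fixes x :: "complex ^ 'n::finite"
  assumes K: "number_field K" and S: "archimedean_places K \<subseteq> S"
    and F: "form d (S_integers K S) F" and G: "form e (S_integers K S) G"
    and x: "x \<noteq> 0" "\<And>i. x $ i \<in> S_integers K S"
    and units: "eval_mpoly F x \<noteq> 0" "inverse (eval_mpoly F x) \<in> S_integers K S"
      "eval_mpoly G x \<noteq> 0" "inverse (eval_mpoly G x) \<in> S_integers K S"
  shows "x \<in> integral_points K S proj_space (zero_locus {F} \<union> zero_locus {G})"
proof -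
  let ?O = "S_integers K S"
  let ?D = "zero_locus {F} \<union> zero_locus {G}"
  have sub: "subring ?O"
    using K S by (rule subring_S_integers)
  have OK: "?O \<subseteq> K"
    by (auto simp: S_integers_def)
  have "\<not> reduces_into K \<nu> ?D x" if \<nu>: "\<nu> \<in> places K - S" for \<nu>
  proof
    assume "reduces_into K \<nu> ?D x"
    then obtain a c where a: "a \<in> \<nu>" and c: "c \<in> K" "\<exists>i. a (c * x $ i) = 1"
      and van: "\<And>d H. form d {z \<in> K. a z \<le> 1} H \<Longrightarrow> (\<forall>y\<in>?D. eval_mpoly H y = 0)
          \<Longrightarrow> a (eval_mpoly H (c *s x)) < 1"
      unfolding reduces_into_def by blast
    have av: "absolute_value K a"
      using \<nu> a places_absolute_value by blast
    have ultra: "ultrametric_on K a"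
      using ultrametric_if_not_archimedean[OF \<nu> S a] .
    have O_le: "a z \<le> 1" if "z \<in> ?O" for z
      using that \<nu> a by (auto simp: S_integers_def)
    have sub_a: "?O \<subseteq> {z \<in> K. a z \<le> 1}"
      using O_le OK by blast
    obtain H where H: "form (d + e) {z \<in> K. a z \<le> 1} H"
      "\<And>x. eval_mpoly H x = eval_mpoly F x * eval_mpoly G x"
      using ex_form_mult[OF subring_valuation_ring[OF K av ultra] form_mono[OF F sub_a] form_mono[OF G sub_a]]
      by blast
    have "\<forall>y\<in>?D. eval_mpoly H y = 0"
      by (auto simp: H(2) zero_locus_def)
    then have lt: "a (eval_mpoly H (c *s x)) < 1"
      using van H(1) by blast
    have unit: "a z = 1" if "z \<in> ?O" "z \<noteq> 0" "inverse z \<in> ?O" for z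
    proof -
      have "inverse (a z) \<le> 1"
        using O_le[OF that(3)] av_inverse[OF K av, of z] that(1) OK by auto
      moreover have "a z > 0"
        using that OK by (intro av_pos[OF K av]) auto
      ultimately show ?thesis
        using O_le[OF that(1)] by (simp add: inverse_le_1_iff)
    qed
    have FG: "eval_mpoly F x \<in> ?O" "eval_mpoly G x \<in> ?O"
      using eval_form_in_subring[OF sub] F G x(2) by blast+
    obtain i where i: "a (c * x $ i) = 1"
      using c(2) by blast
    \<comment> \<open>The scaled vector has a unit coordinate while \<open>x\<close> is integral,
      hence \<open>a c \<ge> 1\<close>. The value of \<open>H\<close> is \<open>c ^ (d + e)\<close>
      times two units, so it lies outside the maximal ideal.\<close>
    have "a c * a (x $ i) = 1"
      using i av_mult[OF K av c(1), of "x $ i"] x(2)[of i] OK by auto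
    then have "1 \<le> a c"
      using O_le[OF x(2)[of i]] av_nonneg[OF K av c(1)] mult_left_mono[of "a (x $ i)" 1 "a c"] by simp
    then have "1 \<le> a c ^ (d + e)"
      by (rule one_le_power)
    also have "\<dots> = a (c ^ (d + e) * (eval_mpoly F x * eval_mpoly G x))"
      using FG c(1) OK unit[OF FG(1) units(1,2)] unit[OF FG(2) units(3,4)]
      by (simp add: av_mult[OF K av] av_power[OF K av] number_field_intros[OF K] subset_iff)
    also have "c ^ (d + e) * (eval_mpoly F x * eval_mpoly G x) = eval_mpoly H (c *s x)"
      by (simp add: H(2) eval_form_scale[OF H(1)] flip: H(2))
    finally show False
      using lt by simp
  qed
  then show ?thesis
    using x OK units unfolding integral_points_def proj_space_def zero_locus_def by auto
qed

text \<open>A closed set is cut out by forms, so density follows if every form that vanishes on the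
  integral points is zero as a function. The only freedom left is the finite set \<open>A\<close> of
  elements to be made units.\<close>

lemma potentially_denseI:
  fixes D :: "(complex ^ 'n::finite) set"
  assumes L: "number_field L" "K \<subseteq> L" and A: "finite A" "A \<subseteq> L"
    and dense: "\<And>d F. form d UNIV F \<Longrightarrow> (\<And>x. x \<in> integral_points L (bad_places L A) proj_space D \<Longrightarrow> eval_mpoly F x = 0)
      \<Longrightarrow> (\<And>x. eval_mpoly F x = 0)"
  shows "integral_points_potentially_dense K proj_space D"
  unfolding integral_points_potentially_dense_def
proof (intro exI conjI)
  show "zariski_dense_in (integral_points L (bad_places L A) proj_space D) (proj_space - D)"
    unfolding zariski_dense_in_def
  proof (intro conjI allI impI)
    show "integral_points L (bad_places L A) proj_space D \<subseteq> proj_space - D"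
      by (auto simp: integral_points_def)
    fix Z :: "(complex ^ 'n) set"
    assume Z: "zariski_closed Z \<and> integral_points L (bad_places L A) proj_space D \<subseteq> Z"
    then obtain FF where FF: "\<forall>F\<in>FF. \<exists>d. form d UNIV F" "Z = zero_locus FF"
      by (auto simp: zariski_closed_def)
    have "eval_mpoly F x = 0" if "F \<in> FF" for F x
    proof -
      obtain d where d: "form d UNIV F"
        using FF(1) \<open>F \<in> FF\<close> by blast
      have "eval_mpoly F x = 0" if "x \<in> integral_points L (bad_places L A) proj_space D" for x
        using that Z \<open>F \<in> FF\<close> by (auto simp: FF(2) zero_locus_def)
      then show ?thesis
        using dense[OF d] by blast
    qed
    then show "proj_space - D \<subseteq> Z"
      by (auto simp: FF(2) zero_locus_def)
  qed
  show "bad_places L A \<subseteq> places L"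
    by (auto simp: bad_places_def archimedean_places_def)
  show "archimedean_places L \<subseteq> bad_places L A"
    by (auto simp: bad_places_def)
qed (use L A in \<open>auto intro: finite_bad_places\<close>)

section \<open>Rational frames of a smooth conic\<close>

text \<open>The coordinates \<open>y, z, h, m\<close> belong to \<open>E, P, W, R\<close> in this
  order; \<open>h\<close> is the coordinate transverse to the plane of the conic.\<close>

definition comb :: "complex ^ 'n \<Rightarrow> complex ^ 'n \<Rightarrow> complex ^ 'n \<Rightarrow> complex ^ 'n
    \<Rightarrow> complex \<Rightarrow> complex \<Rightarrow> complex \<Rightarrow> complex \<Rightarrow> complex ^ 'n" where
  "comb E P W R y z h m = y *s E + z *s P + h *s W + m *s R"

lemma comb_spans:
  fixes E P W R :: "complex ^ 4"
  assumes inj: "\<And>y z h m. comb E P W R y z h m = 0 \<Longrightarrow> y = 0 \<and> z = 0 \<and> h = 0 \<and> m = 0"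
  shows "\<exists>y z h m. x = comb E P W R y z h m"
proof -
  define g :: "complex ^ 4 \<Rightarrow> complex ^ 4" where "g w = comb E P W R (w $ 1) (w $ 2) (w $ 3) (w $ 4)" for w
  have lin: "Vector_Spaces.linear (*s) (*s) g"
    by unfold_locales (auto simp: g_def comb_def vec_eq_iff algebra_simps)
  have "inj g"
  proof (rule injI)
    fix v w assume "g v = g w"
    then have "comb E P W R ((v - w) $ 1) ((v - w) $ 2) ((v - w) $ 3) ((v - w) $ 4) = 0"
      by (simp add: g_def comb_def vec_eq_iff algebra_simps)
    from inj[OF this] show "v = w"
      by (simp add: vec_eq_iff forall_4)
  qed
  then have "surj g"
    using vec.linear_inj_imp_surj[OF lin] by blast
  then obtain w where "x = g w"
    by blast
  then show ?thesis
    by (auto simp: g_def)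
qed

definition vec_over :: "complex set \<Rightarrow> complex ^ 'n \<Rightarrow> bool" where
  "vec_over L v \<longleftrightarrow> (\<forall>i. v $ i \<in> L)"

lemma vec_over_mono: "vec_over L v \<Longrightarrow> L \<subseteq> L' \<Longrightarrow> vec_over L' v"
  by (auto simp: vec_over_def)

lemma vec_over_add: "subring L \<Longrightarrow> vec_over L v \<Longrightarrow> vec_over L w \<Longrightarrow> vec_over L (v + w)"
  and vec_over_diff: "subring L \<Longrightarrow> vec_over L v \<Longrightarrow> vec_over L w \<Longrightarrow> vec_over L (v - w)"
  and vec_over_scale: "subring L \<Longrightarrow> c \<in> L \<Longrightarrow> vec_over L v \<Longrightarrow> vec_over L (c *s v)"
  by (auto simp: vec_over_def intro: subring_add subring_diff subring_mult)

lemma vec_over_axis: "subring L \<Longrightarrow> vec_over L (axis i 1)"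
  by (auto simp: vec_over_def axis_def subring_0 subring_1)

lemma quad_over: "subring L \<Longrightarrow> (\<And>i j. A $ i $ j \<in> L) \<Longrightarrow> vec_over L x \<Longrightarrow> quad A x \<in> L"
  and polar_over: "subring L \<Longrightarrow> (\<And>i j. A $ i $ j \<in> L) \<Longrightarrow> vec_over L x \<Longrightarrow> vec_over L y \<Longrightarrow> polar A x y \<in> L"
  by (auto simp: vec_over_def intro: quad_in_subring polar_in_subring)

lemma quad_comb:
  "quad A (comb E P W R y z h m) = y\<^sup>2 * quad A E + z\<^sup>2 * quad A P + h\<^sup>2 * quad A W + m\<^sup>2 * quad A R
    + y * z * polar A E P + y * h * polar A E W + y * m * polar A E R
    + z * h * polar A P W + z * m * polar A P R + h * m * polar A W R"
  by (simp add: comb_def quad_add quad_scale polar_linear polar_commute[of A W E] polar_commute[of A W P]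
      polar_commute[of A R E] polar_commute[of A R P] polar_commute[of A R W] algebra_simps)

lemma polar_comb_right:
  "polar A x (comb E P W R y z h m) = y * polar A x E + z * polar A x P + h * polar A x W + m * polar A x R"
  by (simp add: comb_def polar_linear)

lemma number_field_coefficients:
  assumes K: "number_field K" and alg: "\<And>m. m \<in> Poly_Mapping.keys F \<Longrightarrow> algebraic (Poly_Mapping.lookup F m)"
  shows "\<exists>L. number_field L \<and> K \<subseteq> L \<and> (\<forall>m\<in>Poly_Mapping.keys F. Poly_Mapping.lookup F m \<in> L)"
proof -
  have "\<exists>L. number_field L \<and> K \<subseteq> L \<and> Poly_Mapping.lookup F ` Poly_Mapping.keys F \<subseteq> L"
    using alg by (intro number_field_adjoin_algebraic[OF _ _ K]) auto
  then show ?thesis by blast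
qed

text \<open>A parametrised plane conic: \<open>E, P, R\<close> span its plane and the conic is traced by
  \<open>s t E - t\<^sup>2 P + s\<^sup>2 R\<close>.\<close>

lemma smooth_conic_frame:
  assumes K: "number_field K" and C: "smooth_conic C" and ne: "C \<noteq> {}"
  shows "\<exists>L E P N R. number_field L \<and> K \<subseteq> L \<and>
    vec_over L E \<and> vec_over L P \<and> vec_over L N \<and> vec_over L R \<and>
    (\<forall>x. \<exists>y z h m. x = comb E P N R y z h m) \<and>
    (\<forall>s t. s \<noteq> 0 \<or> t \<noteq> 0 \<longrightarrow> comb E P N R (s * t) (- t\<^sup>2) 0 (s\<^sup>2) \<in> C) \<and>
    (\<forall>x\<in>C. \<exists>y z m. x = comb E P N R y z 0 m)"
proof -
  obtain H q where Hq: "form 1 {z. algebraic z} H" "form 2 {z. algebraic z} q" "C = zero_locus {H, q}"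
    and trans: "\<And>x. x \<in> C \<Longrightarrow> transverse_at H q x"
    using C unfolding smooth_conic_def by blast
  obtain L' where L': "number_field L'" "K \<subseteq> L'" "\<forall>m\<in>Poly_Mapping.keys H. Poly_Mapping.lookup H m \<in> L'"
    using number_field_coefficients[OF K, of H] Hq(1) by (auto simp: form_def)
  obtain L where L: "number_field L" "L' \<subseteq> L" "\<forall>m\<in>Poly_Mapping.keys q. Poly_Mapping.lookup q m \<in> L"
    using number_field_coefficients[OF L'(1), of q] Hq(2) by (auto simp: form_def)
  have KL: "K \<subseteq> L" using L' L by blast
  note sub = number_field_subring[OF L(1)]
  have "form 1 L H" "form 2 L q"
    using Hq(1,2) L L' by (auto simp: form_def)
  from form_1_vector[OF sub this(1)] form_2_matrix[OF sub this(2)]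
  obtain v B where v: "\<And>i. v $ i \<in> L" "\<And>x. eval_mpoly H x = (\<Sum>i\<in>UNIV. v $ i * x $ i)" "\<And>x. grad H x = v"
    and B: "\<And>i j. B $ i $ j \<in> L" "\<And>x. eval_mpoly q x = quad B x"
      "\<And>x y. (\<Sum>k\<in>UNIV. grad q x $ k * y $ k) = polar B x y"
    by blast
  define l where "l x = (\<Sum>i\<in>UNIV. v $ i * x $ i)" for x :: "complex ^ 4"
  have l_add: "l (x + y) = l x + l y" and l_scale: "l (c *s x) = c * l x" for x y c
    by (simp_all add: l_def algebra_simps sum.distrib sum_distrib_left)
  have l_diff: "l (x - y) = l x - l y" for x y
    using l_add[of "x - y" y] by simp
  have l_axis: "l (axis i 1) = v $ i" for i
  proof -
    have "l (axis i 1) = (\<Sum>k\<in>UNIV. if k = i then v $ k else 0)"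
      unfolding l_def by (intro sum.cong) (auto simp: axis_def)
    then show ?thesis by simp
  qed
  note l_linear = l_add l_diff l_scale l_axis
  have C_iff: "x \<in> C \<longleftrightarrow> x \<noteq> 0 \<and> l x = 0 \<and> quad B x = 0" for x
    by (simp add: Hq(3) zero_locus_def proj_space_def v(2) B(2) l_def)
  have smooth: "s = 0 \<and> t = 0" if "x \<in> C" "s *s v + t *s grad q x = 0" for x s t
    using trans[OF that(1)] that(2) unfolding transverse_at_def v(3) by blast
  obtain j where j: "v $ j \<noteq> 0"
  proof -
    obtain x where "x \<in> C" using ne by blast
    then have "v \<noteq> 0"
      using smooth[of x 1 0] by auto
    then show ?thesis
      using that by (auto simp: vec_eq_iff)
  qed
  \<comment> \<open>Vectors over \<open>L\<close> that span the plane of the conic, the kernel of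
    \<open>l\<close>.\<close>
  define b where "b i = v $ j *s axis i 1 - v $ i *s axis j 1" for i
  have b_L: "vec_over L (b i)" for i
    unfolding b_def using v(1) by (intro vec_over_diff vec_over_scale vec_over_axis sub)
  have l_b: "l (b i) = 0" for i
    by (simp add: b_def l_linear)
  \<comment> \<open>Smoothness inside the plane: if \<open>polar B x\<close> vanished on all
    \<open>b i\<close>, the gradient of \<open>q\<close> at \<open>x\<close> would be a multiple of
    \<open>v\<close>.\<close>
  have polar_b: "\<exists>i. polar B x (b i) \<noteq> 0" if "x \<in> C" for x
  proof (rule ccontr)
    assume "\<nexists>i. polar B x (b i) \<noteq> 0"
    then have zero: "polar B x (b i) = 0" for i by blast
    have "polar B x (axis i 1) = grad q x $ i" for i
    proof -
      have "polar B x (axis i 1) = (\<Sum>k\<in>UNIV. if k = i then grad q x $ k else 0)"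
        unfolding B(3)[symmetric] by (intro sum.cong) (auto simp: axis_def)
      then show ?thesis by simp
    qed
    then have "v $ j * grad q x $ i - v $ i * grad q x $ j = 0" for i
      using zero[of i] by (simp add: b_def polar_linear)
    then have "(- grad q x $ j) *s v + v $ j *s grad q x = 0"
      by (simp add: vec_eq_iff algebra_simps)
    then show False
      using smooth[OF \<open>x \<in> C\<close>] j by blast
  qed
  have "\<exists>L1 P. number_field L1 \<and> L \<subseteq> L1 \<and> vec_over L1 P \<and> P \<in> C"
  proof -
    obtain i1 i2 where i: "i1 \<noteq> j" "i2 \<noteq> j" "i1 \<noteq> i2"
    proof -
      have "(1::4) \<noteq> 2 \<and> (1::4) \<noteq> 3 \<and> (2::4) \<noteq> 3" by simp
      then show ?thesis using that by metis
    qed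
    have b_comp: "b k $ k = v $ j" if "k \<noteq> j" for k
      using that by (simp add: b_def axis_def)
    have b_comp': "b i2 $ i1 = 0"
      using i by (simp add: b_def axis_def)
    show ?thesis
    proof (cases "quad B (b i2) = 0")
      case True
      have "b i2 \<noteq> 0"
        using b_comp[OF i(2)] j by auto
      then have "b i2 \<in> C"
        using True l_b by (simp add: C_iff)
      then show ?thesis
        using L(1) b_L by blast
    next
      case False
      \<comment> \<open>On the line through \<open>b i1\<close> and \<open>b i2\<close> the conic is
        cut out by \<open>Q2 t^2 + p t + Q1 = 0\<close>; a root exists after adjoining the square
        root of the discriminant.\<close>
      define Q1 Q2 p where "Q1 = quad B (b i1)" and "Q2 = quad B (b i2)" and "p = polar B (b i1) (b i2)"
      have QL: "Q1 \<in> L" "Q2 \<in> L" "p \<in> L"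
        unfolding Q1_def Q2_def p_def using B(1) b_L by (auto intro: quad_over polar_over sub)
      define s where "s = csqrt (p\<^sup>2 - 4 * Q1 * Q2)"
      have s2: "s\<^sup>2 = p\<^sup>2 - 4 * Q1 * Q2"
        by (simp add: s_def)
      have "s\<^sup>2 \<in> L"
        unfolding s2 using QL by (intro subring_intros sub)
      then obtain L1 where L1: "number_field L1" "L \<subseteq> L1" "s \<in> L1"
        using number_field_adjoin_sqrt[OF L(1)] by blast
      define t where "t = (s - p) / (2 * Q2)"
      have t: "t \<in> L1"
        unfolding t_def using L1 QL by (intro number_field_intros[OF L1(1)]) auto
      have "Q2 * t\<^sup>2 + p * t + Q1 = 0"
      proof -
        have Q2: "Q2 \<noteq> 0" using False by (simp add: Q2_def)
        have "4 * Q2 * (Q2 * t\<^sup>2 + p * t + Q1) = (2 * Q2 * t)\<^sup>2 + 2 * p * (2 * Q2 * t) + 4 * Q1 * Q2"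
          by (simp add: power2_eq_square algebra_simps)
        also have "2 * Q2 * t = s - p"
          using Q2 by (simp add: t_def)
        also have "(s - p)\<^sup>2 + 2 * p * (s - p) + 4 * Q1 * Q2 = s\<^sup>2 - p\<^sup>2 + 4 * Q1 * Q2"
          by (simp add: power2_eq_square algebra_simps)
        also have "\<dots> = 0"
          by (simp add: s2)
        finally show ?thesis using Q2 by simp
      qed
      then have "quad B (b i1 + t *s b i2) = 0"
        by (simp add: quad_add quad_scale polar_linear Q1_def Q2_def p_def algebra_simps)
      moreover have "(b i1 + t *s b i2) $ i1 \<noteq> 0"
        using b_comp[OF i(1)] b_comp' j by simp
      then have "b i1 + t *s b i2 \<noteq> 0"
        by (metis zero_index)
      ultimately have "b i1 + t *s b i2 \<in> C"
        by (simp add: C_iff l_linear l_b)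
      moreover have "vec_over L1 (b i1 + t *s b i2)"
        using L1 t b_L by (intro vec_over_add vec_over_scale number_field_subring[OF L1(1)])
          (auto intro: vec_over_mono)
      ultimately show ?thesis
        using L1 by blast
    qed
  qed
  then obtain L1 P where L1: "number_field L1" "L \<subseteq> L1" and P: "vec_over L1 P" "P \<in> C"
    by blast
  note sub1 = number_field_subring[OF L1(1)]
  have B1: "B $ i $ j \<in> L1" for i j
    using B(1) L1(2) by blast
  have b1: "vec_over L1 (b i)" for i
    using b_L L1(2) by (rule vec_over_mono)
  have P0: "l P = 0" "quad B P = 0" "polar B P P = 0" "P \<noteq> 0"
    using P(2) by (auto simp: C_iff polar_self)
  obtain i0 where i0: "polar B P (b i0) \<noteq> 0"
    using polar_b[OF P(2)] by blast
  \<comment> \<open>\<open>b i0\<close> is scaled to pair to 1 with \<open>P\<close>, then corrected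
    by a multiple of \<open>P\<close> to become isotropic: \<open>P\<close> and \<open>R\<close>
    form a hyperbolic pair.\<close>
  define k where "k = polar B P (b i0)"
  define R1 where "R1 = inverse k *s b i0"
  define R where "R = R1 - quad B R1 *s P"
  have kL: "k \<in> L1"
    unfolding k_def by (intro polar_over sub1 B1 P b1)
  have R1: "vec_over L1 R1" "l R1 = 0" "polar B P R1 = 1"
    using i0 kL by (auto simp: R1_def l_linear l_b polar_linear k_def
        intro!: vec_over_scale sub1 b1 number_field_inverse[OF L1(1)])
  have R: "vec_over L1 R" "l R = 0" "polar B P R = 1"
    using R1 P0 by (auto simp: R_def l_linear polar_linear
        intro!: vec_over_diff vec_over_scale sub1 quad_over B1 P)
  have "quad B (R1 + (- quad B R1) *s P) = 0"
    unfolding quad_add quad_scale polar_linear polar_commute[of B R1 P] R1(3) P0 by simp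
  moreover have "R = R1 + (- quad B R1) *s P"
    by (simp add: R_def vec_eq_iff)
  ultimately have R0: "quad B R = 0" "polar B R R = 0"
    by (simp_all add: polar_self)
  have PR: "polar B R P = 1"
    using R(3) by (simp add: polar_commute)
  \<comment> \<open>The component of \<open>b i\<close> orthogonal to the hyperbolic pair.\<close>
  define e where "e i = b i - polar B (b i) R *s P - polar B (b i) P *s R" for i
  have "\<exists>i. e i \<noteq> 0"
  proof (rule ccontr)
    assume "\<nexists>i. e i \<noteq> 0"
    then have e0: "e i = 0" for i by blast
    \<comment> \<open>If all these components vanished, the plane would be spanned by
      \<open>P\<close> and \<open>R\<close>, and one further vector would complete them to a
      spanning set of 4-space.\<close>
    let ?T = "{P, R, axis j 1}"
    have "axis i 1 \<in> vec.span ?T" for i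
    proof -
      have "v $ j *s axis i 1 = polar B (b i) R *s P + polar B (b i) P *s R + v $ i *s axis j 1"
        using e0[of i] by (simp add: e_def b_def algebra_simps)
      then have "axis i 1 = inverse (v $ j) *s (polar B (b i) R *s P + polar B (b i) P *s R + v $ i *s axis j 1)"
        using j by (metis vector_smult_assoc left_inverse vector_smult_lid)
      also have "\<dots> \<in> vec.span ?T"
        by (intro vec.span_scale vec.span_add vec.span_base) auto
      finally show ?thesis .
    qed
    then have "(cart_basis :: (complex ^ 4) set) \<subseteq> vec.span ?T"
      by (auto simp: cart_basis_def)
    then have "card (cart_basis :: (complex ^ 4) set) \<le> card ?T"
      using vec.independent_span_bound[OF _ independent_cart_basis, of ?T] by simp
    also have "\<dots> \<le> 3"
      using card_length[of "[P, R, axis j 1]"] by simp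
    finally show False
      by (simp add: card_cart_basis)
  qed
  then obtain i' where i': "e i' \<noteq> 0" by blast
  define E1 where "E1 = e i'"
  have E1: "vec_over L1 E1" "l E1 = 0" "polar B E1 P = 0" "polar B E1 R = 0" "E1 \<noteq> 0"
    using i' P0 R R0 PR
    by (auto simp: E1_def e_def l_linear l_b polar_linear
        intro!: vec_over_diff vec_over_scale sub1 polar_over B1 P b1)
  define N where "N = (axis j 1 :: complex ^ 4)"
  have lN: "l N \<noteq> 0"
    using j by (simp add: N_def l_linear)
  \<comment> \<open>Stated for a variable \<open>E\<close>, since it serves both \<open>E1\<close>
    and its rescaling.\<close>
  have inj: "y = 0 \<and> z = 0 \<and> h = 0 \<and> m = 0" if "comb E P N R y z h m = 0"
    and E: "l E = 0" "polar B P E = 0" "polar B R E = 0" "E \<noteq> 0" for E y z h m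
  proof -
    have "l (comb E P N R y z h m) = h * l N"
      by (simp add: comb_def l_linear E P0 R)
    then have h: "h = 0"
      using that(1) lN by (simp add: l_def)
    have "polar B P (comb E P N R y z h m) = m" "polar B R (comb E P N R y z h m) = z"
      using h by (simp_all add: polar_comb_right E P0 R R0 PR)
    then have mz: "m = 0" "z = 0"
      using that(1) by (simp_all add: polar_def)
    then have "y *s E = 0"
      using that(1) h by (simp add: comb_def)
    then have "y = 0"
      using E(4) by simp
    with h mz show ?thesis by simp
  qed
  have spans1: "\<exists>y z h m. x = comb E1 P N R y z h m" for x
    using inj[of E1] E1 by (intro comb_spans) (auto simp: polar_commute)
  \<comment> \<open>Otherwise \<open>E1\<close> would be a singular point of the conic, being
    orthogonal to the whole plane.\<close>
  have q_E1: "quad B E1 \<noteq> 0"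
  proof
    assume "quad B E1 = 0"
    then have "E1 \<in> C"
      using E1 by (simp add: C_iff)
    then obtain i where i: "polar B E1 (b i) \<noteq> 0"
      using polar_b by blast
    obtain y z h m where b: "b i = comb E1 P N R y z h m"
      using spans1 by blast
    have "l (b i) = h * l N"
      by (simp add: b comb_def l_linear E1 P0 R)
    then have "h = 0"
      using l_b lN by simp
    then have "polar B E1 (b i) = 0"
      using \<open>quad B E1 = 0\<close> by (simp add: b polar_comb_right E1 polar_self)
    with i show False by simp
  qed
  \<comment> \<open>Dividing by \<open>s\<close> gives \<open>quad B E = 1\<close>, so that the
    conic becomes \<open>y^2 + z m = 0\<close> and has the stated parametrisation.\<close>
  define s where "s = csqrt (quad B E1)"
  have s: "s\<^sup>2 = quad B E1" "s \<noteq> 0"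
    using q_E1 by (simp_all add: s_def)
  have "s\<^sup>2 \<in> L1"
    unfolding s by (intro quad_over sub1 B1 E1)
  then obtain L2 where L2: "number_field L2" "L1 \<subseteq> L2" "s \<in> L2"
    using number_field_adjoin_sqrt[OF L1(1)] by blast
  define E where "E = inverse s *s E1"
  have E: "vec_over L2 E" "l E = 0" "polar B P E = 0" "polar B R E = 0" "E \<noteq> 0"
    using E1 L2 s(2) by (auto simp: E_def l_linear polar_linear polar_commute[of B P] polar_commute[of B R]
        intro!: vec_over_scale number_field_subring number_field_inverse vec_over_mono[OF E1(1)])
  have qE: "quad B E = 1"
    using s q_E1 by (simp add: E_def quad_scale power_inverse)
  have spans: "\<exists>y z h m. x = comb E P N R y z h m" for x
    using inj[of E] E by (intro comb_spans) auto
  have "comb E P N R (s * t) (- t\<^sup>2) 0 (s\<^sup>2) \<in> C" if "s \<noteq> 0 \<or> t \<noteq> 0" for s t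
    unfolding C_iff
  proof (intro conjI)
    show "comb E P N R (s * t) (- t\<^sup>2) 0 (s\<^sup>2) \<noteq> 0"
      using inj[of E "s * t" "- t\<^sup>2" 0 "s\<^sup>2"] E that by auto
    show "l (comb E P N R (s * t) (- t\<^sup>2) 0 (s\<^sup>2)) = 0"
      by (simp add: comb_def l_linear E P0 R)
    show "quad B (comb E P N R (s * t) (- t\<^sup>2) 0 (s\<^sup>2)) = 0"
      using E by (simp add: quad_comb qE P0 R R0 polar_commute[of B E] power_mult_distrib)
  qed
  moreover have "\<exists>y z m. x = comb E P N R y z 0 m" if "x \<in> C" for x
  proof -
    obtain y z h m where x: "x = comb E P N R y z h m"
      using spans by blast
    have "l x = h * l N"
      by (simp add: x comb_def l_linear E P0 R)
    then have "h = 0"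
      using that lN by (simp add: C_iff)
    then show ?thesis
      using x by blast
  qed
  moreover have "vec_over L2 P" "vec_over L2 R" "vec_over L2 N"
    using P(1) R(1) vec_over_axis[OF number_field_subring[OF L2(1)]] L2(2)
    by (auto simp: N_def intro: vec_over_mono)
  moreover have "K \<subseteq> L2"
    using KL L1 L2 by blast
  ultimately show ?thesis
    using L2(1) E(1) spans by blast
qed

section \<open>Normal form of the two quadrics\<close>

text \<open>The surfaces \<open>Q1 = 0\<close> and \<open>Q2 = 0\<close> in coordinates in which their common conic is
  \<open>y\<^sup>2 + z m = 0\<close> in the plane \<open>h = 0\<close>; a combination of the equations is \<open>h\<close> times a
  linear form.\<close>

definition pencil_form :: "complex ^ 'n ^ 'n \<Rightarrow> complex ^ 'n ^ 'n \<Rightarrow> complex ^ 'n \<Rightarrow> complex ^ 'n \<Rightarrow> complex ^ 'n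
    \<Rightarrow> complex ^ 'n \<Rightarrow> complex \<Rightarrow> complex \<Rightarrow> complex \<Rightarrow> complex \<Rightarrow> complex \<Rightarrow> complex \<Rightarrow> complex \<Rightarrow> bool" where
  "pencil_form A1 A2 E P W R \<alpha> \<beta> f a b c d \<longleftrightarrow>
    (\<forall>x. \<exists>y z h m. x = comb E P W R y z h m) \<and>
    (\<forall>y z h m. quad A1 (comb E P W R y z h m) = \<alpha> * (y\<^sup>2 + z * m - f\<^sup>2 * h\<^sup>2) \<and>
      quad A2 (comb E P W R y z h m)
        = \<alpha> * (\<beta> * (y\<^sup>2 + z * m - f\<^sup>2 * h\<^sup>2) + h * (a * h + b * m + c * y + d * z)))"

text \<open>The symmetry of \<open>y^2 + z m\<close> that exchanges \<open>z\<close> and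
  \<open>m\<close>; it handles linear forms whose only term besides \<open>a h\<close> is
  \<open>d z\<close>.\<close>

lemma pencil_form_swap:
  assumes "pencil_form A1 A2 E P W R \<alpha> \<beta> f a b c d"
  shows "pencil_form A1 A2 E R W P \<alpha> \<beta> f a d c b"
proof -
  have "comb E R W P y z h m = comb E P W R y m h z" for y z h m
    by (simp add: comb_def algebra_simps)
  moreover have "\<exists>y z h m. x = comb E P W R y m h z" for x
    using assms unfolding pencil_form_def by metis
  ultimately show ?thesis
    using assms unfolding pencil_form_def by (simp add: mult.commute add.commute add.left_commute)
qed

text \<open>A unipotent automorphism of \<open>y^2 + z m\<close>. It moves \<open>P\<close> along
  the conic, and the new coefficient of \<open>z\<close> is the value of the linear form at the new
  point, so a suitable \<tau> makes it zero.\<close>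

lemma pencil_form_shear:
  assumes "pencil_form A1 A2 E P W R \<alpha> \<beta> f a b c d"
  shows "pencil_form A1 A2 (E - (2 * \<tau>) *s R) (P + \<tau> *s E - \<tau>\<^sup>2 *s R) W R \<alpha> \<beta> f a b
    (c - 2 * \<tau> * b) (d + \<tau> * c - \<tau>\<^sup>2 * b)"
proof -
  let ?E = "E - (2 * \<tau>) *s R" and ?P = "P + \<tau> *s E - \<tau>\<^sup>2 *s R"
  have comb: "comb ?E ?P W R y z h m = comb E P W R (y + \<tau> * z) z h (m - 2 * \<tau> * y - \<tau>\<^sup>2 * z)" for y z h m
    by (simp add: comb_def vec_eq_iff algebra_simps)
  have "\<exists>y z h m. x = comb ?E ?P W R y z h m" for x
  proof -
    obtain y z h m where "x = comb E P W R y z h m"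
      using assms unfolding pencil_form_def by blast
    then have "x = comb ?E ?P W R (y - \<tau> * z) z h (m + 2 * \<tau> * (y - \<tau> * z) + \<tau>\<^sup>2 * z)"
      by (simp add: comb)
    then show ?thesis by blast
  qed
  moreover have sq: "(y + \<tau> * z)\<^sup>2 + z * (m - 2 * \<tau> * y - \<tau>\<^sup>2 * z) = y\<^sup>2 + z * m" for y z m
    by (simp add: power2_eq_square algebra_simps)
  have lin: "a * h + b * (m - 2 * \<tau> * y - \<tau>\<^sup>2 * z) + c * (y + \<tau> * z) + d * z
      = a * h + b * m + (c - 2 * \<tau> * b) * y + (d + \<tau> * c - \<tau>\<^sup>2 * b) * z" for y z h m
    by (simp add: algebra_simps)
  ultimately show ?thesis
    using assms unfolding pencil_form_def comb by (simp only: sq lin) blast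
qed

text \<open>Along the parametrisation \<open>quad A\<close> is a quartic form in \<open>s, t\<close>
  whose coefficients must all vanish; five parameter values suffice to read them off. On the plane
  \<open>quad A\<close> is then \<open>quad A E\<close> times \<open>y^2 + z m\<close>.\<close>

lemma quad_vanishing_on_conic:
  assumes van: "\<forall>s t. s \<noteq> 0 \<or> t \<noteq> 0 \<longrightarrow> quad A (comb E P N R (s * t) (- t\<^sup>2) 0 (s\<^sup>2)) = 0"
  shows "quad A P = 0" "quad A R = 0" "polar A E P = 0" "polar A E R = 0" "polar A P R = quad A E"
proof -
  have *: "(s * t)\<^sup>2 * quad A E + (t\<^sup>2)\<^sup>2 * quad A P + (s\<^sup>2)\<^sup>2 * quad A R - s * t * t\<^sup>2 * polar A E P
      + s * t * s\<^sup>2 * polar A E R - t\<^sup>2 * s\<^sup>2 * polar A P R = 0" if "s \<noteq> 0 \<or> t \<noteq> 0" for s t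
    using van[rule_format, OF that] by (simp add: quad_comb algebra_simps)
  show PR0: "quad A P = 0" "quad A R = 0"
    using *[of 0 1] *[of 1 0] by simp_all
  have 1: "quad A E - polar A E P + polar A E R - polar A P R = 0"
    using *[of 1 1] PR0 by simp
  have 2: "quad A E + polar A E P - polar A E R - polar A P R = 0"
    using *[of 1 "- 1"] PR0 by simp
  have 3: "4 * quad A E - 2 * polar A E P + 8 * polar A E R - 4 * polar A P R = 0"
    using *[of 2 1] PR0 by simp
  have "2 * (polar A P R - quad A E) = 0"
    using 1 2 by algebra
  then show PR: "polar A P R = quad A E"
    by simp
  have "6 * polar A E R = 0"
    using 1 2 3 by algebra
  then show ER: "polar A E R = 0"
    by simp
  show "polar A E P = 0"
    using 1 ER PR by simp
qed

text \<open>The first quadric is nondegenerate on the plane, so \<open>N\<close> can be corrected to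
  a vector \<open>W\<close> orthogonal to it, which removes the mixed terms with \<open>h\<close>.
  The second form minus \<beta> times the first vanishes on the plane, hence is \<open>h\<close>
  times a linear form; a swap or a shear removes \<open>z\<close> from the latter.\<close>

lemma pencil_form_exists_if_nonzero_on_plane:
  fixes A1 A2 :: "complex ^ 4 ^ 4"
  assumes L: "number_field L" and A: "\<And>i j. A1 $ i $ j \<in> L" "\<And>i j. A2 $ i $ j \<in> L"
    and over: "vec_over L E" "vec_over L P" "vec_over L N" "vec_over L R"
    and spans: "\<And>x. \<exists>y z h m. x = comb E P N R y z h m"
    and van1: "\<forall>s t. s \<noteq> 0 \<or> t \<noteq> 0 \<longrightarrow> quad A1 (comb E P N R (s * t) (- t\<^sup>2) 0 (s\<^sup>2)) = 0"
    and van2: "\<forall>s t. s \<noteq> 0 \<or> t \<noteq> 0 \<longrightarrow> quad A2 (comb E P N R (s * t) (- t\<^sup>2) 0 (s\<^sup>2)) = 0"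
    and x0: "x0 = comb E P N R y0 z0 0 m0"
    and trans: "\<forall>s t. (\<forall>v. s * polar A1 x0 v + t * polar A2 x0 v = 0) \<longrightarrow> s = 0 \<and> t = 0"
    and \<alpha>0: "quad A1 E \<noteq> 0"
  shows "\<exists>L' E P W R \<alpha> \<beta> f a b c. number_field L' \<and> L \<subseteq> L' \<and>
    vec_over L' E \<and> vec_over L' P \<and> vec_over L' W \<and> vec_over L' R \<and>
    {\<alpha>, \<beta>, f, a, b, c} \<subseteq> L' \<and> \<alpha> \<noteq> 0 \<and> (b \<noteq> 0 \<or> c \<noteq> 0) \<and>
    pencil_form A1 A2 E P W R \<alpha> \<beta> f a b c 0"
proof -
  note sub = number_field_subring[OF L]
  define \<alpha> where "\<alpha> = quad A1 E"
  have c1: "quad A1 P = 0" "quad A1 R = 0" "polar A1 E P = 0" "polar A1 E R = 0" "polar A1 P R = \<alpha>"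
    unfolding \<alpha>_def by (rule quad_vanishing_on_conic[OF van1])+
  have c2: "quad A2 P = 0" "quad A2 R = 0" "polar A2 E P = 0" "polar A2 E R = 0" "polar A2 P R = quad A2 E"
    by (rule quad_vanishing_on_conic[OF van2])+
  have \<alpha>: "\<alpha> \<noteq> 0" "\<alpha> \<in> L"
    using \<alpha>0 by (auto simp: \<alpha>_def intro!: quad_over sub A over)
  \<comment> \<open>Projection of \<open>N\<close> to the plane. The 2 comes from
    \<open>polar A1 E E\<close>; \<open>P\<close> and \<open>R\<close> pair only with each other, so
    the coefficient of \<open>P\<close> is read off from \<open>R\<close> and conversely.\<close>
  define k1 k2 k3 where "k1 = polar A1 N E / (2 * \<alpha>)" and "k2 = polar A1 N R / \<alpha>" and "k3 = polar A1 N P / \<alpha>"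
  have kL: "k1 \<in> L" "k2 \<in> L" "k3 \<in> L"
    unfolding k1_def k2_def k3_def
    using \<alpha> by (auto intro!: number_field_intros[OF L] polar_over[OF sub] A over)
  define W where "W = N - k1 *s E - k2 *s P - k3 *s R"
  have W: "vec_over L W"
    unfolding W_def using kL by (intro vec_over_diff vec_over_scale sub over)
  have sym: "polar A1 P E = 0" "polar A1 R E = 0" "polar A1 R P = \<alpha>" "polar A1 E E = 2 * \<alpha>"
    "polar A1 P P = 0" "polar A1 R R = 0"
    using c1 by (simp_all add: polar_commute[of A1 P E] polar_commute[of A1 R E] polar_commute[of A1 R P]
        polar_self \<alpha>_def)
  have WE: "polar A1 W E = 0" "polar A1 W P = 0" "polar A1 W R = 0"
    using \<alpha> c1 sym by (simp_all add: W_def polar_linear k1_def k2_def k3_def)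
  have EW: "polar A1 E W = 0" "polar A1 P W = 0"
    using WE by (simp_all add: polar_commute[of A1 _ W])
  \<comment> \<open>Normalises \<open>quad A1 W\<close> to \<open>- \<alpha> * f\<^sup>2\<close>.
    The square lies in \<open>L\<close>, and \<open>f\<close> itself is adjoined at the end.\<close>
  define f where "f = csqrt (- quad A1 W / \<alpha>)"
  have f2: "f\<^sup>2 = - quad A1 W / \<alpha>"
    by (simp add: f_def)
  define \<beta> a b c d where "\<beta> = quad A2 E / \<alpha>" and "a = quad A2 W / \<alpha> + \<beta> * f\<^sup>2"
    and "b = polar A2 W R / \<alpha>" and "c = polar A2 W E / \<alpha>" and "d = polar A2 W P / \<alpha>"
  have const: "\<beta> \<in> L" "a \<in> L" "b \<in> L" "c \<in> L" "d \<in> L" "f\<^sup>2 \<in> L"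
    unfolding \<beta>_def a_def b_def c_def d_def f2
    by (auto intro!: number_field_intros[OF L] polar_over[OF sub] quad_over[OF sub] A over W \<alpha>)
  have combN: "comb E P W R y z h m = comb E P N R (y - h * k1) (z - h * k2) h (m - h * k3)" for y z h m
    by (simp add: comb_def W_def vec_eq_iff algebra_simps)
  have spansW: "\<exists>y z h m. x = comb E P W R y z h m" for x
  proof -
    obtain y z h m where "x = comb E P N R y z h m"
      using spans by blast
    then have "x = comb E P W R (y + h * k1) (z + h * k2) h (m + h * k3)"
      by (simp add: combN)
    then show ?thesis by blast
  qed
  have q1: "quad A1 (comb E P W R y z h m) = \<alpha> * (y\<^sup>2 + z * m - f\<^sup>2 * h\<^sup>2)" for y z h m
    using \<alpha> by (simp add: quad_comb c1 EW WE f2 \<alpha>_def[symmetric] field_simps)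
  have q2: "quad A2 (comb E P W R y z h m)
      = \<alpha> * (\<beta> * (y\<^sup>2 + z * m - f\<^sup>2 * h\<^sup>2) + h * (a * h + b * m + c * y + d * z))" for y z h m
  proof -
    have "quad A2 E = \<alpha> * \<beta>" "quad A2 W = \<alpha> * (a - \<beta> * f\<^sup>2)" "polar A2 W R = \<alpha> * b"
      "polar A2 E W = \<alpha> * c" "polar A2 P W = \<alpha> * d"
      using \<alpha> by (simp_all add: \<beta>_def a_def b_def c_def d_def polar_commute[of A2 _ W])
    then show ?thesis
      by (simp only: quad_comb c2) (simp add: power2_eq_square algebra_simps)
  qed
  have pf: "pencil_form A1 A2 E P W R \<alpha> \<beta> f a b c d"
    unfolding pencil_form_def using spansW q1 q2 by blast
  \<comment> \<open>Otherwise the second form minus \<beta> times the first would be a multiple of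
    \<open>h^2\<close>, whose derivative vanishes at \<open>x0\<close> because \<open>x0\<close>
    lies in the plane \<open>h = 0\<close>; this contradicts transversality.\<close>
  have nz: "b \<noteq> 0 \<or> c \<noteq> 0 \<or> d \<noteq> 0"
  proof (rule ccontr)
    assume "\<not> ?thesis"
    then have W2: "polar A2 W E = 0" "polar A2 W P = 0" "polar A2 W R = 0"
      using \<alpha> by (simp_all add: b_def c_def d_def)
    have "\<beta> * polar A1 x0 v + (- 1) * polar A2 x0 v = 0" for v
    proof -
      obtain y z h m where v: "v = comb E P W R y z h m"
        using spansW by blast
      have x0': "x0 = comb E P W R y0 z0 0 m0"
        by (simp add: x0 combN)
      have p: "polar A (comb E P W R y0 z0 0 m0) (comb E P W R y z h m)
          = quad A (comb E P W R (y0 + y) (z0 + z) h (m0 + m)) - quad A (comb E P W R y0 z0 0 m0)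
            - quad A (comb E P W R y z h m)" for A
        using quad_add[of A "comb E P W R y0 z0 0 m0" "comb E P W R y z h m"]
        by (simp add: comb_def algebra_simps)
      have "b = 0" "c = 0" "d = 0"
        using \<open>\<not> (b \<noteq> 0 \<or> c \<noteq> 0 \<or> d \<noteq> 0)\<close> by auto
      then show ?thesis
        unfolding x0' v p q1 q2 by (simp add: power2_eq_square algebra_simps)
    qed
    with trans show False by (metis zero_neq_neg_one)
  qed
  have "\<exists>E P W R L2 b c. number_field L2 \<and> L \<subseteq> L2 \<and>
    vec_over L2 E \<and> vec_over L2 P \<and> vec_over L2 W \<and> vec_over L2 R \<and> b \<in> L2 \<and> c \<in> L2 \<and> (b \<noteq> 0 \<or> c \<noteq> 0) \<and>
    pencil_form A1 A2 E P W R \<alpha> \<beta> f a b c 0"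
  proof (cases "b = 0 \<and> c = 0")
    case True
    then have "pencil_form A1 A2 E R W P \<alpha> \<beta> f a d c 0" "d \<noteq> 0"
      using pencil_form_swap[OF pf] nz by auto
    then show ?thesis
      using L over W const by blast
  next
    case False
    \<comment> \<open>The equation says that the linear form vanishes at the sheared
      \<open>P\<close>. A shear fixes \<open>b\<close>, and fixes \<open>c\<close> if
      \<open>b = 0\<close>, so the two do not become zero together.\<close>
    have "\<exists>L2 \<tau>. number_field L2 \<and> L \<subseteq> L2 \<and> \<tau> \<in> L2 \<and> d + \<tau> * c - \<tau>\<^sup>2 * b = 0 \<and> (b \<noteq> 0 \<or> c - 2 * \<tau> * b \<noteq> 0)"
    proof (cases "b = 0")
      case True
      then have "d + (- d / c) * c - (- d / c)\<^sup>2 * b = 0" "c \<noteq> 0" "- d / c \<in> L"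
        using False const by (auto intro: number_field_intros[OF L])
      then show ?thesis
        using L True by (intro exI[of _ L] exI[of _ "- d / c"]) simp
    next
      case b: False
      define s where "s = csqrt (c\<^sup>2 + 4 * b * d)"
      have s2: "s\<^sup>2 = c\<^sup>2 + 4 * b * d"
        by (simp add: s_def)
      have "s\<^sup>2 \<in> L"
        unfolding s2 using const by (intro number_field_intros[OF L])
      then obtain L2 where L2: "number_field L2" "L \<subseteq> L2" "s \<in> L2"
        using number_field_adjoin_sqrt[OF L] by blast
      define \<tau> where "\<tau> = (c + s) / (2 * b)"
      have "\<tau> \<in> L2"
        unfolding \<tau>_def using L2 const by (intro number_field_intros[OF L2(1)]) auto
      moreover have "d + \<tau> * c - \<tau>\<^sup>2 * b = 0"
      proof -
        have "4 * b * (d + \<tau> * c - \<tau>\<^sup>2 * b) = 4 * b * d + 2 * c * (2 * b * \<tau>) - (2 * b * \<tau>)\<^sup>2"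
          by (simp add: power2_eq_square algebra_simps)
        also have "2 * b * \<tau> = c + s"
          using b by (simp add: \<tau>_def)
        also have "4 * b * d + 2 * c * (c + s) - (c + s)\<^sup>2 = c\<^sup>2 + 4 * b * d - s\<^sup>2"
          by (simp add: power2_eq_square algebra_simps)
        also have "\<dots> = 0"
          by (simp add: s2)
        finally show ?thesis using b by simp
      qed
      ultimately show ?thesis
        using L2 b by blast
    qed
    then obtain L2 \<tau> where L2: "number_field L2" "L \<subseteq> L2" "\<tau> \<in> L2"
      and \<tau>: "d + \<tau> * c - \<tau>\<^sup>2 * b = 0" "b \<noteq> 0 \<or> c - 2 * \<tau> * b \<noteq> 0"
      by blast
    have over2: "vec_over L2 E" "vec_over L2 P" "vec_over L2 W" "vec_over L2 R"
      using over W L2(2) by (auto intro: vec_over_mono)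
    have const2: "b \<in> L2" "c \<in> L2"
      using const L2(2) by auto
    have "pencil_form A1 A2 (E - (2 * \<tau>) *s R) (P + \<tau> *s E - \<tau>\<^sup>2 *s R) W R \<alpha> \<beta> f a b (c - 2 * \<tau> * b) 0"
      using pencil_form_shear[OF pf, of \<tau>] \<tau>(1) by simp
    moreover have "vec_over L2 (E - (2 * \<tau>) *s R)" "vec_over L2 (P + \<tau> *s E - \<tau>\<^sup>2 *s R)"
      using over2 L2 by (auto intro!: vec_over_add vec_over_diff vec_over_scale number_field_intros[OF L2(1)]
          number_field_subring)
    moreover have "c - 2 * \<tau> * b \<in> L2"
      using const2 L2 by (intro number_field_intros[OF L2(1)])
    ultimately show ?thesis
      using L2(1,2) const2 over2 \<tau>(2) by blast
  qed
  then obtain E P W R L2 b c where L2: "number_field L2" "L \<subseteq> L2"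
    and over2: "vec_over L2 E" "vec_over L2 P" "vec_over L2 W" "vec_over L2 R"
    and bc: "b \<in> L2" "c \<in> L2" "b \<noteq> 0 \<or> c \<noteq> 0" and pf2: "pencil_form A1 A2 E P W R \<alpha> \<beta> f a b c 0"
    by blast
  have "f\<^sup>2 \<in> L2"
    using const L2(2) by blast
  then obtain L3 where L3: "number_field L3" "L2 \<subseteq> L3" "f \<in> L3"
    using number_field_adjoin_sqrt[OF L2(1)] by blast
  have over3: "vec_over L3 E" "vec_over L3 P" "vec_over L3 W" "vec_over L3 R"
    using over2 L3(2) by (auto intro: vec_over_mono)
  have const3: "{\<alpha>, \<beta>, f, a, b, c} \<subseteq> L3" "L \<subseteq> L3"
    using bc const \<alpha> L2 L3 by auto
  show ?thesis
    by (intro exI conjI) (fact L3(1) const3 over3 \<alpha>(1) bc(3) pf2)+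
qed

lemma transverse_polar:
  assumes tr: "transverse_at F G x"
    and F: "\<And>x y. (\<Sum>k\<in>UNIV. grad F x $ k * y $ k) = polar A x y"
    and G: "\<And>x y. (\<Sum>k\<in>UNIV. grad G x $ k * y $ k) = polar B x y"
  shows "\<forall>s t. (\<forall>v. s * polar A x v + t * polar B x v = 0) \<longrightarrow> s = 0 \<and> t = 0"
proof (intro allI impI)
  fix s t assume zero: "\<forall>v. s * polar A x v + t * polar B x v = 0"
  have "s * grad F x $ i + t * grad G x $ i = 0" for i
  proof -
    have ax: "(\<Sum>k\<in>UNIV. w $ k * axis i 1 $ k) = w $ i" for w :: "complex ^ 'a"
    proof -
      have "(\<Sum>k\<in>UNIV. w $ k * axis i 1 $ k) = (\<Sum>k\<in>UNIV. if k = i then w $ k else 0)"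
        by (intro sum.cong) (auto simp: axis_def)
      then show ?thesis by simp
    qed
    show ?thesis
      using zero[rule_format, of "axis i 1"] by (simp only: F[symmetric] G[symmetric] ax)
  qed
  then have "s *s grad F x + t *s grad G x = 0"
    by (simp add: vec_eq_iff)
  then show "s = 0 \<and> t = 0"
    using tr unfolding transverse_at_def by blast
qed

lemma transverse_at_commute: "transverse_at F G x \<Longrightarrow> transverse_at G F x"
  unfolding transverse_at_def by (subst add.commute) blast

text \<open>The normal form divides by the value of the first quadric at \<open>E\<close>, so the
  order of the quadrics is chosen to make this nonzero.\<close>

lemma pencil_form_exists:
  assumes K: "number_field K" and Q: "form 2 K Q1" "form 2 K Q2" and C: "smooth_conic C"
    and red: "reduced_component_of_intersection C Q1 Q2"
  shows "\<exists>F G L A1 A2 E P W R \<alpha> \<beta> f a b c. (F, G) \<in> {(Q1, Q2), (Q2, Q1)} \<and> number_field L \<and> K \<subseteq> L \<and>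
    eval_mpoly F = quad A1 \<and> eval_mpoly G = quad A2 \<and>
    vec_over L E \<and> vec_over L P \<and> vec_over L W \<and> vec_over L R \<and>
    {\<alpha>, \<beta>, f, a, b, c} \<subseteq> L \<and> \<alpha> \<noteq> 0 \<and> (b \<noteq> 0 \<or> c \<noteq> 0) \<and>
    pencil_form A1 A2 E P W R \<alpha> \<beta> f a b c 0"
proof -
  obtain x0 where x0: "x0 \<in> C" "transverse_at Q1 Q2 x0" and sub: "C \<subseteq> zero_locus {Q1} \<inter> zero_locus {Q2}"
    using red unfolding reduced_component_of_intersection_def by blast
  from x0(1) have "C \<noteq> {}" by blast
  from smooth_conic_frame[OF K C this] obtain L E P N R where L: "number_field L" "K \<subseteq> L"
    and over: "vec_over L E" "vec_over L P" "vec_over L N" "vec_over L R"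
    and frame: "\<forall>x. \<exists>y z h m. x = comb E P N R y z h m"
      "\<forall>s t. s \<noteq> 0 \<or> t \<noteq> 0 \<longrightarrow> comb E P N R (s * t) (- t\<^sup>2) 0 (s\<^sup>2) \<in> C"
      "\<forall>x\<in>C. \<exists>y z m. x = comb E P N R y z 0 m"
    by (elim exE conjE)
  note spans = frame(1)[rule_format] and param = frame(2)[rule_format] and plane = frame(3)[rule_format]
  obtain y0 z0 m0 where x0c: "x0 = comb E P N R y0 z0 0 m0"
    using plane x0(1) by blast
  note subK = number_field_subring[OF K]
  obtain A1 where A1: "\<And>i j. A1 $ i $ j \<in> K" "\<And>x. eval_mpoly Q1 x = quad A1 x"
    "\<And>x y. (\<Sum>k\<in>UNIV. grad Q1 x $ k * y $ k) = polar A1 x y"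
    using form_2_matrix[OF subK Q(1)] by blast
  obtain A2 where A2: "\<And>i j. A2 $ i $ j \<in> K" "\<And>x. eval_mpoly Q2 x = quad A2 x"
    "\<And>x y. (\<Sum>k\<in>UNIV. grad Q2 x $ k * y $ k) = polar A2 x y"
    using form_2_matrix[OF subK Q(2)] by blast
  have van: "quad A1 x = 0" "quad A2 x = 0" if "x \<in> C" for x
    using that sub A1(2) A2(2) by (auto simp: zero_locus_def)
  have van1: "\<forall>s t. s \<noteq> 0 \<or> t \<noteq> 0 \<longrightarrow> quad A1 (comb E P N R (s * t) (- t\<^sup>2) 0 (s\<^sup>2)) = 0"
    and van2: "\<forall>s t. s \<noteq> 0 \<or> t \<noteq> 0 \<longrightarrow> quad A2 (comb E P N R (s * t) (- t\<^sup>2) 0 (s\<^sup>2)) = 0"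
    by (blast intro: van param)+
  have AL: "A1 $ i $ j \<in> L" "A2 $ i $ j \<in> L" for i j
    using A1(1) A2(1) L(2) by auto
  note tr1 = transverse_polar[OF x0(2) A1(3) A2(3)]
  note tr2 = transverse_polar[OF transverse_at_commute[OF x0(2)] A2(3) A1(3)]
  have ev: "eval_mpoly Q1 = quad A1" "eval_mpoly Q2 = quad A2"
    using A1(2) A2(2) by auto
  \<comment> \<open>If both values were zero, both quadrics would contain the plane of the conic,
    and their derivatives at \<open>x0\<close> would both be multiples of the coordinate
    \<open>h\<close>, hence dependent.\<close>
  have "quad A1 E \<noteq> 0 \<or> quad A2 E \<noteq> 0"
  proof (rule ccontr)
    assume "\<not> ?thesis"
    then have z: "quad A1 E = 0" "quad A2 E = 0" by auto
    have p0: "polar A x0 v = h * polar A x0 N" if "v = comb E P N R y z h m" "quad A E = 0"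
      "quad A P = 0" "quad A R = 0" "polar A E P = 0" "polar A E R = 0" "polar A P R = quad A E" for A v y z h m
    proof -
      have "polar A x0 E = 0" "polar A x0 P = 0" "polar A x0 R = 0"
        using that(2-) unfolding x0c polar_commute[of A "comb E P N R y0 z0 0 m0"] polar_comb_right
        by (simp_all add: polar_self polar_commute[of A P E] polar_commute[of A R E] polar_commute[of A R P])
      then show ?thesis
        by (simp add: that(1) polar_comb_right)
    qed
    have p1: "polar A1 x0 v = h * polar A1 x0 N" if "v = comb E P N R y z h m" for v y z h m
      by (rule p0[OF that z(1) quad_vanishing_on_conic[OF van1]])
    have p2: "polar A2 x0 v = h * polar A2 x0 N" if "v = comb E P N R y z h m" for v y z h m
      by (rule p0[OF that z(2) quad_vanishing_on_conic[OF van2]])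
    have "polar A2 x0 N * polar A1 x0 v + (- polar A1 x0 N) * polar A2 x0 v = 0" for v
    proof -
      obtain y z h m where "v = comb E P N R y z h m"
        using spans by blast
      from p1[OF this] p2[OF this] show ?thesis by simp
    qed
    then have "polar A1 x0 N = 0"
      using tr1[rule_format, of "polar A2 x0 N" "- polar A1 x0 N"] by auto
    have "1 * polar A1 x0 v + 0 * polar A2 x0 v = 0" for v
    proof -
      obtain y z h m where "v = comb E P N R y z h m"
        using spans by blast
      from p1[OF this] \<open>polar A1 x0 N = 0\<close> show ?thesis by simp
    qed
    then show False
      using tr1[rule_format, of 1 0] by auto
  qed
  then show ?thesis
  proof
    assume nz: "quad A1 E \<noteq> 0"
    from pencil_form_exists_if_nonzero_on_plane[OF L(1) AL over spans van1 van2 x0c tr1 nz]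
    obtain L' E P W R \<alpha> \<beta> f a b c where *: "number_field L' \<and> L \<subseteq> L' \<and>
      vec_over L' E \<and> vec_over L' P \<and> vec_over L' W \<and> vec_over L' R \<and>
      {\<alpha>, \<beta>, f, a, b, c} \<subseteq> L' \<and> \<alpha> \<noteq> 0 \<and> (b \<noteq> 0 \<or> c \<noteq> 0) \<and> pencil_form A1 A2 E P W R \<alpha> \<beta> f a b c 0"
      by (elim exE)
    have "(Q1, Q2) \<in> {(Q1, Q2), (Q2, Q1)} \<and> number_field L' \<and> K \<subseteq> L' \<and>
      eval_mpoly Q1 = quad A1 \<and> eval_mpoly Q2 = quad A2 \<and>
      vec_over L' E \<and> vec_over L' P \<and> vec_over L' W \<and> vec_over L' R \<and>
      {\<alpha>, \<beta>, f, a, b, c} \<subseteq> L' \<and> \<alpha> \<noteq> 0 \<and> (b \<noteq> 0 \<or> c \<noteq> 0) \<and> pencil_form A1 A2 E P W R \<alpha> \<beta> f a b c 0"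
      using * ev L(2) by (simp add: order_trans[of K L])
    then show ?thesis
      by (intro exI)
  next
    assume nz: "quad A2 E \<noteq> 0"
    from pencil_form_exists_if_nonzero_on_plane[OF L(1) AL(2,1) over spans van2 van1 x0c tr2 nz]
    obtain L' E P W R \<alpha> \<beta> f a b c where *: "number_field L' \<and> L \<subseteq> L' \<and>
      vec_over L' E \<and> vec_over L' P \<and> vec_over L' W \<and> vec_over L' R \<and>
      {\<alpha>, \<beta>, f, a, b, c} \<subseteq> L' \<and> \<alpha> \<noteq> 0 \<and> (b \<noteq> 0 \<or> c \<noteq> 0) \<and> pencil_form A2 A1 E P W R \<alpha> \<beta> f a b c 0"
      by (elim exE)
    have "(Q2, Q1) \<in> {(Q1, Q2), (Q2, Q1)} \<and> number_field L' \<and> K \<subseteq> L' \<and>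
      eval_mpoly Q2 = quad A2 \<and> eval_mpoly Q1 = quad A1 \<and>
      vec_over L' E \<and> vec_over L' P \<and> vec_over L' W \<and> vec_over L' R \<and>
      {\<alpha>, \<beta>, f, a, b, c} \<subseteq> L' \<and> \<alpha> \<noteq> 0 \<and> (b \<noteq> 0 \<or> c \<noteq> 0) \<and> pencil_form A2 A1 E P W R \<alpha> \<beta> f a b c 0"
      using * ev L(2) by (simp add: order_trans[of K L])
    then show ?thesis
      by (intro exI)
  qed
qed

section \<open>Vanishing of forms on the families of points\<close>

text \<open>A predicate on functions: polynomiality of a composite expression follows from closure
  rules without computing its coefficients.\<close>

definition polynomial_fun :: "(complex \<Rightarrow> complex) \<Rightarrow> bool" where
  "polynomial_fun g \<longleftrightarrow> (\<exists>q. g = poly q)"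

lemma polynomial_fun_const: "polynomial_fun (\<lambda>_. c)"
  unfolding polynomial_fun_def by (rule exI[of _ "[:c:]"]) auto

lemma polynomial_fun_id: "polynomial_fun (\<lambda>t. t)"
  unfolding polynomial_fun_def by (rule exI[of _ "[:0, 1:]"]) auto

lemma polynomial_fun_add:
  assumes "polynomial_fun f" "polynomial_fun g" shows "polynomial_fun (\<lambda>t. f t + g t)"
proof -
  obtain p q where "f = poly p" "g = poly q"
    using assms by (auto simp: polynomial_fun_def)
  then show ?thesis
    unfolding polynomial_fun_def by (intro exI[of _ "p + q"]) auto
qed

lemma polynomial_fun_mult:
  assumes "polynomial_fun f" "polynomial_fun g" shows "polynomial_fun (\<lambda>t. f t * g t)"
proof -
  obtain p q where "f = poly p" "g = poly q"
    using assms by (auto simp: polynomial_fun_def)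
  then show ?thesis
    unfolding polynomial_fun_def by (intro exI[of _ "p * q"]) auto
qed

lemma polynomial_fun_minus: "polynomial_fun f \<Longrightarrow> polynomial_fun (\<lambda>t. - f t)"
  using polynomial_fun_mult[OF polynomial_fun_const[of "- 1"], of f] by simp

lemma polynomial_fun_diff:
  "polynomial_fun f \<Longrightarrow> polynomial_fun g \<Longrightarrow> polynomial_fun (\<lambda>t. f t - g t)"
  using polynomial_fun_add[of f "\<lambda>t. - g t"] polynomial_fun_minus[of g] by simp

lemma polynomial_fun_divide: "polynomial_fun f \<Longrightarrow> polynomial_fun (\<lambda>t. f t / c)"
  unfolding divide_inverse by (intro polynomial_fun_mult polynomial_fun_const)

lemma polynomial_fun_power: "polynomial_fun f \<Longrightarrow> polynomial_fun (\<lambda>t. f t ^ n)"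
  by (induction n) (simp_all add: polynomial_fun_const polynomial_fun_mult)

lemma polynomial_fun_sum: "(\<And>i. i \<in> A \<Longrightarrow> polynomial_fun (f i)) \<Longrightarrow> polynomial_fun (\<lambda>t. \<Sum>i\<in>A. f i t)"
  by (induction A rule: infinite_finite_induct) (simp_all add: polynomial_fun_const polynomial_fun_add)

lemma polynomial_fun_prod: "(\<And>i. i \<in> A \<Longrightarrow> polynomial_fun (f i)) \<Longrightarrow> polynomial_fun (\<lambda>t. \<Prod>i\<in>A. f i t)"
  by (induction A rule: infinite_finite_induct) (simp_all add: polynomial_fun_const polynomial_fun_mult)

lemmas polynomial_fun_intros = polynomial_fun_const polynomial_fun_id polynomial_fun_add
  polynomial_fun_mult polynomial_fun_minus polynomial_fun_diff polynomial_fun_divide polynomial_fun_power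

lemma polynomial_fun_eq_0:
  assumes "polynomial_fun g" "infinite S" "\<And>t. t \<in> S \<Longrightarrow> g t = 0"
  shows "g t = 0"
proof -
  obtain q where q: "g = poly q"
    using assms(1) by (auto simp: polynomial_fun_def)
  have "S \<subseteq> {t. poly q t = 0}"
    using assms(3) q by auto
  then have "q = 0"
    using assms(2) poly_roots_finite[of q] finite_subset by blast
  then show ?thesis
    by (simp add: q)
qed

lemma polynomial_fun_eq_0_nonzero:
  assumes "polynomial_fun g" "\<And>t. t \<noteq> 0 \<Longrightarrow> g t = 0"
  shows "g t = 0"
proof (rule polynomial_fun_eq_0[OF assms(1)])
  show "infinite (UNIV - {0 :: complex})"
    by (rule infinite_remove[OF infinite_UNIV_char_0])
qed (use assms(2) in simp)

lemma polynomial_fun_eval_mpoly: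
  assumes "\<And>i. polynomial_fun (\<lambda>t. X t $ i)"
  shows "polynomial_fun (\<lambda>t. eval_mpoly F (X t))"
  unfolding eval_mpoly_def using assms
  by (intro polynomial_fun_sum polynomial_fun_mult polynomial_fun_prod polynomial_fun_power polynomial_fun_const)

text \<open>The two properties of a form in the coordinates of a frame that the vanishing arguments
  use: restriction to polynomial curves, and rescaling of points.\<close>

definition homogeneous_fun :: "nat \<Rightarrow> (complex \<Rightarrow> complex \<Rightarrow> complex \<Rightarrow> complex \<Rightarrow> complex) \<Rightarrow> bool" where
  "homogeneous_fun d p \<longleftrightarrow>
    (\<forall>Y Z H M. polynomial_fun Y \<longrightarrow> polynomial_fun Z \<longrightarrow> polynomial_fun H \<longrightarrow> polynomial_fun M \<longrightarrow>
      polynomial_fun (\<lambda>t. p (Y t) (Z t) (H t) (M t))) \<and>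
    (\<forall>l y z h m. p (l * y) (l * z) (l * h) (l * m) = l ^ d * p y z h m)"

lemma homogeneous_fun_comb:
  assumes "form d UNIV F"
  shows "homogeneous_fun d (\<lambda>y z h m. eval_mpoly F (comb E P W R y z h m))"
  unfolding homogeneous_fun_def
proof (intro conjI allI impI)
  fix Y Z H M :: "complex \<Rightarrow> complex"
  assume "polynomial_fun Y" "polynomial_fun Z" "polynomial_fun H" "polynomial_fun M"
  then show "polynomial_fun (\<lambda>t. eval_mpoly F (comb E P W R (Y t) (Z t) (H t) (M t)))"
    unfolding comb_def
    by (intro polynomial_fun_eval_mpoly) (simp, intro polynomial_fun_intros)
next
  fix l y z h m
  have "comb E P W R (l * y) (l * z) (l * h) (l * m) = l *s comb E P W R y z h m"
    by (simp add: comb_def vec_eq_iff algebra_simps)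
  then show "eval_mpoly F (comb E P W R (l * y) (l * z) (l * h) (l * m))
      = l ^ d * eval_mpoly F (comb E P W R y z h m)"
    using eval_form_scale[OF assms] by simp
qed

lemma infinite_range_power:
  fixes x :: complex
  assumes "norm x > 1"
  shows "infinite (range (\<lambda>k. x ^ k))"
proof (rule range_inj_infinite, rule injI)
  fix i j assume "x ^ i = x ^ j"
  then have "norm x ^ i = norm x ^ j"
    by (simp flip: norm_power)
  then show "i = j"
    using assms by simp
qed

lemma infinite_range_power_Suc:
  fixes x :: complex
  assumes "norm x > 1"
  shows "infinite (range (\<lambda>k. x ^ Suc k))"
proof (rule range_inj_infinite, rule injI)
  fix i j assume "x ^ Suc i = x ^ Suc j"
  then have "norm x ^ Suc i = norm x ^ Suc j"
    by (simp only: norm_power[symmetric])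
  then have "Suc i = Suc j"
    using assms by (simp only: power_inject_exp)
  then show "i = j" by simp
qed

section \<open>Vanishing on the three families, freeing one parameter at a time\<close>

context
  fixes d p
  assumes hom: "homogeneous_fun d p"
begin

lemma homogeneous_polynomial:
  "polynomial_fun Y \<Longrightarrow> polynomial_fun Z \<Longrightarrow> polynomial_fun H \<Longrightarrow> polynomial_fun M \<Longrightarrow>
    polynomial_fun (\<lambda>t. p (Y t) (Z t) (H t) (M t))"
  using hom by (auto simp: homogeneous_fun_def)

lemma homogeneous_scale: "p (l * y) (l * z) (l * h) (l * m) = l ^ d * p y z h m"
  using hom by (auto simp: homogeneous_fun_def)

lemma homogeneous_eq_0_scaled:
  assumes "p (l * y) (l * z) (l * h) (l * m) = 0" "l \<noteq> 0"
  shows "p y z h m = 0"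
  using assms by (simp add: homogeneous_scale)

lemma homogeneous_eq_0_if_m_1:
  assumes "\<And>y z h. p y z h 1 = 0"
  shows "p y z h m = 0"
proof (rule polynomial_fun_eq_0_nonzero[of "\<lambda>m. p y z h m"])
  show "polynomial_fun (p y z h)"
    by (intro homogeneous_polynomial polynomial_fun_intros)
  fix m :: complex assume "m \<noteq> 0"
  then show "p y z h m = 0"
    using assms[of "y / m" "z / m" "h / m"] homogeneous_eq_0_scaled[of "1 / m" y z h m] by simp
qed

lemma homogeneous_eq_0_if_h_1:
  assumes "\<And>y z m. p y z 1 m = 0"
  shows "p y z h m = 0"
proof (rule polynomial_fun_eq_0_nonzero[of "\<lambda>h. p y z h m"])
  show "polynomial_fun (\<lambda>h. p y z h m)"
    by (intro homogeneous_polynomial polynomial_fun_intros)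
  fix h :: complex assume "h \<noteq> 0"
  then show "p y z h m = 0"
    using assms[of "y / h" "z / h" "m / h"] homogeneous_eq_0_scaled[of "1 / h" y z h m] by simp
qed

text \<open>On \<open>m = 1\<close> the values \<open>h, u, v\<close> are birational coordinates,
  and each ranges over an infinite set independently of the others. They are freed in the order
  \<open>v\<close>, \<open>u\<close>, \<open>h\<close>.\<close>

lemma vanishing_torus_family:
  assumes c: "c \<noteq> 0" and inf: "infinite U" "0 \<notin> U"
    and van: "\<And>h u v y. h \<in> U \<Longrightarrow> u \<in> U \<Longrightarrow> v \<in> U \<Longrightarrow> y = ((v - \<beta> * u) / h - a * h - b) / c \<Longrightarrow>
      p y (u + f\<^sup>2 * h\<^sup>2 - y\<^sup>2) h 1 = 0"
  shows "p y z h m = 0"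
proof (rule homogeneous_eq_0_if_m_1)
  fix y z h
  have 1: "p y (u + f\<^sup>2 * h\<^sup>2 - y\<^sup>2) h 1 = 0" if hu: "h \<in> U" "u \<in> U" for h u y
  proof -
    let ?y = "\<lambda>v. ((v - \<beta> * u) / h - a * h - b) / c"
    define g where "g v = p (?y v) (u + f\<^sup>2 * h\<^sup>2 - (?y v)\<^sup>2) h 1" for v
    have "polynomial_fun g"
      unfolding g_def by (intro homogeneous_polynomial polynomial_fun_intros)
    then have g: "g v = 0" for v
      by (rule polynomial_fun_eq_0[OF _ inf(1)]) (use van hu in \<open>simp add: g_def\<close>)
    have "h \<noteq> 0" using hu inf by auto
    \<comment> \<open>The \<open>v\<close> at which the solved coordinate takes the prescribed value
      \<open>y\<close>.\<close>
    then have "?y ((c * y + b + a * h) * h + \<beta> * u) = y"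
      using c by simp
    then show ?thesis
      using g[of "(c * y + b + a * h) * h + \<beta> * u"] unfolding g_def by simp
  qed
  have 2: "p y z h 1 = 0" if h: "h \<in> U" for h y z
  proof -
    have "polynomial_fun (\<lambda>u. p y (u + f\<^sup>2 * h\<^sup>2 - y\<^sup>2) h 1)"
      by (intro homogeneous_polynomial polynomial_fun_intros)
    then have "p y ((z - f\<^sup>2 * h\<^sup>2 + y\<^sup>2) + f\<^sup>2 * h\<^sup>2 - y\<^sup>2) h 1 = 0"
      by (rule polynomial_fun_eq_0[OF _ inf(1)]) (use 1 h in blast)
    then show ?thesis by simp
  qed
  have "polynomial_fun (\<lambda>h. p y z h 1)"
    by (intro homogeneous_polynomial polynomial_fun_intros)
  then show "p y z h 1 = 0"
    by (rule polynomial_fun_eq_0[OF _ inf(1)]) (use 2 in blast)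
qed

text \<open>For fixed \<open>h\<close>, freeing \<open>j\<close> and \<open>w\<close> gives
  vanishing on the surface \<open>y^2 + z m = (1 + f h)^2\<close>. Homogeneity then turns the
  variation of \<open>h\<close> into a variation of this surface with \<open>h\<close> kept
  fixed.\<close>

lemma vanishing_pell_family:
  assumes b: "b \<noteq> 0" and \<beta>: "\<beta> \<noteq> 0" and inf: "infinite U" "0 \<notin> U" and nz: "\<And>h. h \<in> U \<Longrightarrow> 1 + 2 * f * h \<noteq> 0"
    and infW: "\<And>h. h \<in> U \<Longrightarrow> infinite (V h)"
    and van: "\<And>h w j m. h \<in> U \<Longrightarrow> w \<in> V h \<Longrightarrow> m = (\<beta> * (1 + 2 * f * h) * ((w - 1) / h) - a * h) / b \<Longrightarrow>
      p ((1 + f * h) + of_nat j * m) (- (2 * (1 + f * h) * of_nat j + (of_nat j)\<^sup>2 * m)) h m = 0"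
  shows "p y z h m = 0"
proof -
  have inf_nat: "infinite (range (of_nat :: nat \<Rightarrow> complex))"
    by (rule range_inj_infinite) (rule inj_of_nat)
  have 1: "p ((1 + f * h) + j * m) (- (2 * (1 + f * h) * j + j\<^sup>2 * m)) h m = 0" if h: "h \<in> U" for h j m
  proof -
    let ?m = "\<lambda>w. (\<beta> * (1 + 2 * f * h) * ((w - 1) / h) - a * h) / b"
    let ?p = "\<lambda>j m. p ((1 + f * h) + j * m) (- (2 * (1 + f * h) * j + j\<^sup>2 * m)) h m"
    have a: "?p j (?m w) = 0" if w: "w \<in> V h" for j w
    proof -
      have "polynomial_fun (\<lambda>j. ?p j (?m w))"
        by (intro homogeneous_polynomial polynomial_fun_intros)
      then show ?thesis
        by (rule polynomial_fun_eq_0[OF _ inf_nat]) (use van[OF h w refl] in auto)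
    qed
    have "polynomial_fun (\<lambda>w. ?p j (?m w))"
      by (intro homogeneous_polynomial polynomial_fun_intros)
    then have "?p j (?m w) = 0" for w
      by (rule polynomial_fun_eq_0[OF _ infW[OF h]]) (use a in blast)
    \<comment> \<open>The \<open>w\<close> for which \<open>?m w\<close> is the given
      \<open>m\<close>.\<close>
    moreover have "?m (1 + (b * m + a * h) * h / (\<beta> * (1 + 2 * f * h))) = m"
    proof -
      have "h \<noteq> 0" using h inf by auto
      then have "\<beta> * (1 + 2 * f * h) * ((b * m + a * h) * h / (\<beta> * (1 + 2 * f * h)) / h) = b * m + a * h"
        using nz[OF h] \<beta> by simp
      then show ?thesis
        using b by simp
    qed
    ultimately show ?thesis by metis
  qed
  \<comment> \<open>Rescaling a point from \<open>k\<close> in \<open>U\<close> to a fixed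
    \<open>h\<close> turns the equation of its surface into \<open>y^2 + z m = (s + f)^2 h^2\<close>
    with \<open>s = 1 / k\<close>. As \<open>s\<close> takes infinitely many values, it becomes a
    free parameter.\<close>
  have 2: "p y z h m = 0" if h: "h \<noteq> 0" and m: "m \<noteq> 0" for y z h m
  proof -
    let ?z = "\<lambda>s. ((s + f)\<^sup>2 * h\<^sup>2 - y\<^sup>2) / m"
    have infU: "infinite (inverse ` U)"
      using inf(1) finite_imageD[of inverse U] by (auto simp: inj_on_def)
    have poly: "polynomial_fun (\<lambda>s. p y (?z s) h m)"
      by (intro homogeneous_polynomial polynomial_fun_intros)
    have "p y (?z s) h m = 0" if s: "s \<in> inverse ` U" for s
    proof -
      obtain k where k: "k \<in> U" "s = inverse k"
        using s by blast
      have k0: "k \<noteq> 0" using k inf by auto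
      define l where "l = k / h"
      have l: "l \<noteq> 0" "l * h = k"
        using k0 h by (simp_all add: l_def)
      define r where "r = 1 + f * k"
      have sf: "(s + f) * k = r"
        using k0 by (simp add: k(2) r_def algebra_simps)
      define j where "j = (l * y - r) / (l * m)"
      have j: "j * (l * m) = l * y - r"
        using l m by (simp add: j_def)
      have y: "r + j * (l * m) = l * y"
        by (simp add: j)
      have "(- (2 * r * j + j\<^sup>2 * (l * m))) * (l * m) = - (2 * r * (j * (l * m)) + (j * (l * m))\<^sup>2)"
        by (simp add: power2_eq_square algebra_simps)
      also have "\<dots> = r\<^sup>2 - l\<^sup>2 * y\<^sup>2"
        unfolding j by (simp add: power2_eq_square algebra_simps)
      also have "\<dots> = (l * ?z s) * (l * m)"
      proof -
        have "(l * ?z s) * (l * m) = l\<^sup>2 * (?z s * m)"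
          by (simp add: power2_eq_square)
        also have "?z s * m = (s + f)\<^sup>2 * h\<^sup>2 - y\<^sup>2"
          using m by simp
        also have "l\<^sup>2 * ((s + f)\<^sup>2 * h\<^sup>2 - y\<^sup>2) = ((s + f) * (l * h))\<^sup>2 - l\<^sup>2 * y\<^sup>2"
          by (simp add: power2_eq_square algebra_simps)
        finally show ?thesis
          by (simp only: l(2) sf)
      qed
      finally have "- (2 * r * j + j\<^sup>2 * (l * m)) = l * ?z s"
        using mult_right_cancel[of "l * m"] l(1) m by (metis mult_eq_0_iff)
      with 1[OF k(1), of j "l * m"] y have "p (l * y) (l * ?z s) (l * h) (l * m) = 0"
        unfolding r_def[symmetric] l(2) by simp
      then show ?thesis
        using l(1) by (rule homogeneous_eq_0_scaled)
    qed
    with poly infU have s: "p y (?z s) h m = 0" for s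
      by (rule polynomial_fun_eq_0)
    \<comment> \<open>Every \<open>z\<close> is reached, by solving the equation of the surface for
      \<open>s\<close>.\<close>
    have "?z (csqrt ((z * m + y\<^sup>2) / h\<^sup>2) - f) = z"
      using h m by simp
    then show ?thesis
      using s by metis
  qed
  have 3: "p y z h m = 0" if h: "h \<noteq> 0" for y z h m
  proof (rule polynomial_fun_eq_0_nonzero[of "\<lambda>m. p y z h m"])
    show "polynomial_fun (\<lambda>m. p y z h m)"
      by (intro homogeneous_polynomial polynomial_fun_intros)
  qed (use 2 h in blast)
  show ?thesis
  proof (rule polynomial_fun_eq_0_nonzero[of "\<lambda>h. p y z h m"])
    show "polynomial_fun (\<lambda>h. p y z h m)"
      by (intro homogeneous_polynomial polynomial_fun_intros)
  qed (use 3 in blast)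
qed

text \<open>For fixed nonzero \<open>m\<close>, the parameters \<open>j\<close> and \<open>w\<close>
  determine \<open>y\<close> and \<open>z\<close> and can be recovered from them; so freeing both
  gives the whole slice \<open>h = 1\<close> with this \<open>m\<close>, and \<open>m\<close> is
  freed last.\<close>

lemma vanishing_congruence_family:
  assumes c0: "c0 \<noteq> 0" and inf: "infinite U" "0 \<notin> U" and infW: "\<And>m. m \<in> U \<Longrightarrow> infinite (V m)"
    and van: "\<And>m w j. m \<in> U \<Longrightarrow> w \<in> V m \<Longrightarrow>
      p (r + of_nat j * m) (c0 * ((w - 1) / m) - 2 * r * of_nat j - (of_nat j)\<^sup>2 * m) 1 m = 0"
  shows "p y z h m = 0"
proof (rule homogeneous_eq_0_if_h_1)
  fix y z m
  have inf_nat: "infinite (range (of_nat :: nat \<Rightarrow> complex))"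
    by (rule range_inj_infinite) (rule inj_of_nat)
  have 1: "p y z 1 m = 0" if m: "m \<in> U" for m y z
  proof -
    let ?p = "\<lambda>j w. p (r + j * m) (c0 * ((w - 1) / m) - 2 * r * j - j\<^sup>2 * m) 1 m"
    have a: "?p j w = 0" if w: "w \<in> V m" for j w
    proof -
      have "polynomial_fun (\<lambda>j. ?p j w)"
        by (intro homogeneous_polynomial polynomial_fun_intros)
      then show ?thesis
        by (rule polynomial_fun_eq_0[OF _ inf_nat]) (use van[OF m w] in auto)
    qed
    have b: "?p j w = 0" for j w
    proof -
      have "polynomial_fun (\<lambda>w. ?p j w)"
        by (intro homogeneous_polynomial polynomial_fun_intros)
      then show ?thesis
        by (rule polynomial_fun_eq_0[OF _ infW[OF m]]) (use a in blast)
    qed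
    have "m \<noteq> 0" using m inf by auto
    define j where "j = (y - r) / m"
    define w where "w = 1 + (z + 2 * r * j + j\<^sup>2 * m) * m / c0"
    have "r + j * m = y"
      using \<open>m \<noteq> 0\<close> by (simp add: j_def)
    moreover have "c0 * ((w - 1) / m) - 2 * r * j - j\<^sup>2 * m = z"
      using \<open>m \<noteq> 0\<close> c0 by (simp add: w_def)
    ultimately show ?thesis
      using b[of j w] by simp
  qed
  have "polynomial_fun (\<lambda>m. p y z 1 m)"
    by (intro homogeneous_polynomial polynomial_fun_intros)
  then show "p y z 1 m = 0"
    by (rule polynomial_fun_eq_0[OF _ inf(1)]) (use 1 in blast)
qed

end

section \<open>Integral points in the normal form\<close>

definition unit_in :: "complex set \<Rightarrow> complex \<Rightarrow> bool" where
  "unit_in R z \<longleftrightarrow> z \<noteq> 0 \<and> z \<in> R \<and> inverse z \<in> R"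

lemma unit_in_mem: "unit_in R z \<Longrightarrow> z \<in> R"
  and unit_in_nonzero: "unit_in R z \<Longrightarrow> z \<noteq> 0"
  by (simp_all add: unit_in_def)

lemma unit_in_1: "subring R \<Longrightarrow> unit_in R 1"
  by (simp add: unit_in_def subring_1)

lemma unit_in_mult: "subring R \<Longrightarrow> unit_in R x \<Longrightarrow> unit_in R y \<Longrightarrow> unit_in R (x * y)"
  by (simp add: unit_in_def subring_mult)

lemma unit_in_minus: "subring R \<Longrightarrow> unit_in R x \<Longrightarrow> unit_in R (- x)"
  by (simp add: unit_in_def subring_minus)

lemma unit_in_power: "subring R \<Longrightarrow> unit_in R x \<Longrightarrow> unit_in R (x ^ n)"
  by (induction n) (simp_all add: unit_in_1 unit_in_mult)

lemma subring_divide_unit: "subring R \<Longrightarrow> x \<in> R \<Longrightarrow> unit_in R y \<Longrightarrow> x / y \<in> R"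
  by (simp add: divide_inverse unit_in_def subring_mult)

text \<open>A geometric sum. Powers of a unit \<open>x\<close> are thus units congruent to 1 modulo
  \<open>x - 1\<close>. For \<open>x = 1\<close> the quotient is 0 by convention.\<close>

lemma subring_power_quotient: "subring R \<Longrightarrow> x \<in> R \<Longrightarrow> (x ^ k - 1) / (x - 1) \<in> R"
  by (cases "x = 1") (simp_all add: subring_0 subring_sum subring_power power_diff_1_eq)

theorem mainTheorem1:
  fixes K :: "complex set" and Q1 Q2 :: "4 mpoly" and C :: "(complex ^ 4) set"
  assumes "number_field K"
    and "form 2 K Q1" and "Q1 \<noteq> 0"
    and "form 2 K Q2" and "Q2 \<noteq> 0"
    and "smooth_conic C"
    and "reduced_component_of_intersection C Q1 Q2"
  shows "integral_points_potentially_dense K proj_space (zero_locus {Q1} \<union> zero_locus {Q2})"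
proof -
  from pencil_form_exists[OF assms(1,2,4,6,7)]
  obtain F G L A1 A2 E P W R \<alpha> \<beta> f a b c where
    FG: "(F, G) \<in> {(Q1, Q2), (Q2, Q1)}" and L: "number_field L" "K \<subseteq> L"
    and ev: "eval_mpoly F = quad A1" "eval_mpoly G = quad A2"
    and over: "vec_over L E" "vec_over L P" "vec_over L W" "vec_over L R"
    and const: "{\<alpha>, \<beta>, f, a, b, c} \<subseteq> L" and \<alpha>: "\<alpha> \<noteq> 0" and bc: "b \<noteq> 0 \<or> c \<noteq> 0"
    and pf: "pencil_form A1 A2 E P W R \<alpha> \<beta> f a b c 0"
    by (elim exE conjE)
  have D: "zero_locus {Q1} \<union> zero_locus {Q2} = zero_locus {F} \<union> zero_locus {G}"
    using FG by auto
  have forms: "form 2 K F" "form 2 K G"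
    using FG assms by auto
  \<comment> \<open>Everything that must be integral, with the nonzero elements becoming units: the
    constants of the normal form, the frame, the coefficients of both equations, and 2 as the source
    of units.\<close>
  define A where "A = {2, \<alpha>, \<beta>, f, a, b, c} \<union> range (($) E) \<union> range (($) P) \<union> range (($) W) \<union> range (($) R)
    \<union> Poly_Mapping.lookup F ` Poly_Mapping.keys F \<union> Poly_Mapping.lookup G ` Poly_Mapping.keys G"
  have "finite A"
    by (simp add: A_def)
  have "A \<subseteq> L"
    using const over forms L number_field_intros(11)[OF L(1)]
    by (auto simp: A_def vec_over_def form_def)
  define S where "S = bad_places L A"
  define Z where "Z = S_integers L S"
  have S: "archimedean_places L \<subseteq> S"
    by (auto simp: S_def bad_places_def)
  have sub: "subring Z"
    unfolding Z_def by (rule subring_S_integers[OF L(1) S])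
  have A_Z: "x \<in> Z" if "x \<in> A" for x
    using S_integers_bad_places(1)[OF L(1) \<open>A \<subseteq> L\<close> that] by (simp add: Z_def S_def)
  have A_unit: "unit_in Z x" if "x \<in> A" "x \<noteq> 0" for x
    using S_integers_bad_places[OF L(1) \<open>A \<subseteq> L\<close> that(1)] that(2) by (simp add: Z_def S_def unit_in_def)
  have Z_const: "\<alpha> \<in> Z" "\<beta> \<in> Z" "f \<in> Z" "a \<in> Z" "b \<in> Z" "c \<in> Z"
    by (auto intro!: A_Z simp: A_def)
  have unit_const: "unit_in Z 2" "unit_in Z \<alpha>" "\<beta> \<noteq> 0 \<Longrightarrow> unit_in Z \<beta>" "f \<noteq> 0 \<Longrightarrow> unit_in Z f"
    "a \<noteq> 0 \<Longrightarrow> unit_in Z a" "b \<noteq> 0 \<Longrightarrow> unit_in Z b" "c \<noteq> 0 \<Longrightarrow> unit_in Z c"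
    using \<alpha> by (auto simp: A_def intro!: A_unit)
  have unit_2: "unit_in Z (2 ^ n)" for n
    by (intro unit_in_power sub unit_const)
  have over_Z: "vec_over Z E" "vec_over Z P" "vec_over Z W" "vec_over Z R"
    by (auto simp: vec_over_def A_def intro!: A_Z)
  have forms_Z: "form 2 Z F" "form 2 Z G"
    using forms by (auto simp: form_def A_def intro!: A_Z)
  note Z_intros = subring_intros[OF sub] Z_const
  have spans: "\<exists>y z h m. x = comb E P W R y z h m" for x
    using pf by (auto simp: pencil_form_def)
  have q1: "quad A1 (comb E P W R y z h m) = \<alpha> * (y\<^sup>2 + z * m - f\<^sup>2 * h\<^sup>2)"
    and q2: "quad A2 (comb E P W R y z h m)
      = \<alpha> * (\<beta> * (y\<^sup>2 + z * m - f\<^sup>2 * h\<^sup>2) + h * (a * h + b * m + c * y))" for y z h m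
    using pf by (auto simp: pencil_form_def)
  show ?thesis
    unfolding D
  proof (rule potentially_denseI[OF L \<open>finite A\<close> \<open>A \<subseteq> L\<close>])
    fix d and \<Phi> :: "4 mpoly" and x
    assume \<Phi>: "form d UNIV \<Phi>"
      and van: "\<And>x. x \<in> integral_points L (bad_places L A) proj_space (zero_locus {F} \<union> zero_locus {G})
        \<Longrightarrow> eval_mpoly \<Phi> x = 0"
    define p where "p y z h m = eval_mpoly \<Phi> (comb E P W R y z h m)" for y z h m
    have hom: "homogeneous_fun d p"
      unfolding p_def by (rule homogeneous_fun_comb[OF \<Phi>])
    \<comment> \<open>\<open>u\<close> and \<open>v\<close> are the values of the quadrics divided
      by the unit \<alpha>. A nonzero value of \<open>F\<close> also shows that the vector is
      nonzero.\<close>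
    have pt: "p y z h m = 0"
      if yzhm: "y \<in> Z" "z \<in> Z" "h \<in> Z" "m \<in> Z" and u: "y\<^sup>2 + z * m - f\<^sup>2 * h\<^sup>2 = u" "unit_in Z u"
        and v: "\<beta> * u + h * (a * h + b * m + c * y) = v" "unit_in Z v" for y z h m u v
    proof -
      let ?x = "comb E P W R y z h m"
      have Fx: "eval_mpoly F ?x = \<alpha> * u" and Gx: "eval_mpoly G ?x = \<alpha> * v"
        unfolding ev q1 q2 u(1) v(1) by (rule refl)+
      have units: "unit_in Z (\<alpha> * u)" "unit_in Z (\<alpha> * v)"
        by (intro unit_in_mult sub unit_const u(2) v(2))+
      have "?x \<noteq> 0"
        using Fx units(1) by (auto simp: ev quad_def unit_in_def)
      moreover have "?x $ i \<in> Z" for i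
        using yzhm over_Z unfolding comb_def vec_over_def
        by (auto intro!: Z_intros)
      ultimately have "?x \<in> integral_points L S proj_space (zero_locus {F} \<union> zero_locus {G})"
        using forms_Z units unfolding Z_def by (intro integral_pointsI[OF L(1) S]) (auto simp: Fx Gx unit_in_def)
      then show ?thesis
        using van by (simp add: p_def S_def)
    qed
    \<comment> \<open>The exponent starts at 1: elements of \<open>X\<close> have infinitely many
      powers, and \<open>x - 1\<close>, from which parameters are built below, is never
      zero.\<close>
    define X where "X = range (\<lambda>n. 2 ^ Suc n :: complex)"
    have infinite_X: "infinite X"
      unfolding X_def by (rule infinite_range_power_Suc) simp
    have X_unit: "unit_in Z x" if "x \<in> X" for x
      using that by (auto simp only: X_def intro!: unit_2)
    have X_norm: "norm x > 1" if "x \<in> X" for x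
      using that by (auto simp only: X_def norm_power norm_numeral intro!: one_less_power)
    have X_not_1: "1 \<notin> X"
      using X_norm by force
    have X_infinite_powers: "infinite (range (\<lambda>k. x ^ k))" if "x \<in> X" for x
      using X_norm[OF that] by (rule infinite_range_power)
    have "p y z h m = 0" for y z h m
    proof -
      consider "c \<noteq> 0" | "c = 0" "b \<noteq> 0" "\<beta> \<noteq> 0" | "c = 0" "b \<noteq> 0" "\<beta> = 0"
        using bc by blast
      then show ?thesis
      proof cases
        case 1
        have X0: "0 \<notin> X"
          using unit_in_nonzero[OF X_unit] by blast
        show ?thesis
        proof (rule vanishing_torus_family[OF hom 1 infinite_X X0])
          fix h u v y
          assume huv: "h \<in> X" "u \<in> X" "v \<in> X" and y: "y = ((v - \<beta> * u) / h - a * h - b) / c"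
          have units: "unit_in Z h" "unit_in Z u" "unit_in Z v"
            using huv by (auto intro: X_unit)
          note mem = units[THEN unit_in_mem]
          have yO: "y \<in> Z"
            unfolding y using 1 by (intro Z_intros mem subring_divide_unit[OF sub] units unit_const) auto
          show "p y (u + f\<^sup>2 * h\<^sup>2 - y\<^sup>2) h 1 = 0"
          proof (rule pt[OF yO _ mem(1) _ _ units(2) _ units(3)])
            show "u + f\<^sup>2 * h\<^sup>2 - y\<^sup>2 \<in> Z"
              by (intro Z_intros mem yO)
            have "h * (a * h + b * 1 + c * y) = v - \<beta> * u"
              using 1 unit_in_nonzero[OF units(1)] by (simp add: y)
            then show "\<beta> * u + h * (a * h + b * 1 + c * y) = v"
              by simp
          qed (simp_all add: Z_intros)
        qed
      next
        case 2
        \<comment> \<open>For \<open>f \<noteq> 0\<close> the unit \<open>1 + \<kappa> h\<close> is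
          \<open>u\<close> itself. For \<open>f = 0\<close> the value \<open>u\<close> is constantly
          1, and \<open>1 + h\<close> takes over the task of supplying units congruent to 1 modulo
          \<open>h\<close>.\<close>
        define \<kappa> where "\<kappa> = (if f = 0 then 1 else 2 * f)"
        have \<kappa>: "unit_in Z \<kappa>"
          unfolding \<kappa>_def by (auto intro!: unit_in_1 unit_in_mult sub unit_const)
        let ?U = "(\<lambda>x. (x - 1) / \<kappa>) ` X" and ?V = "\<lambda>h. range (\<lambda>k. (1 + \<kappa> * h) ^ k)"
        have X: "1 + \<kappa> * h \<in> X" if "h \<in> ?U" for h
          using that unit_in_nonzero[OF \<kappa>] by auto
        show ?thesis
        proof (rule vanishing_pell_family[OF hom 2(2,3)])
          have "inj_on (\<lambda>x. (x - 1) / \<kappa>) X"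
            using unit_in_nonzero[OF \<kappa>] by (auto simp: inj_on_def)
          then show "infinite ?U"
            using infinite_X finite_imageD by blast
          show "0 \<notin> ?U"
            using X_not_1 unit_in_nonzero[OF \<kappa>] by auto
          show "infinite (?V h)" if "h \<in> ?U" for h
            using X_infinite_powers[OF X[OF that]] .
          have u: "unit_in Z (1 + 2 * f * h)" if "h \<in> ?U" for h
          proof (cases "f = 0")
            case True
            then show ?thesis by (simp add: unit_in_1 sub)
          next
            case False
            then show ?thesis
              using X_unit[OF X[OF that]] by (simp add: \<kappa>_def)
          qed
          then show "1 + 2 * f * h \<noteq> 0" if "h \<in> ?U" for h
            using unit_in_nonzero that by blast
          fix h w j m
          assume h: "h \<in> ?U" and w: "w \<in> ?V h"
            and m: "m = (\<beta> * (1 + 2 * f * h) * ((w - 1) / h) - a * h) / b"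
          let ?u = "1 + 2 * f * h" and ?r = "1 + f * h"
          obtain k where k: "w = (1 + \<kappa> * h) ^ k"
            using w by blast
          have "h \<noteq> 0"
            using h X_not_1 unit_in_nonzero[OF \<kappa>] by auto
          \<comment> \<open>The geometric quotient has denominator \<open>\<kappa> * h\<close>; the
            unit \<kappa> accounts for the difference.\<close>
          have "(w - 1) / h = \<kappa> * ((w - 1) / (\<kappa> * h))"
            using unit_in_nonzero[OF \<kappa>] by simp
          also have "\<dots> = \<kappa> * (((1 + \<kappa> * h) ^ k - 1) / ((1 + \<kappa> * h) - 1))"
            by (simp add: k)
          also have "\<dots> \<in> Z"
            by (intro subring_mult subring_power_quotient sub unit_in_mem[OF \<kappa>] unit_in_mem X_unit X h)
          finally have wh: "(w - 1) / h \<in> Z" .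
          have hO: "h \<in> Z"
          proof -
            have "h = ((1 + \<kappa> * h) - 1) / \<kappa>"
              using unit_in_nonzero[OF \<kappa>] by simp
            moreover have "((1 + \<kappa> * h) - 1) / \<kappa> \<in> Z"
              by (intro subring_divide_unit subring_diff subring_1 sub \<kappa> unit_in_mem[OF X_unit] X h)
            ultimately show ?thesis by simp
          qed
          have mO: "m \<in> Z"
            unfolding m using 2(2) by (intro subring_divide_unit[OF sub] Z_intros wh hO unit_const) auto
          have w_unit: "unit_in Z w"
            unfolding k by (intro unit_in_power sub X_unit X h)
          show "p (?r + of_nat j * m) (- (2 * ?r * of_nat j + (of_nat j)\<^sup>2 * m)) h m = 0"
          proof (rule pt[OF _ _ hO mO _ u[OF h]])
            show "?r + of_nat j * m \<in> Z" "- (2 * ?r * of_nat j + (of_nat j)\<^sup>2 * m) \<in> Z"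
              by (intro Z_intros hO mO)+
            show "(?r + of_nat j * m)\<^sup>2 + - (2 * ?r * of_nat j + (of_nat j)\<^sup>2 * m) * m - f\<^sup>2 * h\<^sup>2 = ?u"
              by (simp add: power2_eq_square algebra_simps)
            have "b * m = \<beta> * ?u * ((w - 1) / h) - a * h"
              using 2(2) by (simp add: m)
            then have "h * (a * h + b * m + c * (?r + of_nat j * m)) = h * (\<beta> * ?u * ((w - 1) / h))"
              by (simp add: 2(1))
            also have "\<dots> = \<beta> * ?u * (w - 1)"
              using \<open>h \<noteq> 0\<close> by simp
            finally show "\<beta> * ?u + h * (a * h + b * m + c * (?r + of_nat j * m)) = \<beta> * ?u * w"
              by (simp add: algebra_simps)
            show "unit_in Z (\<beta> * ?u * w)"
              using 2(3) by (intro unit_in_mult sub u[OF h] w_unit unit_const) auto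
          qed
        qed
      next
        case 3
        \<comment> \<open>Chosen to make \<open>r^2 - f^2\<close> a unit: it is 1 if
          \<open>f = 0\<close>, and minus the square of the unit \<open>f\<close> otherwise.\<close>
        define r where "r = (if f = 0 then 1 else 0 :: complex)"
        define c0 where "c0 = r\<^sup>2 - f\<^sup>2"
        have c0: "unit_in Z c0"
          unfolding c0_def r_def
          by (auto intro!: unit_in_minus unit_in_power unit_const sub simp: unit_in_1 sub)
        have rO: "r \<in> Z"
          by (simp add: r_def Z_intros)
        \<comment> \<open>The fourth coordinate solves \<open>y^2 + z m - f^2 = c0 w\<close> for
          \<open>y = r + j m\<close>: at \<open>y = r\<close> the difference is
          \<open>c0 (w - 1)\<close>, which is divisible by \<open>m\<close>.\<close>
        have fam: "p (r + of_nat j * m) (c0 * ((w - 1) / m) - 2 * r * of_nat j - (of_nat j)\<^sup>2 * m) 1 m = 0"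
          if m: "m \<in> Z" "m \<noteq> 0" "unit_in Z (a + b * m)" and w: "unit_in Z w" "(w - 1) / m \<in> Z" for m w j
        proof (rule pt[OF _ _ _ m(1)])
          show "r + of_nat j * m \<in> Z" "c0 * ((w - 1) / m) - 2 * r * of_nat j - (of_nat j)\<^sup>2 * m \<in> Z" "1 \<in> Z"
            by (intro Z_intros m w rO unit_in_mem[OF c0])+
          have "c0 * ((w - 1) / m) * m = c0 * (w - 1)"
            using m(2) by simp
          then show "(r + of_nat j * m)\<^sup>2 + (c0 * ((w - 1) / m) - 2 * r * of_nat j - (of_nat j)\<^sup>2 * m) * m
              - f\<^sup>2 * 1\<^sup>2 = c0 * w"
            unfolding left_diff_distrib by (simp add: c0_def power2_eq_square algebra_simps)
          show "unit_in Z (c0 * w)"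
            by (intro unit_in_mult sub c0 w)
          show "\<beta> * (c0 * w) + 1 * (a * 1 + b * m + c * (r + of_nat j * m)) = a + b * m"
            by (simp add: 3)
          show "unit_in Z (a + b * m)"
            by (rule m)
        qed
        show ?thesis
        proof (cases "a = 0")
          case True
          \<comment> \<open>Now \<open>v = b m\<close> is a unit for every \<open>m\<close> in
            \<open>X\<close>. The congruence modulo the unit \<open>m\<close> is void, so
            \<open>w\<close> ranges over \<open>X\<close> itself.\<close>
          show ?thesis
          proof (rule vanishing_congruence_family[OF hom unit_in_nonzero[OF c0] infinite_X])
            show "0 \<notin> X"
              using unit_in_nonzero[OF X_unit] by blast
            show "infinite X" by (rule infinite_X)
            fix m w j assume m: "m \<in> X" and w: "w \<in> X"
            show "p (r + of_nat j * m) (c0 * ((w - 1) / m) - 2 * r * of_nat j - (of_nat j)\<^sup>2 * m) 1 m = 0"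
            proof (rule fam)
              show "m \<in> Z" "m \<noteq> 0" "unit_in Z w"
                using X_unit[OF m] X_unit[OF w] by (auto simp: unit_in_def)
              show "unit_in Z (a + b * m)"
                using unit_in_mult[OF sub unit_const(6)[OF 3(2)] X_unit[OF m]] by (simp add: True)
              show "(w - 1) / m \<in> Z"
                by (intro subring_divide_unit sub subring_diff subring_1 unit_in_mem X_unit m w)
            qed
          qed
        next
          case False
          \<comment> \<open>\<open>m\<close> is determined by \<open>a + b m = a x\<close> with
            \<open>x\<close> in \<open>X\<close>. Then \<open>x - 1 = b m / a\<close>, so the powers
            of \<open>x\<close> are congruent to 1 modulo \<open>m\<close>.\<close>
          let ?U = "(\<lambda>x. a * (x - 1) / b) ` X" and ?V = "\<lambda>m. range (\<lambda>k. ((a + b * m) / a) ^ k)"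
          have X: "(a + b * m) / a \<in> X" if m: "m \<in> ?U" for m
          proof -
            obtain x where "x \<in> X" "m = a * (x - 1) / b"
              using m by blast
            moreover from this have "(a + b * m) / a = x"
              using False 3 by (simp add: field_simps)
            ultimately show ?thesis by simp
          qed
          have ab: "unit_in Z a" "unit_in Z b"
            using False 3 by (auto intro!: unit_const)
          show ?thesis
          proof (rule vanishing_congruence_family[OF hom unit_in_nonzero[OF c0]])
            have "inj_on (\<lambda>x. a * (x - 1) / b) X"
              using False 3 by (auto simp: inj_on_def)
            then show "infinite ?U"
              using infinite_X finite_imageD by blast
            show U0: "0 \<notin> ?U"
              using X_not_1 False 3 by auto
            show "infinite (?V m)" if "m \<in> ?U" for m
              by (rule X_infinite_powers[OF X[OF that]])
            fix m w j assume m: "m \<in> ?U" and w: "w \<in> ?V m"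
            obtain k where k: "w = ((a + b * m) / a) ^ k"
              using w by blast
            let ?x = "(a + b * m) / a"
            have bm: "b * m = a * (?x - 1)"
              using False by (simp add: field_simps)
            have m_eq: "m = a * (?x - 1) / b"
              unfolding bm[symmetric] using 3 by simp
            have "m \<noteq> 0"
              using m U0 by blast
            show "p (r + of_nat j * m) (c0 * ((w - 1) / m) - 2 * r * of_nat j - (of_nat j)\<^sup>2 * m) 1 m = 0"
            proof (rule fam[OF _ \<open>m \<noteq> 0\<close>])
              have "a * (?x - 1) / b \<in> Z"
                by (intro subring_divide_unit subring_mult subring_diff subring_1 sub ab unit_in_mem[OF ab(1)]
                    unit_in_mem[OF X_unit] X m)
              then show "m \<in> Z"
                using m_eq by simp
              have "unit_in Z (a * ?x)"
                by (intro unit_in_mult sub ab X_unit X m)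
              then show "unit_in Z (a + b * m)"
                using False by simp
              show "unit_in Z w"
                unfolding k by (intro unit_in_power sub X_unit X m)
              have "(b / a) * ((?x ^ k - 1) / (?x - 1)) \<in> Z"
                by (intro subring_divide_unit subring_mult subring_power_quotient sub ab unit_in_mem[OF ab(2)]
                    unit_in_mem[OF X_unit] X m)
              also have "(b / a) * ((?x ^ k - 1) / (?x - 1)) = (w - 1) / (a * (?x - 1) / b)"
                by (simp only: k) simp
              also have "a * (?x - 1) / b = m"
                using m_eq by simp
              finally show "(w - 1) / m \<in> Z" .
            qed
          qed
        qed
      qed
    qed
    then show "eval_mpoly \<Phi> x = 0"
      using spans[of x] by (auto simp: p_def)
  qed
qed

end
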